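(* Let $(M=B\times_f F,g^f)$ be a contravariant warped product space with bivector field $\Pi=\Pi_B+\Pi_F$, let $\mathcal D$ be the contravariant Levi-Civita connection associated with $(\Pi,g^f)$, and let $s_2=\dim F$. Let $\lambda$ be a real constant. Then $M$ is Einstein with $Ric=\lambda g^f$ if and only if there is a constant $\tilde\lambda$ such that the following three conditions hold: (a) $Ric_B=\lambda g_B+\dfrac{s_2}{f^2}\big[2A-fH^f_{\Pi_B}\big]$, where $A(\alpha_1,\beta_1)=g_B(J_1df,\alpha_1)\,g_B(J_1df,\beta_1)$ for $\alpha_1,\beta_1\in\Gamma(T^*B)$; (b) $(F,g_F)$ is Einstein with $Ric_F=\tilde\lambda g_F$; (c) $\tilde\lambda=\dfrac1{f^4}\big[\lambda f^2+(s_2+1)\|J_1df\|_B^2+f\Delta^{\mathcal D^B}(f)\big]$ on $B$.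
   Context: Contravariant geometry. Let $(N,\Pi)$ be a Poisson manifold with Poisson bivector field $\Pi$. The anchor map $\sharp_\Pi:T^*N\to TN$ is defined by $\beta(\sharp_\Pi(\alpha))=\Pi(\alpha,\beta)$. The Koszul bracket on 1-forms is $[\alpha,\beta]_\Pi=\mathcal L_{\sharp_\Pi(\alpha)}\beta-\mathcal L_{\sharp_\Pi(\beta)}\alpha-d(\Pi(\alpha,\beta))$. A pseudo-Riemannian metric $\tilde g$ on $N$ induces a metric $g$ on $T^*N$ (its cometric) through the isomorphism $X\mapsto\tilde g(X,\cdot)$. The contravariant Levi-Civita connection of $(\Pi,g)$ is the unique $\mathbb R$-bilinear map $\mathcal D:\Gamma(T^*N)\times\Gamma(T^*N)\to\Gamma(T^*N)$ with $\mathcal D_{u\alpha}\beta=u\mathcal D_\alpha\beta$, $\mathcal D_\alpha(u\beta)=u\mathcal D_\alpha\beta+\sharp_\Pi(\alpha)(u)\beta$ for $u\in C^\infty(N)$, $\mathcal D_\alpha\beta-\mathcal D_\beta\alpha=[\alpha,\beta]_\Pi$, and $\sharp_\Pi(\alpha)(g(\beta,\gamma))=g(\mathcal D_\alpha\beta,\gamma)+g(\beta,\mathcal D_\alpha\gamma)$. Its curvature is $\mathcal R(\alpha,\beta)\gamma=\mathcal D_\alpha\mathcal D_\beta\gamma-\mathcal D_\beta\mathcal D_\alpha\gamma-\mathcal D_{[\alpha,\beta]_\Pi}\gamma$. For a local $g$-orthonormal coframe $\{\eta_i\}$ with $\varepsilon_i=g(\eta_i,\eta_i)=\pm1$, the Ricci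 curvature is $Ric(\alpha,\beta)=\sum_i\varepsilon_i\,g(\mathcal R(\alpha,\eta_i)\eta_i,\beta)$. "Einstein" means $Ric=\lambda g$ for a constant $\lambda$. Warped products. Let $(B,\tilde g_B)$, $(F,\tilde g_F)$ be pseudo-Riemannian manifolds of positive dimensions with cometrics $g_B,g_F$ and Poisson bivector fields $\Pi_B,\Pi_F$; let $f>0$ be a smooth function on $B$ (the warping function), and let $\pi,\sigma$ be the projections of $B\times F$ onto $B$ and $F$. Put $u^h=u\circ\pi$, $\alpha_1^h=\pi^*\alpha_1$ for functions and 1-forms on $B$, and $w^v=w\circ\sigma$, $\alpha_2^v=\sigma^*\alpha_2$ for functions and 1-forms on $F$. On $M=B\times_fF$ (the manifold $B\times F$) one takes the warped metric $\tilde g^f=\pi^*\tilde g_B+(f^h)^2\sigma^*\tilde g_F$, whose cometric $g^f$ satisfies $g^f(\alpha_1^h,\beta_1^h)=g_B(\alpha_1,\beta_1)^h$, $g^f(\alpha_1^h,\beta_2^v)=0$, $g^f(\alpha_2^v,\beta_2^v)=\frac1{(f^h)^2}g_F(\alpha_2,\beta_2)^v$; the pair $(M,g^f)$ is called a contravariant warped product space. The Poisson bivector $\Pi=\Pi_B+\Pi_F$ on $M$ is given by $\Pi(\alpha_1^h,\beta_1^h)=\Pi_B(\alpha_1,\beta_1)^h$, $\Pi(\alpha_1^h,\beta_2^v)=0$, $\Pi(\alpha_2^v,\beta_2^v)=\Pi_F(\alpha_2,\beta_2)^v$. Notation. $\mathcal D^B$ is the contravariant Levi-Civita connection of $(\Pi_B,g_B)$;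 $Ric,Ric_B,Ric_F$ are the Ricci curvatures of $(M,\Pi,g^f)$, $(B,\Pi_B,g_B)$, $(F,\Pi_F,g_F)$. $J_1:T^*B\to T^*B$ is the field of endomorphisms with $\Pi_B(\alpha,\beta)=g_B(J_1\alpha,\beta)=-g_B(\alpha,J_1\beta)$. $\|J_1df\|_B^2=g_B(J_1df,J_1df)$. The contravariant Hessian is $H^f_{\Pi_B}(\alpha,\beta)=-g_B(\mathcal D^B_\alpha(J_1df),\beta)$, and the contravariant Laplacian is $\Delta^{\mathcal D^B}(f)=-\sum_i\varepsilon_iH^f_{\Pi_B}(\eta_i,\eta_i)=\sum_i\varepsilon_i\,g_B(\mathcal D^B_{\eta_i}(J_1df),\eta_i)$ for a local $g_B$-orthonormal coframe $\{\eta_i\}$ of $B$ with $\varepsilon_i=g_B(\eta_i,\eta_i)$. *)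

theory Defs
  imports "HOL-Analysis.Analysis"
begin

section \<open>Smooth functions on open subsets of normed spaces\<close>

text \<open>Intended for open sets in finite-dimensional spaces, where \<open>Ck_on n\<close> is the usual
  class of \<open>n\<close> times continuously differentiable functions.\<close>

primrec Ck_on ::
  "nat \<Rightarrow> 'e::real_normed_vector set \<Rightarrow> ('e \<Rightarrow> 'v::real_normed_vector) \<Rightarrow> bool" where
  "Ck_on 0 S h \<longleftrightarrow> continuous_on S h"
| "Ck_on (Suc n) S h \<longleftrightarrow> (\<forall>x\<in>S. h differentiable (at x)) \<and>
     (\<forall>v. Ck_on n S (\<lambda>x. frechet_derivative h (at x) v))"

definition smooth_on :: "'e::real_normed_vector set \<Rightarrow> ('e \<Rightarrow> 'v::real_normed_vector) \<Rightarrow> bool" where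
  "smooth_on S h \<longleftrightarrow> (\<forall>n. Ck_on n S h)"

section \<open>Smooth manifolds\<close>

text \<open>A manifold structure on the topological space \<open>'a\<close>, modelled on \<open>'e\<close>, is given by an atlas
  indexed by the points: \<open>M p\<close> is a chart (domain and coordinate map) around \<open>p\<close>. Every smooth atlas
  contains such a family, and this family already determines the smooth structure. The index fixes a
  preferred chart at each point, through which the tangent space at \<open>p\<close> is identified with \<open>'e\<close>
  and the cotangent space with \<open>'e \<Rightarrow>\<^sub>L real\<close>. The model space is a Euclidean space, so the
  dimension \<open>DIM('e)\<close> is positive.\<close>

type_synonym ('a, 'e) mfd = "'a \<Rightarrow> 'a set \<times> ('a \<Rightarrow> 'e)"

definition cdom :: "('a, 'e) mfd \<Rightarrow> 'a \<Rightarrow> 'a set" where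
  "cdom M a = fst (M a)"

definition cmap :: "('a, 'e) mfd \<Rightarrow> 'a \<Rightarrow> 'a \<Rightarrow> 'e" where
  "cmap M a = snd (M a)"

definition cinv :: "('a, 'e) mfd \<Rightarrow> 'a \<Rightarrow> 'e \<Rightarrow> 'a" where
  "cinv M a = inv_into (cdom M a) (cmap M a)"

definition smooth_manifold ::
  "('a::{t2_space, second_countable_topology}, 'e::euclidean_space) mfd \<Rightarrow> bool" where
  "smooth_manifold M \<longleftrightarrow>
     (\<forall>a. a \<in> cdom M a \<and> open (cdom M a) \<and> open (cmap M a ` cdom M a) \<and>
          homeomorphism (cdom M a) (cmap M a ` cdom M a) (cmap M a) (cinv M a)) \<and>
     (\<forall>a b. smooth_on (cmap M a ` (cdom M a \<inter> cdom M b)) (cmap M b \<circ> cinv M a))"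

definition prod_mfd ::
  "('a, 'e) mfd \<Rightarrow> ('b, 'f) mfd \<Rightarrow> ('a \<times> 'b, 'e \<times> 'f) mfd" where
  "prod_mfd M N = (\<lambda>(a, b). (cdom M a \<times> cdom N b, map_prod (cmap M a) (cmap N b)))"

definition smooth_fun_on ::
  "('a, 'e::euclidean_space) mfd \<Rightarrow> 'a set \<Rightarrow> ('a \<Rightarrow> 'v::real_normed_vector) \<Rightarrow> bool" where
  "smooth_fun_on M U u \<longleftrightarrow> (\<forall>a. smooth_on (cmap M a ` (U \<inter> cdom M a)) (u \<circ> cinv M a))"

abbreviation smooth_fun :: "('a, 'e::euclidean_space) mfd \<Rightarrow> ('a \<Rightarrow> real) \<Rightarrow> bool" where
  "smooth_fun M u \<equiv> smooth_fun_on M UNIV u"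

definition tangent_map ::
  "('a, 'e::euclidean_space) mfd \<Rightarrow> ('b, 'f::euclidean_space) mfd \<Rightarrow> ('a \<Rightarrow> 'b) \<Rightarrow> 'a \<Rightarrow> 'e \<Rightarrow>\<^sub>L 'f" where
  "tangent_map M N h p =
     Blinfun (frechet_derivative (cmap N (h p) \<circ> h \<circ> cinv M p) (at (cmap M p p)))"

definition differential ::
  "('a, 'e::euclidean_space) mfd \<Rightarrow> ('a \<Rightarrow> real) \<Rightarrow> 'a \<Rightarrow> 'e \<Rightarrow>\<^sub>L real" where
  "differential M u p = Blinfun (frechet_derivative (u \<circ> cinv M p) (at (cmap M p p)))"

text \<open>Jacobian at \<open>p\<close> of the change from the chart \<open>M a\<close> to the chart \<open>M b\<close>. As tangent vectors
  at \<open>p\<close> are expressed in the chart \<open>M p\<close>, the field with constant components \<open>v\<close> in the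
  chart \<open>M a\<close> is \<open>coord_field M a v\<close>, and \<open>coord_comp M a X\<close> are the components
  of \<open>X\<close> in the chart \<open>M a\<close>; both are meaningful on \<open>cdom M a\<close> only.\<close>

definition coord_change :: "('a, 'e::euclidean_space) mfd \<Rightarrow> 'a \<Rightarrow> 'a \<Rightarrow> 'a \<Rightarrow> 'e \<Rightarrow>\<^sub>L 'e" where
  "coord_change M a b p = Blinfun (frechet_derivative (cmap M b \<circ> cinv M a) (at (cmap M a p)))"

definition coord_field :: "('a, 'e::euclidean_space) mfd \<Rightarrow> 'a \<Rightarrow> 'e \<Rightarrow> 'a \<Rightarrow> 'e" where
  "coord_field M a v = (\<lambda>p. blinfun_apply (coord_change M a p p) v)"

definition coord_comp :: "('a, 'e::euclidean_space) mfd \<Rightarrow> 'a \<Rightarrow> ('a \<Rightarrow> 'e) \<Rightarrow> 'a \<Rightarrow> 'e" where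
  "coord_comp M a X = (\<lambda>p. blinfun_apply (coord_change M p a p) (X p))"

definition coord_form ::
  "('a, 'e::euclidean_space) mfd \<Rightarrow> 'a \<Rightarrow> ('e \<Rightarrow>\<^sub>L real) \<Rightarrow> 'a \<Rightarrow> 'e \<Rightarrow>\<^sub>L real" where
  "coord_form M a \<omega> = (\<lambda>p. \<omega> o\<^sub>L coord_change M p a p)"

section \<open>Tensor fields\<close>

type_synonym ('a, 'e) form = "'a \<Rightarrow> ('e \<Rightarrow>\<^sub>L real)"
type_synonym ('a, 'e) bivector = "'a \<Rightarrow> ('e \<Rightarrow>\<^sub>L real) \<Rightarrow> ('e \<Rightarrow>\<^sub>L real) \<Rightarrow> real"
type_synonym ('a, 'e) metric = "'a \<Rightarrow> 'e \<Rightarrow> 'e \<Rightarrow> real"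
type_synonym ('a, 'e) cometric = "'a \<Rightarrow> ('e \<Rightarrow>\<^sub>L real) \<Rightarrow> ('e \<Rightarrow>\<^sub>L real) \<Rightarrow> real"
type_synonym ('a, 'e) connection = "('a, 'e) form \<Rightarrow> ('a, 'e) form \<Rightarrow> ('a, 'e) form"

definition one_forms :: "('a, 'e::euclidean_space) mfd \<Rightarrow> ('a, 'e) form set" where
  "one_forms M = {\<alpha>. \<forall>a v. smooth_fun_on M (cdom M a) (\<lambda>p. blinfun_apply (\<alpha> p) (coord_field M a v p))}"

definition bivector_field :: "('a, 'e::euclidean_space) mfd \<Rightarrow> ('a, 'e) bivector \<Rightarrow> bool" where
  "bivector_field M P \<longleftrightarrow>
     (\<forall>p. bilinear (P p) \<and> (\<forall>\<omega> \<tau>. P p \<omega> \<tau> = - P p \<tau> \<omega>)) \<and>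
     (\<forall>a \<omega> \<tau>. smooth_fun_on M (cdom M a) (\<lambda>p. P p (coord_form M a \<omega> p) (coord_form M a \<tau> p)))"

definition pseudo_riemannian :: "('a, 'e::euclidean_space) mfd \<Rightarrow> ('a, 'e) metric \<Rightarrow> bool" where
  "pseudo_riemannian M G \<longleftrightarrow>
     (\<forall>p. bilinear (G p) \<and> (\<forall>v w. G p v w = G p w v) \<and>
          (\<forall>v. (\<forall>w. G p v w = 0) \<longrightarrow> v = 0)) \<and>
     (\<forall>a v w. smooth_fun_on M (cdom M a) (\<lambda>p. G p (coord_field M a v p) (coord_field M a w p)))"

definition metric_raise :: "('a, 'e::euclidean_space) metric \<Rightarrow> 'a \<Rightarrow> ('e \<Rightarrow>\<^sub>L real) \<Rightarrow> 'e" where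
  "metric_raise G p \<omega> = (THE v. \<forall>w. G p v w = blinfun_apply \<omega> w)"

definition cometric :: "('a, 'e::euclidean_space) metric \<Rightarrow> ('a, 'e) cometric" where
  "cometric G p \<omega> \<tau> = G p (metric_raise G p \<omega>) (metric_raise G p \<tau>)"

section \<open>Poisson structures and the Koszul bracket\<close>

definition poisson_bracket ::
  "('a, 'e::euclidean_space) mfd \<Rightarrow> ('a, 'e) bivector \<Rightarrow> ('a \<Rightarrow> real) \<Rightarrow> ('a \<Rightarrow> real) \<Rightarrow> 'a \<Rightarrow> real" where
  "poisson_bracket M P u w p = P p (differential M u p) (differential M w p)"

definition poisson :: "('a, 'e::euclidean_space) mfd \<Rightarrow> ('a, 'e) bivector \<Rightarrow> bool" where
  "poisson M P \<longleftrightarrow> bivector_field M P \<and>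
     (\<forall>u v w. smooth_fun M u \<longrightarrow> smooth_fun M v \<longrightarrow> smooth_fun M w \<longrightarrow>
       (\<forall>p. poisson_bracket M P u (poisson_bracket M P v w) p +
            poisson_bracket M P v (poisson_bracket M P w u) p +
            poisson_bracket M P w (poisson_bracket M P u v) p = 0))"

definition anchor :: "('a, 'e::euclidean_space) bivector \<Rightarrow> ('a, 'e) form \<Rightarrow> 'a \<Rightarrow> 'e" where
  "anchor P \<alpha> p = (THE v. \<forall>\<beta>. blinfun_apply \<beta> v = P p (\<alpha> p) \<beta>)"

definition deriv_along ::
  "('a, 'e::euclidean_space) mfd \<Rightarrow> ('a \<Rightarrow> 'e) \<Rightarrow> ('a \<Rightarrow> real) \<Rightarrow> 'a \<Rightarrow> real" where
  "deriv_along M X u p = blinfun_apply (differential M u p) (X p)"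

definition lie_bracket ::
  "('a, 'e::euclidean_space) mfd \<Rightarrow> ('a \<Rightarrow> 'e) \<Rightarrow> ('a \<Rightarrow> 'e) \<Rightarrow> 'a \<Rightarrow> 'e" where
  "lie_bracket M X Y p =
     frechet_derivative (coord_comp M p Y \<circ> cinv M p) (at (cmap M p p)) (X p) -
     frechet_derivative (coord_comp M p X \<circ> cinv M p) (at (cmap M p p)) (Y p)"

text \<open>The formula \<open>(\<L>\<^sub>X \<beta>)(Y) = X(\<beta>(Y)) - \<beta>([X, Y])\<close> is tensorial in \<open>Y\<close>; it is evaluated at \<open>p\<close> on
  the local extension of the tangent vector \<open>v\<close> with constant components in the chart at \<open>p\<close>.\<close>

definition lie_derivative ::
  "('a, 'e::euclidean_space) mfd \<Rightarrow> ('a \<Rightarrow> 'e) \<Rightarrow> ('a, 'e) form \<Rightarrow> ('a, 'e) form" where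
  "lie_derivative M X \<beta> p = Blinfun (\<lambda>v.
     deriv_along M X (\<lambda>q. blinfun_apply (\<beta> q) (coord_field M p v q)) p -
     blinfun_apply (\<beta> p) (lie_bracket M X (coord_field M p v) p))"

definition koszul ::
  "('a, 'e::euclidean_space) mfd \<Rightarrow> ('a, 'e) bivector \<Rightarrow> ('a, 'e) form \<Rightarrow> ('a, 'e) form \<Rightarrow> ('a, 'e) form" where
  "koszul M P \<alpha> \<beta> = (\<lambda>p.
     lie_derivative M (anchor P \<alpha>) \<beta> p - lie_derivative M (anchor P \<beta>) \<alpha> p -
     differential M (\<lambda>q. P q (\<alpha> q) (\<beta> q)) p)"

section \<open>The contravariant Levi-Civita connection and its curvature\<close>

definition contravariant_levi_civita ::
  "('a, 'e::euclidean_space) mfd \<Rightarrow> ('a, 'e) bivector \<Rightarrow> ('a, 'e) cometric \<Rightarrow> ('a, 'e) connection \<Rightarrow> bool" where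
  "contravariant_levi_civita M P g D \<longleftrightarrow>
     (\<forall>\<alpha>\<in>one_forms M. \<forall>\<beta>\<in>one_forms M. D \<alpha> \<beta> \<in> one_forms M) \<and>
     (\<forall>\<alpha>\<in>one_forms M. \<forall>\<alpha>'\<in>one_forms M. \<forall>\<beta>\<in>one_forms M. \<forall>r s::real.
        D (\<lambda>p. r *\<^sub>R \<alpha> p + s *\<^sub>R \<alpha>' p) \<beta> = (\<lambda>p. r *\<^sub>R D \<alpha> \<beta> p + s *\<^sub>R D \<alpha>' \<beta> p) \<and>
        D \<beta> (\<lambda>p. r *\<^sub>R \<alpha> p + s *\<^sub>R \<alpha>' p) = (\<lambda>p. r *\<^sub>R D \<beta> \<alpha> p + s *\<^sub>R D \<beta> \<alpha>' p)) \<and>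
     (\<forall>\<alpha>\<in>one_forms M. \<forall>\<beta>\<in>one_forms M. \<forall>u. smooth_fun M u \<longrightarrow>
        D (\<lambda>p. u p *\<^sub>R \<alpha> p) \<beta> = (\<lambda>p. u p *\<^sub>R D \<alpha> \<beta> p) \<and>
        D \<alpha> (\<lambda>p. u p *\<^sub>R \<beta> p) =
          (\<lambda>p. u p *\<^sub>R D \<alpha> \<beta> p + deriv_along M (anchor P \<alpha>) u p *\<^sub>R \<beta> p)) \<and>
     (\<forall>\<alpha>\<in>one_forms M. \<forall>\<beta>\<in>one_forms M. \<forall>p. D \<alpha> \<beta> p - D \<beta> \<alpha> p = koszul M P \<alpha> \<beta> p) \<and>
     (\<forall>\<alpha>\<in>one_forms M. \<forall>\<beta>\<in>one_forms M. \<forall>\<gamma>\<in>one_forms M. \<forall>p.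
        deriv_along M (anchor P \<alpha>) (\<lambda>q. g q (\<beta> q) (\<gamma> q)) p =
          g p (D \<alpha> \<beta> p) (\<gamma> p) + g p (\<beta> p) (D \<alpha> \<gamma> p))"

definition curvature ::
  "('a, 'e::euclidean_space) mfd \<Rightarrow> ('a, 'e) bivector \<Rightarrow> ('a, 'e) connection \<Rightarrow>
     ('a, 'e) form \<Rightarrow> ('a, 'e) form \<Rightarrow> ('a, 'e) form \<Rightarrow> ('a, 'e) form" where
  "curvature M P D \<alpha> \<beta> \<gamma> = (\<lambda>p.
     D \<alpha> (D \<beta> \<gamma>) p - D \<beta> (D \<alpha> \<gamma>) p - D (koszul M P \<alpha> \<beta>) \<gamma> p)"

text \<open>Connections act on global 1-forms, so a local coframe near \<open>p\<close> is represented by global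
  1-forms that are orthonormal on a neighbourhood of \<open>p\<close> (after shrinking the neighbourhood every
  local coframe is the restriction of such a family). Since the operators involved are local and
  tensorial, the choice made in \<open>local_coframe\<close> is immaterial.\<close>

definition orthonormal_coframe ::
  "('a, 'e::euclidean_space) mfd \<Rightarrow> ('a, 'e) cometric \<Rightarrow> 'a set \<Rightarrow> (nat \<Rightarrow> ('a, 'e) form) \<Rightarrow> bool" where
  "orthonormal_coframe M g U \<eta> \<longleftrightarrow>
     (\<forall>i<DIM('e). \<eta> i \<in> one_forms M) \<and>
     (\<forall>p\<in>U. \<forall>i<DIM('e). g p (\<eta> i p) (\<eta> i p) \<in> {1, -1}) \<and>
     (\<forall>p\<in>U. \<forall>i<DIM('e). \<forall>j<DIM('e). i \<noteq> j \<longrightarrow> g p (\<eta> i p) (\<eta> j p) = 0)"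

definition local_coframe ::
  "('a::topological_space, 'e::euclidean_space) mfd \<Rightarrow> ('a, 'e) cometric \<Rightarrow> 'a \<Rightarrow> nat \<Rightarrow> ('a, 'e) form" where
  "local_coframe M g p = (SOME \<eta>. \<exists>U. open U \<and> p \<in> U \<and> orthonormal_coframe M g U \<eta>)"

definition ricci ::
  "('a::topological_space, 'e::euclidean_space) mfd \<Rightarrow> ('a, 'e) bivector \<Rightarrow> ('a, 'e) cometric \<Rightarrow>
     ('a, 'e) connection \<Rightarrow> ('a, 'e) form \<Rightarrow> ('a, 'e) form \<Rightarrow> 'a \<Rightarrow> real" where
  "ricci M P g D \<alpha> \<beta> p = (let \<eta> = local_coframe M g p in
     \<Sum>i<DIM('e). g p (\<eta> i p) (\<eta> i p) * g p (curvature M P D \<alpha> (\<eta> i) (\<eta> i) p) (\<beta> p))"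

definition einstein ::
  "('a::topological_space, 'e::euclidean_space) mfd \<Rightarrow> ('a, 'e) bivector \<Rightarrow> ('a, 'e) cometric \<Rightarrow>
     ('a, 'e) connection \<Rightarrow> real \<Rightarrow> bool" where
  "einstein M P g D c \<longleftrightarrow>
     (\<forall>\<alpha>\<in>one_forms M. \<forall>\<beta>\<in>one_forms M. \<forall>p. ricci M P g D \<alpha> \<beta> p = c * g p (\<alpha> p) (\<beta> p))"

definition J_field ::
  "('a, 'e::euclidean_space) bivector \<Rightarrow> ('a, 'e) cometric \<Rightarrow> ('a, 'e) form \<Rightarrow> ('a, 'e) form" where
  "J_field P g \<alpha> p = (THE \<tau>. \<forall>\<beta>. P p (\<alpha> p) \<beta> = g p \<tau> \<beta>)"

definition contravariant_hessian ::
  "('a, 'e::euclidean_space) mfd \<Rightarrow> ('a, 'e) bivector \<Rightarrow> ('a, 'e) cometric \<Rightarrow> ('a, 'e) connection \<Rightarrow>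
     ('a \<Rightarrow> real) \<Rightarrow> ('a, 'e) form \<Rightarrow> ('a, 'e) form \<Rightarrow> 'a \<Rightarrow> real" where
  "contravariant_hessian M P g D f \<alpha> \<beta> p = - g p (D \<alpha> (J_field P g (differential M f)) p) (\<beta> p)"

definition contravariant_laplacian ::
  "('a::topological_space, 'e::euclidean_space) mfd \<Rightarrow> ('a, 'e) bivector \<Rightarrow> ('a, 'e) cometric \<Rightarrow>
     ('a, 'e) connection \<Rightarrow> ('a \<Rightarrow> real) \<Rightarrow> 'a \<Rightarrow> real" where
  "contravariant_laplacian M P g D f p = (let \<eta> = local_coframe M g p in
     - (\<Sum>i<DIM('e). g p (\<eta> i p) (\<eta> i p) * contravariant_hessian M P g D f (\<eta> i) (\<eta> i) p))"

section \<open>Warped products\<close>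

definition pullback_metric ::
  "('a, 'e::euclidean_space) mfd \<Rightarrow> ('b, 'f::euclidean_space) mfd \<Rightarrow> ('a \<Rightarrow> 'b) \<Rightarrow>
     ('b, 'f) metric \<Rightarrow> ('a, 'e) metric" where
  "pullback_metric M N h G p v w = 
     G (h p) (blinfun_apply (tangent_map M N h p) v) (blinfun_apply (tangent_map M N h p) w)"

definition warped_metric ::
  "('a, 'e::euclidean_space) mfd \<Rightarrow> ('b, 'f::euclidean_space) mfd \<Rightarrow> ('a \<Rightarrow> real) \<Rightarrow>
     ('a, 'e) metric \<Rightarrow> ('b, 'f) metric \<Rightarrow> ('a \<times> 'b, 'e \<times> 'f) metric" where
  "warped_metric B F f GB GF z v w =
     pullback_metric (prod_mfd B F) B fst GB z v w +
     (f (fst z))\<^sup>2 * pullback_metric (prod_mfd B F) F snd GF z v w"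

text \<open>The bivector field \<open>\<Pi>\<^sub>B + \<Pi>\<^sub>F\<close>: covectors of the product at \<open>(p, q)\<close> are restricted to the
  slices \<open>B \<times> {q}\<close> and \<open>{p} \<times> F\<close>. As forms lifted from one factor vanish on the slices of the
  other one, this gives \<open>\<Pi>\<^sub>B\<close>, \<open>\<Pi>\<^sub>F\<close> and \<open>0\<close> on pairs of lifted forms.\<close>

definition sum_bivector ::
  "('a, 'e::euclidean_space) mfd \<Rightarrow> ('b, 'f::euclidean_space) mfd \<Rightarrow>
     ('a, 'e) bivector \<Rightarrow> ('b, 'f) bivector \<Rightarrow> ('a \<times> 'b, 'e \<times> 'f) bivector" where
  "sum_bivector B F PB PF = (\<lambda>(p, q) \<omega> \<tau>.
     (let i = tangent_map B (prod_mfd B F) (\<lambda>x. (x, q)) p;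
          j = tangent_map F (prod_mfd B F) (\<lambda>y. (p, y)) q
      in PB p (\<omega> o\<^sub>L i) (\<tau> o\<^sub>L i) + PF q (\<omega> o\<^sub>L j) (\<tau> o\<^sub>L j)))"

end

theory Submission
  imports Defs
begin

text \<open>
  The Koszul formula determines the connection of the warped product on lifted forms. With
  \<open>\<omega> = J\<^sub>1 df\<close> and \<open>\<alpha>, \<beta>\<close> lifted from \<open>B\<close>, \<open>U, V\<close> lifted from \<open>F\<close>, it reads
  \<open>D \<alpha> \<beta> = D\<^sup>B \<alpha> \<beta>\<close>, \<open>D \<alpha> U = D U \<alpha> = g\<^sub>B(\<omega>, \<alpha>) / f * U\<close> and
  \<open>D U V = D\<^sup>F U V - g\<^sub>F(U, V) / f\<^sup>3 * \<omega>\<close>. The resulting curvature, traced over a coframe of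
  lifted forms, has vanishing mixed Ricci terms, and its two diagonal blocks give the conditions on
  \<open>Ric\<^sub>B\<close> and \<open>Ric\<^sub>F\<close>. In the second block the factor of \<open>g\<^sub>F\<close> depends on the point of \<open>B\<close>
  only while \<open>Ric\<^sub>F\<close> depends on the point of \<open>F\<close> only, so it is a constant.

  Two facts let the forms of the product be replaced by lifted ones. First, bump functions turn
  \<open>C\<^sup>\<infinity>\<close>-linearity into pointwise dependence, so an identity between tensorial expressions need only
  be checked on differentials, where the Koszul bracket is \<open>[du, dw] = d{u, w}\<close>. Secondly, the curvature
  is tensorial in its last argument because the anchor preserves brackets, which is the Jacobi
  identity of the product and follows from those of the factors in the same way.
\<close>

section \<open>Calculus of smooth functions\<close>

text \<open>The connection \<open>D\<close> acts on global 1-forms, and locality is not part of its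
  definition. Every local object (coordinate forms, orthonormal frames, functions with a prescribed
  differential) must therefore be made global by a cut-off before \<open>D\<close> can be applied to
  it. For the same reason \<open>ricci\<close> traces over global forms picked by Hilbert choice:
  suitable forms must be shown to exist, which for an indefinite metric needs a Gram-Schmidt process
  that avoids isotropic vectors, and the trace must be shown not to depend on the choice.

  That the product is Poisson is not immediate: a function on the product is in general no sum of
  lifted functions. Only its differential at one point is the differential of such a sum, so the
  Jacobi identity is inherited once the jacobiator is known to depend on differentials alone.

  The constants come from derivatives of powers of \<open>f\<close>: the 2 in front of
  \<open>A\<close> is 3 - 1, with 3 from differentiating 1/f^3, and \<open>s2 + 1\<close> is 2 +
  (\<open>s2\<close> - 1), with 2 from the trace over the base and \<open>s2\<close> - 1 from the
  trace over the fibre.\<close>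

lemma frechet_derivative_cong_open:
  assumes "open S" "x \<in> S" "\<And>y. y \<in> S \<Longrightarrow> h y = k y"
  shows "frechet_derivative h (at x) = frechet_derivative k (at x)"
proof -
  have "(h has_derivative D) (at x) \<longleftrightarrow> (k has_derivative D) (at x)" for D
    using has_derivative_transform_within_open[OF _ assms(1,2)] assms(3) by metis
  then show ?thesis by (simp add: frechet_derivative_def)
qed

lemma differentiable_cong_open:
  assumes "open S" "x \<in> S" "\<And>y. y \<in> S \<Longrightarrow> h y = k y" "h differentiable (at x)"
  shows "k differentiable (at x)"
proof -
  obtain D where "(h has_derivative D) (at x)" using assms(4) unfolding differentiable_def by blast
  from has_derivative_transform_within_open[OF this assms(1,2)] assms(3)
  show ?thesis unfolding differentiable_def by blast
qed

text \<open>Derivatives in \<open>Ck_on\<close> are taken at points of the whole space and not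
  within \<open>S\<close>; agreement on \<open>S\<close> passes on to them because \<open>S\<close>
  is open.\<close>

lemma Ck_on_cong:
  assumes "open S" "\<And>x. x \<in> S \<Longrightarrow> h x = k x" "Ck_on n S h"
  shows "Ck_on n S k"
  using assms(2,3)
proof (induction n arbitrary: h k)
  case 0
  then show ?case by (simp cong: continuous_on_cong)
next
  case (Suc n)
  have "Ck_on n S (\<lambda>x. frechet_derivative k (at x) v)" for v
    by (rule Suc.IH[where h="\<lambda>x. frechet_derivative h (at x) v"])
      (use Suc.prems frechet_derivative_cong_open[OF assms(1)] in \<open>auto, metis\<close>)
  moreover have "k differentiable (at x)" if "x \<in> S" for x
    using differentiable_cong_open[OF assms(1) that, of h k] Suc.prems that by auto
  ultimately show ?case by simp
qed

lemma Ck_on_subset: "Ck_on n S h \<Longrightarrow> T \<subseteq> S \<Longrightarrow> Ck_on n T h"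
  by (induction n arbitrary: h) (auto intro: continuous_on_subset)

lemma Ck_on_Suc_imp: "Ck_on (Suc n) S h \<Longrightarrow> Ck_on n S h"
proof (induction n arbitrary: h)
  case 0
  then show ?case by (auto intro!: continuous_at_imp_continuous_on differentiable_imp_continuous_within)
next
  case (Suc n)
  then show ?case by (metis Ck_on.simps(2))
qed

text \<open>Since \<open>Ck_on\<close> uses derivatives at points, never within the set, regularity
  can be tested near each point. This is the gluing principle behind extension by zero.\<close>

lemma Ck_on_local:
  assumes "\<And>x. x \<in> S \<Longrightarrow> \<exists>T. open T \<and> x \<in> T \<and> Ck_on n T h"
  shows "Ck_on n S h"
  using assms
proof (induction n arbitrary: h)
  case 0
  have "isCont h x" if "x \<in> S" for x
    using 0[OF that] by (auto simp: continuous_on_eq_continuous_at)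
  then show ?case by (simp add: continuous_at_imp_continuous_on)
next
  case (Suc n)
  have "h differentiable (at x)" if "x \<in> S" for x
    using Suc.prems[OF that] by auto
  moreover have "Ck_on n S (\<lambda>x. frechet_derivative h (at x) v)" for v
    by (rule Suc.IH) (use Suc.prems in \<open>fastforce\<close>)
  ultimately show ?case by simp
qed

lemma Ck_on_const: "Ck_on n S (\<lambda>x. c)"
  by (induction n arbitrary: c) auto

text \<open>By uniqueness of derivatives any explicit derivative may replace
  \<open>frechet_derivative\<close>; the inductions below raise the order through this rule.\<close>

lemma Ck_on_SucI:
  assumes "open S" "\<And>x. x \<in> S \<Longrightarrow> (h has_derivative h' x) (at x)" "\<And>v. Ck_on n S (\<lambda>x. h' x v)"
  shows "Ck_on (Suc n) S h"
proof -
  have "h' x = frechet_derivative h (at x)" if "x \<in> S" for x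
    using assms(2)[OF that] frechet_derivative_at by blast
  then have "Ck_on n S (\<lambda>x. frechet_derivative h (at x) v)" for v
    by (intro Ck_on_cong[OF assms(1) _ assms(3)]) simp
  then show ?thesis using assms(2) by (auto simp: differentiable_def)
qed

lemma Ck_on_SucD:
  assumes "Ck_on (Suc n) S h" "x \<in> S"
  shows "(h has_derivative frechet_derivative h (at x)) (at x)"
  using assms frechet_derivative_works by auto

lemma Ck_on_add:
  assumes S: "open S"
  shows "Ck_on n S h \<Longrightarrow> Ck_on n S k \<Longrightarrow> Ck_on n S (\<lambda>x. h x + k x)"
proof (induction n arbitrary: h k)
  case 0
  then show ?case by (simp add: continuous_on_add)
next
  case (Suc n)
  show ?case
    by (rule Ck_on_SucI[OF S has_derivative_add[OF Ck_on_SucD[OF Suc.prems(1)] Ck_on_SucD[OF Suc.prems(2)]]])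
      (use Suc in auto)
qed

lemma Ck_on_bounded_linear:
  assumes S: "open S" and L: "bounded_linear L"
  shows "Ck_on n S h \<Longrightarrow> Ck_on n S (\<lambda>x. L (h x))"
proof (induction n arbitrary: h)
  case 0
  then show ?case using L by (simp add: bounded_linear.continuous_on)
next
  case (Suc n)
  show ?case
    by (rule Ck_on_SucI[OF S bounded_linear.has_derivative[OF L Ck_on_SucD[OF Suc.prems(1)]]])
      (use Suc in auto)
qed

lemma Ck_on_bounded_bilinear:
  assumes S: "open S" and L: "bounded_bilinear L"
  shows "Ck_on n S h \<Longrightarrow> Ck_on n S k \<Longrightarrow> Ck_on n S (\<lambda>x. L (h x) (k x))"
proof (induction n arbitrary: h k)
  case 0
  then show ?case using L by (simp add: bounded_bilinear.continuous_on)
next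
  case (Suc n)
  show ?case
    \<comment> \<open>The product rule mixes derivatives with undifferentiated factors, so the
      induction hypothesis also needs \<open>h\<close> and \<open>k\<close> themselves at the lower
      order.\<close>
    by (rule Ck_on_SucI[OF S bounded_bilinear.FDERIV[OF L Ck_on_SucD[OF Suc.prems(1)] Ck_on_SucD[OF Suc.prems(2)]]])
      (use Suc.prems Ck_on_Suc_imp[OF Suc.prems(1)] Ck_on_Suc_imp[OF Suc.prems(2)]
        in \<open>auto intro!: Ck_on_add[OF S] Suc.IH\<close>)
qed

lemma Ck_on_sum:
  assumes "open S" "\<And>i. i \<in> I \<Longrightarrow> Ck_on n S (h i)"
  shows "Ck_on n S (\<lambda>x. \<Sum>i\<in>I. h i x)"
  using assms(2)
  by (induction I rule: infinite_finite_induct) (auto intro: Ck_on_add[OF assms(1)] Ck_on_const)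

text \<open>Expanding the inner derivative in a basis turns the chain rule into a finite sum of
  products of \<open>k\<close>-components with partial derivatives of \<open>h\<close> composed with
  \<open>k\<close>; both kinds of factor are covered by the induction. Hence the Euclidean middle
  space.\<close>

lemma Ck_on_compose:
  fixes k :: "'a::real_normed_vector \<Rightarrow> 'b::euclidean_space" and h :: "'b \<Rightarrow> 'c::real_normed_vector"
  assumes S: "open S" and T: "open T" and kS: "k ` S \<subseteq> T"
  shows "Ck_on n T h \<Longrightarrow> Ck_on n S k \<Longrightarrow> Ck_on n S (\<lambda>x. h (k x))"
proof (induction n arbitrary: h)
  case 0
  then show ?case using kS by (auto intro: continuous_on_compose2)
next
  case (Suc n)
  let ?h' = "\<lambda>y. frechet_derivative h (at y)" and ?k' = "\<lambda>x. frechet_derivative k (at x)"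
  have d: "((\<lambda>x. h (k x)) has_derivative (\<lambda>v. \<Sum>b\<in>Basis. (?k' x v \<bullet> b) *\<^sub>R ?h' (k x) b)) (at x)"
    if x: "x \<in> S" for x
  proof -
    have h: "(h has_derivative ?h' (k x)) (at (k x))"
      using Ck_on_SucD[OF Suc.prems(1)] kS x by auto
    interpret bounded_linear "?h' (k x)" using h by (rule has_derivative_bounded_linear)
    have "?h' (k x) w = (\<Sum>b\<in>Basis. (w \<bullet> b) *\<^sub>R ?h' (k x) b)" for w
      by (subst euclidean_representation[of w, symmetric]) (simp add: sum scaleR)
    then show ?thesis
      by (intro has_derivative_eq_rhs[OF has_derivative_compose[OF Ck_on_SucD[OF Suc.prems(2) x] h]] ext)
  qed
  have "Ck_on n S (\<lambda>x. ?h' (k x) b)" for b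
    by (rule Suc.IH[of "\<lambda>y. ?h' y b", OF _ Ck_on_Suc_imp[OF Suc.prems(2)]]) (use Suc.prems(1) in simp)
  moreover have "Ck_on n S (\<lambda>x. ?k' x v \<bullet> b)" for v b
    by (rule Ck_on_bounded_linear[OF S bounded_linear_inner_left, of n "\<lambda>x. ?k' x v"]) (use Suc.prems(2) in simp)
  ultimately show ?case
    by (intro Ck_on_SucI[OF S d] Ck_on_sum[OF S] Ck_on_bounded_bilinear[OF S bounded_bilinear_scaleR])
qed

section \<open>Smooth functions on open sets: closure properties\<close>

lemma smooth_on_cong:
  "open S \<Longrightarrow> (\<And>x. x \<in> S \<Longrightarrow> h x = k x) \<Longrightarrow> smooth_on S h \<Longrightarrow> smooth_on S k"
  unfolding smooth_on_def using Ck_on_cong by blast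

lemma smooth_on_subset: "smooth_on S h \<Longrightarrow> T \<subseteq> S \<Longrightarrow> smooth_on T h"
  unfolding smooth_on_def using Ck_on_subset by blast

lemma smooth_on_local:
  assumes "\<And>x. x \<in> S \<Longrightarrow> \<exists>T. open T \<and> x \<in> T \<and> smooth_on T h"
  shows "smooth_on S h"
  unfolding smooth_on_def using assms by (meson Ck_on_local smooth_on_def)

lemma smooth_on_differentiable: "smooth_on S h \<Longrightarrow> x \<in> S \<Longrightarrow> h differentiable (at x)"
  unfolding smooth_on_def by (metis Ck_on.simps(2))

lemma smooth_on_has_derivative:
  "smooth_on S h \<Longrightarrow> x \<in> S \<Longrightarrow> (h has_derivative frechet_derivative h (at x)) (at x)"
  using smooth_on_differentiable frechet_derivative_works by blast

lemma smooth_on_frechet_derivative: "smooth_on S h \<Longrightarrow> smooth_on S (\<lambda>x. frechet_derivative h (at x) v)"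
  unfolding smooth_on_def by (metis Ck_on.simps(2))

lemma smooth_on_continuous_on: "smooth_on S h \<Longrightarrow> continuous_on S h"
  unfolding smooth_on_def by (metis Ck_on.simps(1))

lemma smooth_on_const: "smooth_on S (\<lambda>x. c)"
  by (simp add: smooth_on_def Ck_on_const)

lemma smooth_on_add: "open S \<Longrightarrow> smooth_on S h \<Longrightarrow> smooth_on S k \<Longrightarrow> smooth_on S (\<lambda>x. h x + k x)"
  by (simp add: smooth_on_def Ck_on_add)

lemma smooth_on_bounded_linear:
  "open S \<Longrightarrow> bounded_linear L \<Longrightarrow> smooth_on S h \<Longrightarrow> smooth_on S (\<lambda>x. L (h x))"
  by (simp add: smooth_on_def Ck_on_bounded_linear)

lemma smooth_on_id: "open S \<Longrightarrow> smooth_on S (\<lambda>x. x)"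
  unfolding smooth_on_def
proof
  fix n assume S: "open S"
  show "Ck_on n S (\<lambda>x. x)"
    by (cases n) (auto intro!: Ck_on_SucI[OF S has_derivative_ident] Ck_on_const)
qed

lemma smooth_on_linear: "open S \<Longrightarrow> bounded_linear L \<Longrightarrow> smooth_on S L"
  using smooth_on_bounded_linear[OF _ _ smooth_on_id] by blast

lemma smooth_on_bounded_bilinear:
  "open S \<Longrightarrow> bounded_bilinear L \<Longrightarrow> smooth_on S h \<Longrightarrow> smooth_on S k \<Longrightarrow> smooth_on S (\<lambda>x. L (h x) (k x))"
  by (simp add: smooth_on_def Ck_on_bounded_bilinear)

lemmas smooth_on_scaleR = smooth_on_bounded_bilinear[OF _ bounded_bilinear_scaleR]
lemmas smooth_on_mult = smooth_on_bounded_bilinear[OF _ bounded_bilinear_mult]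

lemma smooth_on_sum:
  "open S \<Longrightarrow> (\<And>i. i \<in> I \<Longrightarrow> smooth_on S (h i)) \<Longrightarrow> smooth_on S (\<lambda>x. \<Sum>i\<in>I. h i x)"
  by (simp add: smooth_on_def Ck_on_sum)

lemma smooth_on_compose:
  fixes k :: "'a::real_normed_vector \<Rightarrow> 'b::euclidean_space" and h :: "'b \<Rightarrow> 'c::real_normed_vector"
  assumes "open S" "open T" "smooth_on T h" "smooth_on S k" "k ` S \<subseteq> T"
  shows "smooth_on S (\<lambda>x. h (k x))"
  unfolding smooth_on_def
  using assms(3,4)[unfolded smooth_on_def] Ck_on_compose[OF assms(1,2,5)] by blast

section \<open>Inverse, square root and bump functions on Euclidean space\<close>

text \<open>The derivative of \<open>inverse\<close> is a polynomial in \<open>inverse\<close>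
  itself, so order n yields order n + 1 without a formula for higher derivatives.\<close>

lemma smooth_on_inverse: "smooth_on (- {0}) (inverse :: real \<Rightarrow> real)"
  unfolding smooth_on_def
proof
  have S: "open (- {0::real})" by auto
  fix n show "Ck_on n (- {0}) (inverse :: real \<Rightarrow> real)"
  proof (induction n)
    case 0
    then show ?case by (auto intro!: continuous_intros)
  next
    case (Suc n)
    show ?case
    proof (rule Ck_on_SucI[OF S])
      show "(inverse has_derivative (\<lambda>v. (- v) * (inverse x * inverse x))) (at x)" if "x \<in> - {0}" for x :: real
        using that by (auto intro!: derivative_eq_intros simp: algebra_simps)
      show "Ck_on n (- {0}) (\<lambda>x. (- v) * (inverse x * inverse x))" for v :: real
        by (intro Ck_on_bounded_bilinear[OF S bounded_bilinear_mult] Suc Ck_on_const)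
    qed
  qed
qed

text \<open>Same bootstrapping: the derivative of \<open>sqrt\<close> is a multiple of
  \<open>inverse (sqrt x)\<close>, which is as regular as \<open>sqrt\<close>.\<close>

lemma smooth_on_sqrt: "smooth_on {0<..} sqrt"
  unfolding smooth_on_def
proof
  have S: "open {0::real<..}" by auto
  fix n show "Ck_on n {0<..} sqrt"
  proof (induction n)
    case 0
    then show ?case by (auto intro!: continuous_intros)
  next
    case (Suc n)
    have "Ck_on n {0<..} (\<lambda>x. inverse (sqrt x))"
      by (rule Ck_on_compose[OF S _ _ smooth_on_inverse[unfolded smooth_on_def, rule_format] Suc]) auto
    moreover have "(sqrt has_derivative (\<lambda>v. (v/2) * inverse (sqrt x))) (at x)" if "x \<in> {0<..}" for x
      using that by (auto intro!: derivative_eq_intros simp: field_simps)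
    ultimately show ?case
      by (intro Ck_on_SucI[OF S, where h' = "\<lambda>x v. (v/2) * inverse (sqrt x)"]
          Ck_on_bounded_bilinear[OF S bounded_bilinear_mult] Ck_on_const) auto
  qed
qed

text \<open>This family is closed under differentiation up to linear combinations.\<close>

definition flat_exp :: "nat \<Rightarrow> real \<Rightarrow> real" where
  "flat_exp k x = (if x > 0 then exp (- inverse x) * inverse x ^ k else 0)"

text \<open>From the right, the substitution y = 1/x reduces this to the growth of
  \<open>exp\<close> beyond all powers; from the left the function is constantly 0.\<close>

lemma flat_exp_tendsto_0: "(flat_exp k \<longlongrightarrow> 0) (at 0)"
proof -
  have "((\<lambda>y::real. y ^ k / exp y) \<longlongrightarrow> 0) at_top" by (rule tendsto_power_div_exp_0)
  then have "((\<lambda>x::real. inverse x ^ k / exp (inverse x)) \<longlongrightarrow> 0) (at_right 0)"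
    using filterlim_compose filterlim_inverse_at_top_right by blast
  then have "(flat_exp k \<longlongrightarrow> 0) (at_right 0)"
    by (rule Lim_transform_eventually)
      (auto simp: eventually_at_filter flat_exp_def exp_minus field_simps)
  moreover have "(flat_exp k \<longlongrightarrow> 0) (at_left 0)"
    by (rule Lim_transform_eventually[OF tendsto_const])
      (auto simp: eventually_at_filter flat_exp_def)
  ultimately show ?thesis by (simp add: filterlim_at_split)
qed

lemma flat_exp_has_derivative:
  "(flat_exp k has_real_derivative flat_exp (k + 2) x - real k * flat_exp (k + 1) x) (at x)"
proof (cases x "0::real" rule: linorder_cases)
  case less
  have "((\<lambda>x. 0) has_real_derivative 0) (at x)" by simp
  then show ?thesis
    by (subst DERIV_cong_ev[OF refl, of _ "\<lambda>x. 0"])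
      (use less eventually_nhds_in_open[of "{..<0}" x] in \<open>auto simp: flat_exp_def elim!: eventually_mono\<close>)
next
  case equal
  \<comment> \<open>At 0 the difference quotient of \<open>flat_exp k\<close> is
    \<open>flat_exp (k + 1)\<close>.\<close>
  have "((\<lambda>h. (flat_exp k (0 + h) - flat_exp k 0) / h) \<longlongrightarrow> 0) (at 0)"
    by (rule Lim_transform_eventually[OF flat_exp_tendsto_0[of "k + 1"]])
      (auto simp: flat_exp_def eventually_at_filter field_simps)
  then show ?thesis using equal by (simp add: DERIV_def flat_exp_def)
next
  case greater
  have "((\<lambda>x. exp (- inverse x) * inverse x ^ k) has_real_derivative
      exp (- inverse x) * inverse x ^ (k + 2) - real k * (exp (- inverse x) * inverse x ^ (k + 1))) (at x)"
  proof -
    have 1: "((\<lambda>x. exp (- inverse x)) has_real_derivative exp (- inverse x) * (inverse x)\<^sup>2) (at x)"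
      using greater by (auto intro!: derivative_eq_intros simp: power2_eq_square)
    have 2: "((\<lambda>x. inverse x ^ k) has_real_derivative - real k * inverse x ^ (k + 1)) (at x)"
    proof (cases k)
      case (Suc m)
      have "(inverse has_real_derivative - (inverse x)\<^sup>2) (at x)"
        using DERIV_inverse[of x] greater by (simp add: numeral_2_eq_2)
      from DERIV_power[OF this, of k] show ?thesis using Suc by (simp add: algebra_simps power2_eq_square)
    qed simp
    show ?thesis
      by (rule DERIV_cong[OF DERIV_mult[OF 1 2]]) (simp add: algebra_simps power_add power2_eq_square)
  qed
  then show ?thesis
    by (subst DERIV_cong_ev[OF refl, of _ "\<lambda>x. exp (- inverse x) * inverse x ^ k"])
      (use greater eventually_nhds_in_open[of "{0<..}" x] in \<open>auto simp: flat_exp_def elim!: eventually_mono\<close>)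
qed

lemma smooth_on_flat_exp: "smooth_on UNIV (flat_exp k)"
  unfolding smooth_on_def
proof
  fix n show "Ck_on n UNIV (flat_exp k)"
  proof (induction n arbitrary: k)
    case 0
    then show ?case
      using DERIV_isCont[OF flat_exp_has_derivative] by (auto intro!: continuous_at_imp_continuous_on)
  next
    case (Suc n)
    have *: "(flat_exp k has_derivative (\<lambda>v. v * flat_exp (k + 2) x + (- real k * v) * flat_exp (k + 1) x)) (at x)" for x
      by (rule has_derivative_eq_rhs[OF flat_exp_has_derivative[of k x, unfolded has_field_derivative_def]])
        (simp add: fun_eq_iff algebra_simps)
    show ?case
      by (rule Ck_on_SucI[OF open_UNIV *]) (intro Ck_on_add Ck_on_bounded_bilinear[OF _ bounded_bilinear_mult] Ck_on_const Suc open_UNIV)+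
  qed
qed

text \<open>The function is a quotient a / (a + b). The numerator a is positive exactly inside the
  ball of radius r, and b is positive exactly outside the closed ball of radius r/2, so a + b never
  vanishes; b = 0 gives the value 1 near the centre, a = 0 the value 0 far away.\<close>

lemma smooth_bump_euclidean:
  fixes x0 :: "'e::euclidean_space"
  assumes "r > 0"
  obtains \<rho> :: "'e \<Rightarrow> real" where "smooth_on UNIV \<rho>"
    "\<And>x. x \<in> ball x0 (r/2) \<Longrightarrow> \<rho> x = 1" "\<And>x. x \<notin> ball x0 r \<Longrightarrow> \<rho> x = 0"
proof -
  let ?q = "\<lambda>x. (x - x0) \<bullet> (x - x0)"
  have sub: "smooth_on UNIV (\<lambda>x::'e. x - x0)"
    using smooth_on_add[OF open_UNIV smooth_on_id smooth_on_const, of "- x0"] by simp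
  have q: "smooth_on UNIV ?q"
    by (rule smooth_on_bounded_bilinear[OF _ bounded_bilinear_inner sub sub]) simp
  have q2: "?q x = (dist x0 x)\<^sup>2" for x
    by (simp add: dist_norm power2_norm_eq_inner[symmetric] norm_minus_commute)
  have "smooth_on UNIV (\<lambda>x. r\<^sup>2 + (-1) * ?q x)" "smooth_on UNIV (\<lambda>x. ?q x + - (r/2)\<^sup>2)"
    by (intro smooth_on_add smooth_on_mult smooth_on_const q open_UNIV)+
  then have u: "smooth_on UNIV (\<lambda>x. flat_exp 0 (r\<^sup>2 - ?q x))"
    and w: "smooth_on UNIV (\<lambda>x. flat_exp 0 (?q x - (r/2)\<^sup>2))"
    by (auto intro!: smooth_on_compose[OF _ _ smooth_on_flat_exp] open_UNIV simp: field_simps)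
  define d where "d x = flat_exp 0 (r\<^sup>2 - ?q x) + flat_exp 0 (?q x - (r/2)\<^sup>2)" for x
  have "d x \<noteq> 0" for x
  proof -
    have "(r/2)\<^sup>2 < r\<^sup>2" using assms by (simp add: power2_eq_square)
    then have "r\<^sup>2 - ?q x > 0 \<or> ?q x - (r/2)\<^sup>2 > 0" by linarith
    then show ?thesis unfolding d_def flat_exp_def by (auto simp: add_pos_pos intro!: less_imp_neq[symmetric])
  qed
  then have "smooth_on UNIV (\<lambda>x. inverse (d x))"
    by (intro smooth_on_compose[OF _ _ smooth_on_inverse])
      (auto simp: d_def intro!: smooth_on_add u w)
  then have "smooth_on UNIV (\<lambda>x. flat_exp 0 (r\<^sup>2 - ?q x) * inverse (d x))"
    by (intro smooth_on_mult u) auto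
  moreover have "flat_exp 0 (r\<^sup>2 - ?q x) * inverse (d x) = 1" if "x \<in> ball x0 (r/2)" for x
  proof -
    have "(dist x0 x)\<^sup>2 < (r/2)\<^sup>2" using that by (intro power_strict_mono) auto
    then have "flat_exp 0 (?q x - (r/2)\<^sup>2) = 0" unfolding q2 flat_exp_def by simp
    then show ?thesis using \<open>d x \<noteq> 0\<close> by (simp add: d_def)
  qed
  moreover have "flat_exp 0 (r\<^sup>2 - ?q x) * inverse (d x) = 0" if "x \<notin> ball x0 r" for x
  proof -
    have "r\<^sup>2 \<le> (dist x0 x)\<^sup>2" using that assms by (intro power_mono) auto
    then show ?thesis unfolding q2 flat_exp_def by simp
  qed
  ultimately show thesis using that by blast
qed

text \<open>The second difference of \<open>h\<close> equals \<open>t\<^sup>2\<close> times either mixed derivative at some intermediate point.\<close>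

lemma frechet_derivative_frechet_derivative_commute:
  fixes h :: "'e::euclidean_space \<Rightarrow> real"
  assumes S: "open S" "x \<in> S" and h: "smooth_on S h"
  shows "frechet_derivative (\<lambda>y. frechet_derivative h (at y) v) (at x) w =
         frechet_derivative (\<lambda>y. frechet_derivative h (at y) w) (at x) v"
proof -
  define d2 where "d2 v w y = frechet_derivative (\<lambda>y. frechet_derivative h (at y) v) (at y) w" for v w y
  obtain r where r: "r > 0" "ball x r \<subseteq> S" using S openE by blast
  have mvt: "\<exists>y. dist x y \<le> t * (norm v + norm w) \<and>
        h (x + t *\<^sub>R v + t *\<^sub>R w) - h (x + t *\<^sub>R v) - h (x + t *\<^sub>R w) + h x = t * t * d2 v w y"
    if t: "t > 0" "t * (norm v + norm w) < r" for v w t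
  proof -
    have in_S: "x + s *\<^sub>R v + s' *\<^sub>R w \<in> S" "dist x (x + s *\<^sub>R v + s' *\<^sub>R w) \<le> t * (norm v + norm w)"
      if "s \<in> {0..t}" "s' \<in> {0..t}" for s s'
    proof -
      have "norm (s *\<^sub>R v + s' *\<^sub>R w) \<le> t * norm v + t * norm w"
        using that by (intro order_trans[OF norm_triangle_ineq] add_mono) (auto intro: mult_right_mono)
      then show *: "dist x (x + s *\<^sub>R v + s' *\<^sub>R w) \<le> t * (norm v + norm w)"
        unfolding dist_commute[of x] by (simp add: dist_norm add.assoc distrib_left)
      then show "x + s *\<^sub>R v + s' *\<^sub>R w \<in> S" using r t by auto
    qed
    have D: "((\<lambda>s. k (c + s *\<^sub>R v)) has_real_derivative frechet_derivative k (at (c + s *\<^sub>R v)) v) (at s)"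
      if k: "smooth_on S k" and cs: "c + s *\<^sub>R v \<in> S" for k :: "'e \<Rightarrow> real" and c s v
    proof -
      have "((\<lambda>s. c + s *\<^sub>R v) has_derivative (\<lambda>e. e *\<^sub>R v)) (at s)"
        by (auto intro!: derivative_eq_intros)
      then have 1: "((\<lambda>s. k (c + s *\<^sub>R v)) has_derivative (\<lambda>e. frechet_derivative k (at (c + s *\<^sub>R v)) (e *\<^sub>R v))) (at s)"
        using has_derivative_compose smooth_on_has_derivative[OF k cs] by blast
      have "linear (frechet_derivative k (at (c + s *\<^sub>R v)))"
        using smooth_on_differentiable[OF k cs] linear_frechet_derivative by blast
      then have "(\<lambda>e. frechet_derivative k (at (c + s *\<^sub>R v)) (e *\<^sub>R v)) = (*) (frechet_derivative k (at (c + s *\<^sub>R v)) v)"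
        by (auto simp: linear_cmul)
      with 1 show ?thesis by (simp add: has_field_derivative_def)
    qed
    note D2 = D[OF smooth_on_frechet_derivative[OF h], folded d2_def]
    \<comment> \<open>The first mean value argument runs in direction \<open>v\<close>, for the
      difference of \<open>h\<close> on two parallel segments shifted by
      \<open>t *\<^sub>R w\<close>. The second one, below, runs in direction \<open>w\<close> with
      the intermediate \<open>s\<close> kept fixed.\<close>
    have "\<exists>s. 0 < s \<and> s < t \<and>
        (h (x + t *\<^sub>R w + t *\<^sub>R v) - h (x + t *\<^sub>R v)) - (h (x + t *\<^sub>R w + 0 *\<^sub>R v) - h (x + 0 *\<^sub>R v)) =
        (t - 0) * (frechet_derivative h (at (x + t *\<^sub>R w + s *\<^sub>R v)) v - frechet_derivative h (at (x + s *\<^sub>R v)) v)"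
      by (rule MVT2[OF t(1)], rule DERIV_diff; rule D[OF h])
        (use in_S(1)[of _ t] in_S(1)[of _ 0] t(1) in \<open>auto simp: algebra_simps\<close>)
    then obtain s where s: "0 < s" "s < t"
      "(h (x + t *\<^sub>R w + t *\<^sub>R v) - h (x + t *\<^sub>R v)) - (h (x + t *\<^sub>R w + 0 *\<^sub>R v) - h (x + 0 *\<^sub>R v)) =
        (t - 0) * (frechet_derivative h (at (x + t *\<^sub>R w + s *\<^sub>R v)) v - frechet_derivative h (at (x + s *\<^sub>R v)) v)"
      by blast
    have "\<exists>s'. 0 < s' \<and> s' < t \<and>
        frechet_derivative h (at ((x + s *\<^sub>R v) + t *\<^sub>R w)) v - frechet_derivative h (at ((x + s *\<^sub>R v) + 0 *\<^sub>R w)) v =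
        (t - 0) * d2 v w ((x + s *\<^sub>R v) + s' *\<^sub>R w)"
      by (rule MVT2[OF t(1)], rule D2) (use in_S(1)[of s] s t(1) in \<open>auto simp: algebra_simps\<close>)
    then obtain s' where s': "0 < s'" "s' < t"
      "frechet_derivative h (at ((x + s *\<^sub>R v) + t *\<^sub>R w)) v - frechet_derivative h (at ((x + s *\<^sub>R v) + 0 *\<^sub>R w)) v =
        (t - 0) * d2 v w ((x + s *\<^sub>R v) + s' *\<^sub>R w)" by blast
    show ?thesis
      by (rule exI[of _ "x + s *\<^sub>R v + s' *\<^sub>R w"])
        (use s s' in_S(2)[of s s'] in \<open>auto simp: algebra_simps\<close>)
  qed
  have cont: "isCont (d2 v w) x" for v w
    using smooth_on_continuous_on[OF smooth_on_frechet_derivative[OF smooth_on_frechet_derivative[OF h, of v], of w]]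
      continuous_on_eq_continuous_at[OF S(1)] S(2)
    unfolding d2_def by blast
  have *: "\<bar>d2 v w x - d2 w v x\<bar> < e + e" if e: "e > 0" for e
  proof -
    obtain d1 where d1: "d1 > 0" "\<And>y. dist y x < d1 \<Longrightarrow> dist (d2 v w y) (d2 v w x) < e"
      using cont[of v w] e unfolding continuous_at_eps_delta by blast
    obtain d3 where d3: "d3 > 0" "\<And>y. dist y x < d3 \<Longrightarrow> dist (d2 w v y) (d2 w v x) < e"
      using cont[of w v] e unfolding continuous_at_eps_delta by blast
    \<comment> \<open>The summand 1 keeps \<open>N\<close> positive when both vectors vanish;
      dividing by \<open>2 * N\<close> places both intermediate points within all three
      radii.\<close>
    define N where "N = norm v + norm w + 1"
    define t where "t = Min {r, d1, d3} / (2 * N)"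
    have N: "N > 0" unfolding N_def using norm_ge_zero[of v] norm_ge_zero[of w] by linarith
    have M: "Min {r, d1, d3} > 0" using r d1 d3 by auto
    have t: "t > 0" using N M unfolding t_def by auto
    have "t * (norm v + norm w) < t * (2 * N)" unfolding N_def 
      using t by (intro mult_strict_left_mono) (auto simp: algebra_simps intro!: add_nonneg_pos)
    also have "\<dots> = Min {r, d1, d3}" using N unfolding t_def by simp
    finally have tb: "t * (norm v + norm w) < r" "t * (norm v + norm w) < d1" "t * (norm v + norm w) < d3" by auto
    obtain y1 where y1: "dist x y1 \<le> t * (norm v + norm w)"
      "h (x + t *\<^sub>R v + t *\<^sub>R w) - h (x + t *\<^sub>R v) - h (x + t *\<^sub>R w) + h x = t * t * d2 v w y1"
      using mvt[OF t tb(1)] by blast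
    obtain y2 where y2: "dist x y2 \<le> t * (norm w + norm v)"
      "h (x + t *\<^sub>R w + t *\<^sub>R v) - h (x + t *\<^sub>R w) - h (x + t *\<^sub>R v) + h x = t * t * d2 w v y2"
      using mvt[OF t, of w v] tb(1) by (auto simp: add.commute)
    \<comment> \<open>The second difference is symmetric in \<open>v\<close> and \<open>w\<close>,
      so the two mixed derivatives agree, though at different points near \<open>x\<close>;
      continuity bridges each gap at the cost of \<open>e\<close>.\<close>
    have "t * t * d2 v w y1 = t * t * d2 w v y2" using y1(2) y2(2) by (simp add: algebra_simps)
    then have "d2 v w y1 = d2 w v y2" using t by simp
    moreover have "dist (d2 v w y1) (d2 v w x) < e" "dist (d2 w v y2) (d2 w v x) < e"
      using y1(1) y2(1) tb d1(2)[of y1] d3(2)[of y2] by (auto simp: dist_commute add.commute)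
    ultimately show ?thesis by (simp add: dist_real_def)
  qed
  have "\<bar>d2 v w x - d2 w v x\<bar> \<le> 0"
  proof (rule field_le_epsilon)
    fix e :: real assume "e > 0"
    then show "\<bar>d2 v w x - d2 w v x\<bar> \<le> 0 + e" using *[of "e/2"] by simp
  qed
  then show ?thesis by (simp add: d2_def)
qed

section \<open>Manifolds, functions and 1-forms\<close>

lemma blinfun_representation:
  fixes \<tau> :: "'e::euclidean_space \<Rightarrow>\<^sub>L real"
  shows "\<tau> = (\<Sum>k\<in>Basis. \<tau> k *\<^sub>R blinfun_inner_right k)"
  by (rule blinfun_euclidean_eqI)
    (simp add: blinfun.sum_left blinfun.scaleR_left blinfun_inner_right.rep_eq inner_Basis if_distrib cong: if_cong)

section \<open>Charts and smooth functions on a manifold\<close>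

locale manifold =
  fixes M :: "('a::{t2_space, second_countable_topology}, 'e::euclidean_space) mfd"
  assumes smooth_manifold: "smooth_manifold M"
begin

lemma mem_cdom: "a \<in> cdom M a"
  and open_cdom: "open (cdom M a)"
  and open_range: "open (cmap M a ` cdom M a)"
  and homeo: "homeomorphism (cdom M a) (cmap M a ` cdom M a) (cmap M a) (cinv M a)"
  and smooth_transition: "smooth_on (cmap M a ` (cdom M a \<inter> cdom M b)) (cmap M b \<circ> cinv M a)"
  using smooth_manifold unfolding smooth_manifold_def by blast+

lemma cinv_cmap [simp]: "p \<in> cdom M a \<Longrightarrow> cinv M a (cmap M a p) = p"
  using homeo[of a] by (simp add: homeomorphism_def)

lemma cmap_cinv [simp]: "x \<in> cmap M a ` cdom M a \<Longrightarrow> cmap M a (cinv M a x) = x"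
  using homeo[of a] unfolding homeomorphism_def by blast

lemma cinv_mem: "x \<in> cmap M a ` (U \<inter> cdom M a) \<Longrightarrow> cinv M a x \<in> U \<inter> cdom M a"
  by auto

lemma open_image:
  assumes "open U"
  shows "open (cmap M a ` (U \<inter> cdom M a))"
proof -
  have "openin (top_of_set (cmap M a ` cdom M a)) (cmap M a ` (U \<inter> cdom M a))"
    by (rule homeomorphism_imp_open_map[OF homeo]) (metis Int_commute assms openin_open_Int)
  then show ?thesis using open_range openin_open_trans by blast
qed

lemma open_image': "open U \<Longrightarrow> U \<subseteq> cdom M a \<Longrightarrow> open (cmap M a ` U)"
  using open_image[of U a] by (simp add: Int_absorb2)

lemma smooth_fun_on_subset: "smooth_fun_on M U u \<Longrightarrow> V \<subseteq> U \<Longrightarrow> smooth_fun_on M V u"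
  unfolding smooth_fun_on_def by (meson Int_mono image_mono order_refl smooth_on_subset)

lemma smooth_fun_on_cong:
  assumes "open U" "\<And>p. p \<in> U \<Longrightarrow> u p = w p" "smooth_fun_on M U u"
  shows "smooth_fun_on M U w"
  unfolding smooth_fun_on_def
proof
  fix a
  show "smooth_on (cmap M a ` (U \<inter> cdom M a)) (w \<circ> cinv M a)"
    by (rule smooth_on_cong[OF open_image[OF assms(1)], where h = "u \<circ> cinv M a"])
      (use assms(2,3) in \<open>auto simp: smooth_fun_on_def\<close>)
qed

lemma smooth_fun_on_local:
  assumes "\<And>p. p \<in> U \<Longrightarrow> \<exists>V. open V \<and> p \<in> V \<and> smooth_fun_on M V u"
  shows "smooth_fun_on M U u"
  unfolding smooth_fun_on_def
proof (intro allI smooth_on_local)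
  fix a x assume "x \<in> cmap M a ` (U \<inter> cdom M a)"
  then obtain p where p: "p \<in> U" "p \<in> cdom M a" "x = cmap M a p" by auto
  then obtain V where V: "open V" "p \<in> V" "smooth_fun_on M V u" using assms by blast
  show "\<exists>T. open T \<and> x \<in> T \<and> smooth_on T (u \<circ> cinv M a)"
    using V p open_image[OF V(1), of a] by (intro exI[of _ "cmap M a ` (V \<inter> cdom M a)"]) (auto simp: smooth_fun_on_def)
qed

text \<open>Transition maps are smooth, so one chart that covers \<open>U\<close> decides about all
  others.\<close>

lemma smooth_fun_on_chartI:
  assumes "open U" "U \<subseteq> cdom M a" "smooth_on (cmap M a ` U) (u \<circ> cinv M a)"
  shows "smooth_fun_on M U u"
  unfolding smooth_fun_on_def
proof
  fix b
  let ?S = "cmap M b ` (U \<inter> cdom M b)"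
  have S: "open ?S" by (rule open_image[OF assms(1)])
  have t: "smooth_on ?S (cmap M a \<circ> cinv M b)"
    by (rule smooth_on_subset[OF smooth_transition[of b a]]) (use assms(2) in auto)
  have "smooth_on ?S (\<lambda>x. (u \<circ> cinv M a) ((cmap M a \<circ> cinv M b) x))"
    by (rule smooth_on_compose[OF S open_image'[OF assms(1,2)] assms(3) t]) auto
  then show "smooth_on ?S (u \<circ> cinv M b)"
    by (rule smooth_on_cong[OF S, rotated]) (use assms(2) in auto)
qed

lemma smooth_fun_onD:
  "open U \<Longrightarrow> smooth_fun_on M U u \<Longrightarrow> U \<subseteq> cdom M a \<Longrightarrow> smooth_on (cmap M a ` U) (u \<circ> cinv M a)"
  unfolding smooth_fun_on_def by (drule spec[of _ a]) (simp add: Int_absorb2)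

lemma smooth_fun_on_const: "smooth_fun_on M U (\<lambda>p. c)"
  by (simp add: smooth_fun_on_def comp_def smooth_on_const)

lemma smooth_fun_on_add:
  "open U \<Longrightarrow> smooth_fun_on M U u \<Longrightarrow> smooth_fun_on M U w \<Longrightarrow> smooth_fun_on M U (\<lambda>p. u p + w p)"
  unfolding smooth_fun_on_def comp_def by (intro allI smooth_on_add open_image) auto

lemma smooth_fun_on_bounded_linear:
  "open U \<Longrightarrow> bounded_linear L \<Longrightarrow> smooth_fun_on M U u \<Longrightarrow> smooth_fun_on M U (\<lambda>p. L (u p))"
  unfolding smooth_fun_on_def comp_def by (intro allI smooth_on_bounded_linear[where L = L] open_image) auto

lemma smooth_fun_on_bounded_bilinear:
  "open U \<Longrightarrow> bounded_bilinear L \<Longrightarrow> smooth_fun_on M U u \<Longrightarrow> smooth_fun_on M U w \<Longrightarrow>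
    smooth_fun_on M U (\<lambda>p. L (u p) (w p))"
  unfolding smooth_fun_on_def comp_def by (intro allI smooth_on_bounded_bilinear[where L = L] open_image) auto

lemmas smooth_fun_on_scaleR = smooth_fun_on_bounded_bilinear[OF _ bounded_bilinear_scaleR]
lemmas smooth_fun_on_mult = smooth_fun_on_bounded_bilinear[OF _ bounded_bilinear_mult]

lemma smooth_fun_on_sum:
  "open U \<Longrightarrow> (\<And>i. i \<in> I \<Longrightarrow> smooth_fun_on M U (u i)) \<Longrightarrow> smooth_fun_on M U (\<lambda>p. \<Sum>i\<in>I. u i p)"
  unfolding smooth_fun_on_def comp_def by (intro allI smooth_on_sum open_image) auto

lemma smooth_fun_on_compose:
  fixes u :: "'a \<Rightarrow> 'v::euclidean_space"
  assumes "open U" "open T" "smooth_on T h" "smooth_fun_on M U u" "u ` U \<subseteq> T"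
  shows "smooth_fun_on M U (\<lambda>p. h (u p))"
  unfolding smooth_fun_on_def comp_def
proof
  fix a show "smooth_on (cmap M a ` (U \<inter> cdom M a)) (\<lambda>x. h (u (cinv M a x)))"
    by (rule smooth_on_compose[OF open_image[OF assms(1)] assms(2,3), of _ "\<lambda>x. u (cinv M a x)"])
      (use assms(4,5) in \<open>auto simp: smooth_fun_on_def comp_def\<close>)
qed

lemma smooth_fun_on_inverse:
  "open U \<Longrightarrow> smooth_fun_on M U u \<Longrightarrow> (\<And>p. p \<in> U \<Longrightarrow> u p \<noteq> (0::real)) \<Longrightarrow> smooth_fun_on M U (\<lambda>p. inverse (u p))"
  by (rule smooth_fun_on_compose[OF _ _ smooth_on_inverse]) auto

lemma smooth_fun_on_cmap: "smooth_fun_on M (cdom M a) (cmap M a)"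
  by (rule smooth_fun_on_chartI[OF open_cdom order_refl],
      rule smooth_on_cong[OF open_range _ smooth_on_id[OF open_range]]) auto

lemma smooth_fun_on_of_chart:
  assumes "open S" "S \<subseteq> cmap M a ` cdom M a" "smooth_on S h"
  shows "smooth_fun_on M (cdom M a \<inter> cmap M a -` S) (\<lambda>p. h (cmap M a p))"
    and "open (cdom M a \<inter> cmap M a -` S)"
proof -
  have "continuous_on (cdom M a) (cmap M a)" using homeo[of a] by (simp add: homeomorphism_def)
  then show o: "open (cdom M a \<inter> cmap M a -` S)"
    using continuous_on_open_vimage[OF open_cdom[of a]] assms(1) by (metis Int_commute)
  have eq: "cmap M a ` (cdom M a \<inter> cmap M a -` S) = S" using assms(2) by auto
  show "smooth_fun_on M (cdom M a \<inter> cmap M a -` S) (\<lambda>p. h (cmap M a p))"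
    by (rule smooth_fun_on_chartI[OF o, of a], blast, unfold eq, rule smooth_on_cong[OF assms(1) _ assms(3)])
      (use assms(2) in auto)
qed

text \<open>The Euclidean bump is transported by the chart at \<open>p\<close> and extended by 0.
  The extension is smooth because \<open>K\<close>, the image of a closed ball, is compact and hence
  closed in the Hausdorff space, so the chart domain and \<open>- K\<close> form an open
  cover.\<close>

lemma bump:
  assumes "open U" "p \<in> U"
  obtains \<rho> :: "'a \<Rightarrow> real" and K V where "smooth_fun M \<rho>" "closed K" "K \<subseteq> U" "\<And>q. q \<notin> K \<Longrightarrow> \<rho> q = 0"
    "open V" "p \<in> V" "V \<subseteq> U" "\<And>q. q \<in> V \<Longrightarrow> \<rho> q = 1"
proof -
  let ?W = "cmap M p ` (U \<inter> cdom M p)" and ?x = "cmap M p p"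
  have "open ?W" "?x \<in> ?W" using open_image assms mem_cdom by auto
  then obtain r where r: "r > 0" "cball ?x r \<subseteq> ?W" using open_contains_cball by blast
  obtain h where h: "smooth_on UNIV h" "\<And>x. x \<in> ball ?x (r/2) \<Longrightarrow> h x = 1" "\<And>x. x \<notin> ball ?x r \<Longrightarrow> h x = (0::real)"
    using smooth_bump_euclidean[OF r(1), of ?x] by blast
  define K where "K = cinv M p ` cball ?x r"
  have "continuous_on (cball ?x r) (cinv M p)"
    using homeo[of p] r(2) unfolding homeomorphism_def by (meson continuous_on_subset image_mono inf_le2 order_trans)
  then have K: "closed K" unfolding K_def by (intro compact_imp_closed compact_continuous_image) auto
  have KU: "K \<subseteq> U \<inter> cdom M p" unfolding K_def using r(2) cinv_mem by blast
  have K_iff: "q \<in> K \<longleftrightarrow> cmap M p q \<in> cball ?x r" if "q \<in> cdom M p" for q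
  proof -
    have "cmap M p (cinv M p y) = y" if "y \<in> cball ?x r" for y
      using r(2) that by (intro cmap_cinv) auto
    then show ?thesis unfolding K_def using that by (force intro: rev_image_eqI)
  qed
  define \<rho> where "\<rho> q = (if q \<in> cdom M p then h (cmap M p q) else 0)" for q
  have \<rho>0: "\<rho> q = 0" if "q \<notin> K" for q
    using that h(3) ball_subset_cball[of ?x r] by (auto simp: \<rho>_def K_iff)
  have 1: "smooth_fun_on M (cdom M p) \<rho>"
    by (rule smooth_fun_on_cong[OF open_cdom _ smooth_fun_on_compose[OF open_cdom open_UNIV h(1) smooth_fun_on_cmap]])
      (auto simp: \<rho>_def)
  have 2: "smooth_fun_on M (- K) \<rho>"
    by (rule smooth_fun_on_cong[OF _ _ smooth_fun_on_const[of _ 0]]) (use K \<rho>0 in auto)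
  have "smooth_fun M \<rho>"
  proof (rule smooth_fun_on_local)
    fix q
    show "\<exists>V. open V \<and> q \<in> V \<and> smooth_fun_on M V \<rho>"
    proof (cases "q \<in> K")
      case True
      then show ?thesis using 1 KU open_cdom by blast
    next
      case False
      then show ?thesis using 2 K by (metis ComplI open_Compl)
    qed
  qed
  moreover
  define V where "V = cdom M p \<inter> cmap M p -` ball ?x (r/2)"
  have sub: "ball ?x (r/2) \<subseteq> ?W"
  proof -
    have "ball ?x (r/2) \<subseteq> cball ?x r" using r(1) by auto
    then show ?thesis using r(2) by blast
  qed
  then have V: "open V" unfolding V_def
    by (intro smooth_fun_on_of_chart(2)[OF _ _ smooth_on_const[of _ "0::real"]]) auto
  have "V \<subseteq> K"
    unfolding V_def using K_iff r(1) by (auto simp: dist_commute)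
  ultimately show thesis
    using that[of \<rho> K V] K KU \<rho>0 V r(1) h(2) mem_cdom by (auto simp: V_def \<rho>_def)
qed

text \<open>Points outside \<open>U\<close> have the neighbourhood \<open>- K\<close>, on which the
  product is 0, so arbitrary values of \<open>u\<close> outside \<open>U\<close> do no harm.\<close>

lemma smooth_fun_extend:
  fixes \<rho> :: "'a \<Rightarrow> real" and u :: "'a \<Rightarrow> 'v::real_normed_vector"
  assumes "open U" "smooth_fun_on M U u" "smooth_fun M \<rho>" "closed K" "K \<subseteq> U" "\<And>q. q \<notin> K \<Longrightarrow> \<rho> q = 0"
  shows "smooth_fun_on M UNIV (\<lambda>q. \<rho> q *\<^sub>R u q)"
proof (rule smooth_fun_on_local)
  fix q
  show "\<exists>V. open V \<and> q \<in> V \<and> smooth_fun_on M V (\<lambda>q. \<rho> q *\<^sub>R u q)"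
  proof (cases "q \<in> U")
    case True
    then show ?thesis
      using assms smooth_fun_on_scaleR[OF assms(1) smooth_fun_on_subset[OF assms(3)] assms(2)] by blast
  next
    case False
    have "smooth_fun_on M (- K) (\<lambda>q. \<rho> q *\<^sub>R u q)"
      by (rule smooth_fun_on_cong[OF _ _ smooth_fun_on_const[of _ 0]]) (use assms in auto)
    then show ?thesis using False assms by (metis ComplI open_Compl subsetD)
  qed
qed

section \<open>Differentials and changes of chart\<close>

lemma has_derivative_in_chart:
  assumes "smooth_fun_on M U u" "p \<in> U" "p \<in> cdom M a"
  shows "(u \<circ> cinv M a has_derivative frechet_derivative (u \<circ> cinv M a) (at (cmap M a p))) (at (cmap M a p))"
  by (rule smooth_on_has_derivative[of "cmap M a ` (U \<inter> cdom M a)"]) (use assms in \<open>auto simp: smooth_fun_on_def\<close>)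

lemma differential_has_derivative:
  assumes "smooth_fun_on M U u" "p \<in> U"
  shows "(u \<circ> cinv M p has_derivative blinfun_apply (differential M u p)) (at (cmap M p p))"
  using has_derivative_in_chart[OF assms mem_cdom]
  by (simp add: differential_def bounded_linear_Blinfun_apply has_derivative_bounded_linear)

lemma coord_change_has_derivative:
  assumes "p \<in> cdom M a" "p \<in> cdom M b"
  shows "(cmap M b \<circ> cinv M a has_derivative blinfun_apply (coord_change M a b p)) (at (cmap M a p))"
  using has_derivative_in_chart[OF smooth_fun_on_cmap assms(2,1)]
  by (simp add: coord_change_def bounded_linear_Blinfun_apply has_derivative_bounded_linear)

lemma coord_change_apply:
  assumes "p \<in> cdom M a" "p \<in> cdom M b"
  shows "coord_change M a b p v = frechet_derivative (cmap M b \<circ> cinv M a) (at (cmap M a p)) v"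
  by (simp add: frechet_derivative_at[OF coord_change_has_derivative[OF assms], symmetric])

text \<open>This is the chain rule for \<open>u\<close> read in two charts. The transformation rules
  for differentials and coordinate fields below are instances of it.\<close>

lemma frechet_chart_change:
  assumes U: "open U" and u: "smooth_fun_on M U u" and p: "p \<in> U" "p \<in> cdom M a" "p \<in> cdom M b"
  shows "frechet_derivative (u \<circ> cinv M b) (at (cmap M b p)) (coord_change M a b p v) =
         frechet_derivative (u \<circ> cinv M a) (at (cmap M a p)) v"
proof -
  let ?S = "cmap M a ` (U \<inter> cdom M b \<inter> cdom M a)"
  have S: "open ?S" "cmap M a p \<in> ?S" using p by (auto intro!: open_image open_Int U open_cdom)
  have "(u \<circ> cinv M b has_derivative frechet_derivative (u \<circ> cinv M b) (at (cmap M b p))) (at ((cmap M b \<circ> cinv M a) (cmap M a p)))"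
    using has_derivative_in_chart[OF u p(1,3)] p(2) by simp
  from diff_chain_at[OF coord_change_has_derivative[OF p(2,3)] this]
  have "(u \<circ> cinv M a has_derivative frechet_derivative (u \<circ> cinv M b) (at (cmap M b p)) \<circ> blinfun_apply (coord_change M a b p)) (at (cmap M a p))"
    by (rule has_derivative_transform_within_open[OF _ S]) auto
  then show ?thesis using frechet_derivative_at by (metis comp_apply)
qed

text \<open>The cocycle rule of the Jacobians is the chart-change formula applied to the coordinate
  map \<open>cmap M c\<close>.\<close>

lemma coord_change_comp:
  assumes "p \<in> cdom M a" "p \<in> cdom M b" "p \<in> cdom M c"
  shows "coord_change M b c p (coord_change M a b p v) = coord_change M a c p v"
  using frechet_chart_change[OF open_cdom smooth_fun_on_cmap assms(3,1,2)] assms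
  by (simp add: coord_change_apply)

lemma coord_change_self [simp]:
  assumes "p \<in> cdom M a"
  shows "coord_change M a a p v = v"
proof -
  have "(cmap M a \<circ> cinv M a has_derivative (\<lambda>v. v)) (at (cmap M a p))"
    by (rule has_derivative_transform_within_open[OF has_derivative_ident open_range[of a]]) (use assms in auto)
  then show ?thesis
    using coord_change_has_derivative[OF assms assms] has_derivative_unique by metis
qed

lemma differential_coord_field:
  assumes "open U" "smooth_fun_on M U u" "p \<in> U" "p \<in> cdom M a"
  shows "differential M u p (coord_field M a v p) = frechet_derivative (u \<circ> cinv M a) (at (cmap M a p)) v"
  using frechet_chart_change[OF assms mem_cdom[of p]]
    frechet_derivative_at[OF differential_has_derivative[OF assms(2,3)]]
  by (simp add: coord_field_def)

lemma smooth_coord_change: "smooth_fun_on M (cdom M a \<inter> cdom M b) (\<lambda>p. coord_change M a b p v)"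
proof (rule smooth_fun_on_chartI[of _ a])
  let ?S = "cmap M a ` (cdom M a \<inter> cdom M b)"
  have S: "open ?S" by (metis Int_commute open_cdom open_image)
  show "smooth_on ?S ((\<lambda>p. coord_change M a b p v) \<circ> cinv M a)"
    by (rule smooth_on_cong[OF S _ smooth_on_frechet_derivative[OF smooth_transition[of a b], of v]])
      (auto simp: coord_change_apply)
qed (auto simp: open_cdom)

lemma coord_field_self [simp]: "coord_field M p v p = v"
  by (simp add: coord_field_def mem_cdom)

lemma coord_field_change:
  "q \<in> cdom M a \<Longrightarrow> q \<in> cdom M b \<Longrightarrow> coord_field M b v q = coord_field M a (coord_change M b a q v) q"
  by (simp add: coord_field_def coord_change_comp mem_cdom)

lemma vector_coord_field: "q \<in> cdom M a \<Longrightarrow> coord_field M a (coord_change M q a q w) q = w"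
  using coord_field_change[of q a q w] by (simp add: mem_cdom)

lemma coord_form_coord_field: "q \<in> cdom M a \<Longrightarrow> coord_form M a \<omega> q (coord_field M a v q) = \<omega> v"
  by (simp add: coord_form_def coord_field_def coord_change_comp mem_cdom)

lemma coord_field_sum: "coord_field M a v q = (\<Sum>k\<in>Basis. (v \<bullet> k) *\<^sub>R coord_field M a k q)"
  unfolding coord_field_def
  by (subst (1) euclidean_representation[of v, symmetric]) (simp only: blinfun.sum_right blinfun.scaleR_right)

lemma form_coord_sum:
  assumes "q \<in> cdom M a"
  shows "(\<tau>::'e \<Rightarrow>\<^sub>L real) = (\<Sum>k\<in>Basis. \<tau> (coord_field M a k q) *\<^sub>R coord_form M a (blinfun_inner_right k) q)"
proof (rule blinfun_eqI)
  fix w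
  let ?w = "coord_change M q a q w"
  have "\<tau> w = \<tau> (coord_field M a ?w q)" by (simp add: vector_coord_field assms)
  also have "\<dots> = (\<Sum>k\<in>Basis. (?w \<bullet> k) * \<tau> (coord_field M a k q))"
    by (subst coord_field_sum) (simp add: blinfun.sum_right blinfun.scaleR_right)
  also have "\<dots> = (\<Sum>k\<in>Basis. \<tau> (coord_field M a k q) *\<^sub>R coord_form M a (blinfun_inner_right k) q) w"
    by (simp add: blinfun.sum_left blinfun.scaleR_left coord_form_def blinfun_inner_right.rep_eq inner_commute mult.commute)
  finally show "\<tau> w = \<dots>" .
qed

section \<open>Smooth 1-forms and their extension\<close>

text \<open>A local version of \<open>one_forms\<close>. Coordinate fields are meaningful on their
  chart domain only, hence the intersections; \<open>U\<close> itself need not lie in a single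
  chart.\<close>

definition smooth_form_on :: "'a set \<Rightarrow> ('a, 'e) form \<Rightarrow> bool" where
  "smooth_form_on U \<alpha> \<longleftrightarrow> (\<forall>a v. smooth_fun_on M (U \<inter> cdom M a) (\<lambda>q. \<alpha> q (coord_field M a v q)))"

lemma one_forms_iff: "\<alpha> \<in> one_forms M \<longleftrightarrow> smooth_form_on UNIV \<alpha>"
  by (simp add: one_forms_def smooth_form_on_def)

lemma one_formsD: "\<alpha> \<in> one_forms M \<Longrightarrow> smooth_fun_on M (cdom M a) (\<lambda>q. \<alpha> q (coord_field M a v q))"
  by (simp add: one_forms_def)

lemma one_forms_smooth_form_on: "\<alpha> \<in> one_forms M \<Longrightarrow> smooth_form_on U \<alpha>"
  unfolding smooth_form_on_def one_forms_def using smooth_fun_on_subset by (metis (no_types, lifting) Int_lower2 mem_Collect_eq)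

text \<open>Coordinate fields of another chart are combinations of those of chart \<open>a\<close>,
  with smooth Jacobian entries as coefficients.\<close>

lemma smooth_form_onI_chart:
  fixes \<alpha> :: "('a, 'e) form"
  assumes U: "open U" "U \<subseteq> cdom M a" and \<alpha>: "\<And>v. smooth_fun_on M U (\<lambda>q. \<alpha> q (coord_field M a v q))"
  shows "smooth_form_on U \<alpha>"
  unfolding smooth_form_on_def
proof (intro allI)
  fix b v
  have o: "open (U \<inter> cdom M b)" using U open_cdom by auto
  have c: "smooth_fun_on M (U \<inter> cdom M b) (\<lambda>q. coord_change M b a q v \<bullet> k)" for k
    by (rule smooth_fun_on_bounded_linear[OF o bounded_linear_inner_left smooth_fun_on_subset[OF smooth_coord_change[of b a]]])
      (use U in auto)
  have "smooth_fun_on M (U \<inter> cdom M b) (\<lambda>q. \<Sum>k\<in>Basis. (coord_change M b a q v \<bullet> k) * \<alpha> q (coord_field M a k q))"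
    by (rule smooth_fun_on_sum[OF o], rule smooth_fun_on_mult[OF o c]) (rule smooth_fun_on_subset[OF \<alpha>], auto)
  then show "smooth_fun_on M (U \<inter> cdom M b) (\<lambda>q. \<alpha> q (coord_field M b v q))"
  proof (rule smooth_fun_on_cong[OF o, rotated])
    fix q assume "q \<in> U \<inter> cdom M b"
    then have q: "q \<in> cdom M a" "q \<in> cdom M b" using U by auto
    show "(\<Sum>k\<in>Basis. (coord_change M b a q v \<bullet> k) * \<alpha> q (coord_field M a k q)) = \<alpha> q (coord_field M b v q)"
      unfolding coord_field_change[OF q, of v]
      by (subst (2) coord_field_sum) (simp add: blinfun.sum_right blinfun.scaleR_right)
  qed
qed

lemma one_formsI_local:
  assumes "\<And>p. \<exists>V. open V \<and> p \<in> V \<and> smooth_form_on V \<alpha>"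
  shows "\<alpha> \<in> one_forms M"
  unfolding one_forms_def
proof (safe, rule smooth_fun_on_local)
  fix a v p assume p: "p \<in> cdom M a"
  obtain V where "open V" "p \<in> V" "smooth_form_on V \<alpha>" using assms by blast
  then show "\<exists>V. open V \<and> p \<in> V \<and> smooth_fun_on M V (\<lambda>q. \<alpha> q (coord_field M a v q))"
    using p open_cdom by (intro exI[of _ "V \<inter> cdom M a"]) (auto simp: smooth_form_on_def)
qed

lemma one_forms_add: "\<alpha> \<in> one_forms M \<Longrightarrow> \<beta> \<in> one_forms M \<Longrightarrow> (\<lambda>p. \<alpha> p + \<beta> p) \<in> one_forms M"
  by (simp add: one_forms_def blinfun.add_left smooth_fun_on_add open_cdom)

lemma one_forms_mult: "smooth_fun M u \<Longrightarrow> \<alpha> \<in> one_forms M \<Longrightarrow> (\<lambda>p. u p *\<^sub>R \<alpha> p) \<in> one_forms M"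
  by (auto simp: one_forms_def blinfun.scaleR_left intro!: smooth_fun_on_mult open_cdom intro: smooth_fun_on_subset)

lemma one_forms_scaleR: "\<alpha> \<in> one_forms M \<Longrightarrow> (\<lambda>p. c *\<^sub>R \<alpha> p) \<in> one_forms M"
  by (rule one_forms_mult[OF smooth_fun_on_const])

lemma one_forms_zero: "(\<lambda>p. 0) \<in> one_forms M"
  by (simp add: one_forms_def smooth_fun_on_const)

lemma one_forms_diff:
  assumes "\<alpha> \<in> one_forms M" "\<beta> \<in> one_forms M"
  shows "(\<lambda>p. \<alpha> p - \<beta> p) \<in> one_forms M"
  using one_forms_add[OF assms(1) one_forms_scaleR[OF assms(2), of "-1"]] by simp

lemma one_forms_sum: "(\<And>i. i \<in> I \<Longrightarrow> \<alpha> i \<in> one_forms M) \<Longrightarrow> (\<lambda>p. \<Sum>i\<in>I. \<alpha> i p) \<in> one_forms M"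
  by (induction I rule: infinite_finite_induct) (auto intro: one_forms_add one_forms_zero)

text \<open>This turns forms given in a chart into global ones, on which connections are defined:
  outside \<open>U\<close> the product is 0 on the open set \<open>- K\<close>.\<close>

lemma one_forms_extend:
  fixes \<alpha> :: "('a, 'e) form"
  assumes U: "open U" "U \<subseteq> cdom M a" and \<alpha>: "\<And>v. smooth_fun_on M U (\<lambda>q. \<alpha> q (coord_field M a v q))"
    and \<rho>: "smooth_fun M \<rho>" "closed K" "K \<subseteq> U" "\<And>q. q \<notin> K \<Longrightarrow> \<rho> q = 0"
  shows "(\<lambda>q. \<rho> q *\<^sub>R \<alpha> q) \<in> one_forms M"
proof (rule one_formsI_local)
  fix p
  show "\<exists>V. open V \<and> p \<in> V \<and> smooth_form_on V (\<lambda>q. \<rho> q *\<^sub>R \<alpha> q)"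
  proof (cases "p \<in> U")
    case True
    have "smooth_form_on U (\<lambda>q. \<rho> q *\<^sub>R \<alpha> q)"
      by (rule smooth_form_onI_chart[OF U])
        (auto simp: blinfun.scaleR_left intro!: smooth_fun_on_mult U \<alpha> smooth_fun_on_subset[OF \<rho>(1)])
    then show ?thesis using True U by blast
  next
    case False
    have "smooth_form_on (- K) (\<lambda>q. \<rho> q *\<^sub>R \<alpha> q)"
      unfolding smooth_form_on_def
    proof (intro allI)
      fix a v show "smooth_fun_on M (- K \<inter> cdom M a) (\<lambda>q. (\<rho> q *\<^sub>R \<alpha> q) (coord_field M a v q))"
        by (rule smooth_fun_on_cong[OF _ _ smooth_fun_on_const[of _ 0]]) (use \<rho> open_cdom in auto)
    qed
    then show ?thesis using False \<rho>(2,3) by (metis ComplI open_Compl subsetD)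
  qed
qed

section \<open>Exact forms, covectors as values of forms, and tensoriality\<close>

lemma differential_one_form:
  assumes "smooth_fun M u"
  shows "differential M u \<in> one_forms M"
  unfolding one_forms_def
proof safe
  fix a v
  have "smooth_on (cmap M a ` cdom M a) (u \<circ> cinv M a)"
    using assms unfolding smooth_fun_on_def by (metis Int_UNIV_left)
  then have "smooth_on (cmap M a ` cdom M a) (\<lambda>x. frechet_derivative (u \<circ> cinv M a) (at x) v)"
    by (rule smooth_on_frechet_derivative)
  then show "smooth_fun_on M (cdom M a) (\<lambda>p. differential M u p (coord_field M a v p))"
    by (intro smooth_fun_on_chartI[OF open_cdom order_refl], elim smooth_on_cong[OF open_range, rotated])
      (use differential_coord_field[OF open_UNIV assms, of _ a v] in auto)
qed

lemma differential_eqI: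
  assumes "(u \<circ> cinv M p has_derivative D) (at (cmap M p p))"
  shows "differential M u p v = D v"
  using has_derivative_bounded_linear[OF assms]
  by (simp add: differential_def frechet_derivative_at[OF assms, symmetric] bounded_linear_Blinfun_apply)

lemma differential_const: "differential M (\<lambda>q. c) p = 0"
  by (rule blinfun_eqI, subst differential_eqI[where D = "\<lambda>v. 0"]) (auto simp: comp_def)

lemma differential_add:
  assumes "smooth_fun_on M U u" "smooth_fun_on M U w" "p \<in> U"
  shows "differential M (\<lambda>q. u q + w q) p = differential M u p + differential M w p"
  by (rule blinfun_eqI, rule differential_eqI)
    (use has_derivative_add[OF differential_has_derivative[OF assms(1,3)] differential_has_derivative[OF assms(2,3)]]
      in \<open>simp add: comp_def blinfun.add_left\<close>)

lemma differential_mult: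
  assumes "smooth_fun_on M U u" "smooth_fun_on M U w" "p \<in> U"
  shows "differential M (\<lambda>q. u q * w q) p = u p *\<^sub>R differential M w p + w p *\<^sub>R differential M u p"
proof (rule blinfun_eqI, rule differential_eqI)
  show "((\<lambda>q. u q * w q) \<circ> cinv M p has_derivative
      blinfun_apply (u p *\<^sub>R differential M w p + w p *\<^sub>R differential M u p)) (at (cmap M p p))"
    by (rule has_derivative_eq_rhs, unfold comp_def, rule has_derivative_mult,
        rule differential_has_derivative[OF assms(1,3), unfolded comp_def],
        rule differential_has_derivative[OF assms(2,3), unfolded comp_def])
      (auto simp: mem_cdom blinfun.add_left blinfun.scaleR_left fun_eq_iff)
qed

text \<open>The linear function \<tau> of the coordinates is cut off by a bump function that is 1
  near \<open>p\<close>, so the cut-off leaves no trace in the differential there. Pointwise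
  identities between tensorial expressions can thus be tested on exact forms.\<close>

lemma covector_is_differential:
  fixes \<tau> :: "'e \<Rightarrow>\<^sub>L real"
  obtains u where "smooth_fun M u" "differential M u p = \<tau>"
proof -
  obtain \<rho> :: "'a \<Rightarrow> real" and K V where \<rho>: "smooth_fun M \<rho>" "closed K" "K \<subseteq> cdom M p" "\<And>q. q \<notin> K \<Longrightarrow> \<rho> q = 0"
    and V: "open V" "p \<in> V" "V \<subseteq> cdom M p" "\<And>q. q \<in> V \<Longrightarrow> \<rho> q = 1"
    using bump[OF open_cdom mem_cdom] by metis
  let ?u = "\<lambda>q. \<rho> q *\<^sub>R \<tau> (cmap M p q)"
  have "smooth_fun M ?u"
    by (rule smooth_fun_extend[OF open_cdom _ \<rho>])
      (rule smooth_fun_on_bounded_linear[OF open_cdom blinfun.bounded_linear_right smooth_fun_on_cmap])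
  moreover have "differential M ?u p = \<tau>"
  proof (rule blinfun_eqI, rule differential_eqI)
    have "open (cmap M p ` V)" "cmap M p p \<in> cmap M p ` V" using V open_image' by auto
    then show "(?u \<circ> cinv M p has_derivative blinfun_apply \<tau>) (at (cmap M p p))"
      by (rule has_derivative_transform_within_open[OF bounded_linear_imp_has_derivative[OF blinfun.bounded_linear_right]])
        (use V in \<open>auto simp: subset_iff\<close>)
  qed
  ultimately show thesis using that by blast
qed

lemma covector_is_form_value:
  fixes \<tau> :: "'e \<Rightarrow>\<^sub>L real"
  obtains \<alpha> where "\<alpha> \<in> one_forms M" "\<alpha> p = \<tau>"
proof -
  obtain u where "smooth_fun M u" "differential M u p = \<tau>" by (rule covector_is_differential)
  then show thesis using that differential_one_form by blast
qed

text \<open>Multiplication by the square of a bump function makes the expansion of \<open>\<alpha>\<close> in coordinate forms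
  global: one factor cuts off the coefficients, the other one the coordinate forms.\<close>

lemma tensorial:
  fixes T :: "('a, 'e) form \<Rightarrow> real"
  assumes add: "\<And>\<alpha> \<beta>. \<alpha> \<in> one_forms M \<Longrightarrow> \<beta> \<in> one_forms M \<Longrightarrow> T (\<lambda>q. \<alpha> q + \<beta> q) = T \<alpha> + T \<beta>"
    and mult: "\<And>\<alpha> u. \<alpha> \<in> one_forms M \<Longrightarrow> smooth_fun M u \<Longrightarrow> T (\<lambda>q. u q *\<^sub>R \<alpha> q) = u p * T \<alpha>"
    and \<alpha>\<beta>: "\<alpha> \<in> one_forms M" "\<beta> \<in> one_forms M" "\<alpha> p = \<beta> p"
  shows "T \<alpha> = T \<beta>"
proof -
  obtain \<rho> :: "'a \<Rightarrow> real" and K V where \<rho>: "smooth_fun M \<rho>" "closed K" "K \<subseteq> cdom M p" "\<And>q. q \<notin> K \<Longrightarrow> \<rho> q = 0"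
    and V: "p \<in> V" "\<And>q. q \<in> V \<Longrightarrow> \<rho> q = 1"
    using bump[OF open_cdom mem_cdom] by metis
  define \<theta> where "\<theta> k q = \<rho> q *\<^sub>R coord_form M p (blinfun_inner_right k) q" for k q
  have \<theta>: "\<theta> k \<in> one_forms M" for k
    unfolding \<theta>_def
    by (rule one_forms_extend[OF open_cdom order_refl _ \<rho>],
        rule smooth_fun_on_cong[OF open_cdom _ smooth_fun_on_const]) (simp add: coord_form_coord_field)
  have sum: "T (\<lambda>q. \<Sum>i\<in>I. \<gamma> i q) = (\<Sum>i\<in>I. T (\<gamma> i))" if "finite I" "\<And>i. i \<in> I \<Longrightarrow> \<gamma> i \<in> one_forms M" for I and \<gamma> :: "'e \<Rightarrow> ('a, 'e) form"
    using that
  proof (induction I rule: finite_induct)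
    case empty
    show ?case using mult[OF one_forms_zero smooth_fun_on_const[of _ 0]] by simp
  next
    case (insert i I)
    then show ?case by (simp add: add one_forms_sum)
  qed
  have "T \<gamma> = (\<Sum>k\<in>Basis. \<gamma> p k * T (\<theta> k))" if \<gamma>: "\<gamma> \<in> one_forms M" for \<gamma>
  proof -
    define a where "a k q = \<rho> q *\<^sub>R \<gamma> q (coord_field M p k q)" for k q
    have a: "smooth_fun M (a k)" for k
      unfolding a_def by (rule smooth_fun_extend[OF open_cdom one_formsD[OF \<gamma>] \<rho>])
    have "(\<lambda>q. (\<rho> q * \<rho> q) *\<^sub>R \<gamma> q) = (\<lambda>q. \<Sum>k\<in>Basis. a k q *\<^sub>R \<theta> k q)"
    proof
      fix q
      show "(\<rho> q * \<rho> q) *\<^sub>R \<gamma> q = (\<Sum>k\<in>Basis. a k q *\<^sub>R \<theta> k q)"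
      proof (cases "q \<in> cdom M p")
        case True
        show ?thesis
          by (subst form_coord_sum[OF True, of "\<gamma> q"]) (simp add: a_def \<theta>_def scaleR_sum_right algebra_simps)
      next
        case False
        then have "\<rho> q = 0" using \<rho> by blast
        then show ?thesis by (simp add: a_def)
      qed
    qed
    then have "T (\<lambda>q. (\<rho> q * \<rho> q) *\<^sub>R \<gamma> q) = (\<Sum>k\<in>Basis. a k p * T (\<theta> k))"
      using a by (simp add: sum one_forms_mult mult \<theta>)
    then show ?thesis
      using mult[OF \<gamma> smooth_fun_on_mult[OF open_UNIV \<rho>(1) \<rho>(1)]] V by (simp add: a_def)
  qed
  then show ?thesis using \<alpha>\<beta> by simp
qed

end

section \<open>The Koszul bracket of exact forms\<close>

locale bivector_manifold = manifold M
  for M :: "('a::{t2_space, second_countable_topology}, 'e::euclidean_space) mfd" +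
  fixes P :: "('a, 'e) bivector"
  assumes bivector_field: "bivector_field M P"
begin

lemma bilinear_P: "bilinear (P p)"
  and P_antisym: "P p \<omega> \<tau> = - P p \<tau> \<omega>"
  and smooth_P_coord: "smooth_fun_on M (cdom M a) (\<lambda>p. P p (coord_form M a \<omega> p) (coord_form M a \<tau> p))"
  using bivector_field unfolding bivector_field_def by blast+

lemma linear_P: "linear (P p \<omega>)" "linear (\<lambda>\<omega>. P p \<omega> \<tau>)"
  using bilinear_P by (auto simp: bilinear_def)

lemmas P_simps =
  linear_add[OF linear_P(1)] linear_add[OF linear_P(2)] linear_cmul[OF linear_P(1)] linear_cmul[OF linear_P(2)]
  linear_0[OF linear_P(1)] linear_0[OF linear_P(2)] linear_diff[OF linear_P(1)] linear_diff[OF linear_P(2)]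

text \<open>In finite dimension a linear functional on covectors is evaluation at a vector, whose
  components are the values of the functional on the dual basis. This settles existence and
  uniqueness for the definite description in \<open>anchor\<close>.\<close>

lemma apply_anchor: "blinfun_apply \<beta> (anchor P \<alpha> p) = P p (\<alpha> p) \<beta>"
proof -
  let ?v = "\<Sum>k\<in>Basis. P p (\<alpha> p) (blinfun_inner_right k) *\<^sub>R k"
  have v: "\<beta> ?v = P p (\<alpha> p) \<beta>" for \<beta> :: "'e \<Rightarrow>\<^sub>L real"
    by (subst (2) blinfun_representation[of \<beta>])
      (simp add: linear_sum[OF linear_P(1)] P_simps blinfun.sum_right blinfun.scaleR_right mult.commute)
  have "\<forall>\<beta>. blinfun_apply \<beta> (anchor P \<alpha> p) = P p (\<alpha> p) \<beta>"
    unfolding anchor_def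
  proof (rule theI[of _ ?v])
    show "w = ?v" if w: "\<forall>\<beta>. blinfun_apply \<beta> w = P p (\<alpha> p) \<beta>" for w
    proof (rule euclidean_eqI)
      fix b :: 'e
      have "blinfun_inner_right b w = blinfun_inner_right b ?v" using w v by metis
      then show "w \<bullet> b = ?v \<bullet> b" by (simp only: blinfun_inner_right.rep_eq inner_commute)
    qed
  qed (use v in blast)
  then show ?thesis by blast
qed

lemma deriv_along_anchor: "deriv_along M (anchor P \<alpha>) u p = P p (\<alpha> p) (differential M u p)"
  by (simp add: deriv_along_def apply_anchor)

lemma smooth_P:
  assumes U: "open U" and \<alpha>: "smooth_form_on U \<alpha>" and \<beta>: "smooth_form_on U \<beta>"
  shows "smooth_fun_on M U (\<lambda>p. P p (\<alpha> p) (\<beta> p))"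
proof (rule smooth_fun_on_local)
  fix p assume p: "p \<in> U"
  let ?V = "U \<inter> cdom M p"
  have V: "open ?V" using U open_cdom by auto
  have "smooth_fun_on M ?V (\<lambda>q. \<Sum>k\<in>Basis. \<Sum>l\<in>Basis. (\<alpha> q (coord_field M p k q) * \<beta> q (coord_field M p l q)) *
      P q (coord_form M p (blinfun_inner_right k) q) (coord_form M p (blinfun_inner_right l) q))"
    by (intro smooth_fun_on_sum V smooth_fun_on_mult smooth_fun_on_subset[OF smooth_P_coord])
      (use \<alpha> \<beta> in \<open>auto simp: smooth_form_on_def\<close>)
  then have "smooth_fun_on M ?V (\<lambda>q. P q (\<alpha> q) (\<beta> q))"
  proof (rule smooth_fun_on_cong[OF V, rotated])
    fix q assume "q \<in> ?V"
    then have q: "q \<in> cdom M p" by auto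
    show "(\<Sum>k\<in>Basis. \<Sum>l\<in>Basis. (\<alpha> q (coord_field M p k q) * \<beta> q (coord_field M p l q)) *
      P q (coord_form M p (blinfun_inner_right k) q) (coord_form M p (blinfun_inner_right l) q)) = P q (\<alpha> q) (\<beta> q)"
      by (subst (2) form_coord_sum[OF q, of "\<alpha> q"], subst (2) form_coord_sum[OF q, of "\<beta> q"])
        (simp add: linear_sum[OF linear_P(1)] linear_sum[OF linear_P(2)] P_simps sum_distrib_left mult_ac, rule sum.swap)
  qed
  then show "\<exists>V. open V \<and> p \<in> V \<and> smooth_fun_on M V (\<lambda>p. P p (\<alpha> p) (\<beta> p))"
    using V p mem_cdom by blast
qed

lemma smooth_P_forms: "\<alpha> \<in> one_forms M \<Longrightarrow> \<beta> \<in> one_forms M \<Longrightarrow> smooth_fun M (\<lambda>p. P p (\<alpha> p) (\<beta> p))"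
  using smooth_P[of UNIV] by (simp add: one_forms_iff)

lemma smooth_poisson_bracket: "smooth_fun M u \<Longrightarrow> smooth_fun M w \<Longrightarrow> smooth_fun M (poisson_bracket M P u w)"
  unfolding poisson_bracket_def by (intro smooth_P_forms differential_one_form)

lemma smooth_form_on_coord_form: "smooth_form_on (cdom M a) (coord_form M a \<omega>)"
  by (rule smooth_form_onI_chart[OF open_cdom order_refl], rule smooth_fun_on_cong[OF open_cdom _ smooth_fun_on_const])
    (simp add: coord_form_coord_field)

lemma coord_comp_anchor:
  "coord_comp M a (anchor P \<alpha>) q = (\<Sum>k\<in>Basis. P q (\<alpha> q) (coord_form M a (blinfun_inner_right k) q) *\<^sub>R k)"
proof (rule euclidean_eqI)
  fix b :: 'e assume b: "b \<in> Basis"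
  have "coord_comp M a (anchor P \<alpha>) q \<bullet> b = coord_form M a (blinfun_inner_right b) q (anchor P \<alpha> q)"
    by (simp add: coord_comp_def coord_form_def blinfun_inner_right.rep_eq inner_commute)
  then show "coord_comp M a (anchor P \<alpha>) q \<bullet> b =
      (\<Sum>k\<in>Basis. P q (\<alpha> q) (coord_form M a (blinfun_inner_right k) q) *\<^sub>R k) \<bullet> b"
    using b by (simp add: apply_anchor)
qed

lemma smooth_coord_comp_anchor:
  assumes "\<alpha> \<in> one_forms M"
  shows "smooth_fun_on M (cdom M a) (coord_comp M a (anchor P \<alpha>))"
  unfolding coord_comp_anchor
  by (intro smooth_fun_on_sum open_cdom smooth_fun_on_scaleR smooth_fun_on_const
      smooth_P one_forms_smooth_form_on[OF assms] smooth_form_on_coord_form)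

end

section \<open>Lie derivatives of exact forms\<close>

context manifold
begin

lemma differential_uminus:
  assumes "smooth_fun_on M U u" "p \<in> U"
  shows "differential M (\<lambda>q. - u q) p = - differential M u p"
  by (rule blinfun_eqI, rule differential_eqI)
    (use has_derivative_minus[OF differential_has_derivative[OF assms]] in \<open>simp add: comp_def blinfun.minus_left\<close>)

lemma field_coord_comp: "q \<in> cdom M a \<Longrightarrow> coord_field M a (coord_comp M a X q) q = X q"
  by (simp add: coord_comp_def vector_coord_field)

text \<open>In the chart at \<open>p\<close>, with \<open>Y\<close> the components of the field and
  \<open>H v\<close> the derivative of \<open>w\<close> in the fixed direction \<open>v\<close>, the
  right-hand side differentiates the sum of \<open>Y\<close>-components times partial derivatives.
  The terms with derivatives of \<open>Y\<close> come from the Lie bracket; the remaining ones match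
  by the symmetry of second derivatives.\<close>

lemma lie_derivative_exact:
  assumes w: "smooth_fun M w" and X: "smooth_fun_on M (cdom M p) (coord_comp M p X)"
  shows "lie_derivative M X (differential M w) p = differential M (\<lambda>q. differential M w q (X q)) p"
proof -
  let ?\<Omega> = "cmap M p ` cdom M p" and ?x = "cmap M p p"
  define W where "W = w \<circ> cinv M p"
  define Y where "Y = coord_comp M p X \<circ> cinv M p"
  define H where "H v x = frechet_derivative W (at x) v" for v x
  have x: "?x \<in> ?\<Omega>" using mem_cdom by auto
  have W: "smooth_on ?\<Omega> W"
    unfolding W_def using w unfolding smooth_fun_on_def by (metis Int_UNIV_left)
  have Y: "smooth_on ?\<Omega> Y"
    unfolding Y_def using smooth_fun_onD[OF open_cdom X order_refl] .
  have H: "(H v has_derivative frechet_derivative (H v) (at ?x)) (at ?x)" for v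
    unfolding H_def by (rule smooth_on_has_derivative[OF smooth_on_frechet_derivative[OF W] x])
  have Y': "(Y has_derivative frechet_derivative Y (at ?x)) (at ?x)"
    by (rule smooth_on_has_derivative[OF Y x])
  have linH: "linear (\<lambda>v. H v y)" if "y \<in> ?\<Omega>" for y
    unfolding H_def by (rule linear_frechet_derivative[OF smooth_on_differentiable[OF W that]])
  have H_sum: "H v y = (\<Sum>k\<in>Basis. (v \<bullet> k) * H k y)" if "y \<in> ?\<Omega>" for v y
  proof -
    have "H (\<Sum>k\<in>Basis. (v \<bullet> k) *\<^sub>R k) y = (\<Sum>k\<in>Basis. (v \<bullet> k) * H k y)"
      by (simp add: linear_sum[OF linH[OF that]] linear_cmul[OF linH[OF that]])
    then show ?thesis by (simp add: euclidean_representation)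
  qed
  have dw: "differential M w q (coord_field M p v q) = H v (cmap M p q)" if "q \<in> cdom M p" for q v
    using differential_coord_field[OF open_UNIV w _ that] by (simp add: H_def W_def)
  have schwarz: "frechet_derivative (H k) (at ?x) v = frechet_derivative (H v) (at ?x) k" for k v
    unfolding H_def by (rule frechet_derivative_frechet_derivative_commute[OF open_range x W])
  have "((\<lambda>x. \<Sum>k\<in>Basis. (Y x \<bullet> k) * H k x) has_derivative
      (\<lambda>v. \<Sum>k\<in>Basis. (Y ?x \<bullet> k) * frechet_derivative (H k) (at ?x) v + (frechet_derivative Y (at ?x) v \<bullet> k) * H k ?x)) (at ?x)"
    by (intro has_derivative_sum has_derivative_mult H bounded_linear.has_derivative[OF bounded_linear_inner_left Y'])
  then have "((\<lambda>q. differential M w q (X q)) \<circ> cinv M p has_derivative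
      (\<lambda>v. \<Sum>k\<in>Basis. (Y ?x \<bullet> k) * frechet_derivative (H k) (at ?x) v + (frechet_derivative Y (at ?x) v \<bullet> k) * H k ?x)) (at ?x)"
  proof (rule has_derivative_transform_within_open[OF _ open_range x])
    fix y assume y: "y \<in> ?\<Omega>"
    then have q: "cinv M p y \<in> cdom M p" by auto
    have "differential M w (cinv M p y) (X (cinv M p y)) = H (Y y) y"
      using dw[OF q, of "Y y"] y by (simp add: Y_def field_coord_comp[OF q])
    then show "(\<Sum>k\<in>Basis. (Y y \<bullet> k) * H k y) = ((\<lambda>q. differential M w q (X q)) \<circ> cinv M p) y"
      using H_sum[OF y, of "Y y"] by simp
  qed
  then have d: "differential M (\<lambda>q. differential M w q (X q)) p v =
      (\<Sum>k\<in>Basis. (Y ?x \<bullet> k) * frechet_derivative (H k) (at ?x) v + (frechet_derivative Y (at ?x) v \<bullet> k) * H k ?x)" for v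
    by (rule differential_eqI)
  have Yx: "Y ?x = X p" by (simp add: Y_def coord_comp_def mem_cdom)
  have "deriv_along M X (\<lambda>q. differential M w q (coord_field M p v q)) p -
      differential M w p (lie_bracket M X (coord_field M p v) p) = differential M (\<lambda>q. differential M w q (X q)) p v" for v
  proof -
    have 1: "deriv_along M X (\<lambda>q. differential M w q (coord_field M p v q)) p = frechet_derivative (H v) (at ?x) (X p)"
      unfolding deriv_along_def
      by (rule differential_eqI, rule has_derivative_transform_within_open[OF H open_range x]) (use dw in auto)
    \<comment> \<open>The extension of \<open>v\<close> has constant components, so only the
      derivative of \<open>X\<close> survives in the bracket.\<close>
    have "(coord_comp M p (coord_field M p v) \<circ> cinv M p has_derivative (\<lambda>_. 0)) (at ?x)"
      by (rule has_derivative_transform_within_open[OF has_derivative_const[of v] open_range x])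
        (auto simp: coord_comp_def coord_field_def coord_change_comp mem_cdom)
    then have "lie_bracket M X (coord_field M p v) p = - frechet_derivative Y (at ?x) v"
      by (simp add: lie_bracket_def Y_def frechet_derivative_at[symmetric])
    then have 2: "differential M w p (lie_bracket M X (coord_field M p v) p) = - H (frechet_derivative Y (at ?x) v) ?x"
      using dw[OF mem_cdom, of "frechet_derivative Y (at ?x) v"] by (simp add: blinfun.minus_right)
    have "frechet_derivative (H v) (at ?x) (X p) = (\<Sum>k\<in>Basis. (X p \<bullet> k) * frechet_derivative (H v) (at ?x) k)"
    proof -
      have l: "linear (frechet_derivative (H v) (at ?x))"
        using H has_derivative_linear by blast
      have "frechet_derivative (H v) (at ?x) (\<Sum>k\<in>Basis. (X p \<bullet> k) *\<^sub>R k) = (\<Sum>k\<in>Basis. (X p \<bullet> k) * frechet_derivative (H v) (at ?x) k)"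
        by (simp add: linear_sum[OF l] linear_cmul[OF l])
      then show ?thesis by (simp add: euclidean_representation)
    qed
    then show ?thesis
      unfolding 1 2 d Yx H_sum[OF x, of "frechet_derivative Y (at ?x) v"] by (simp add: sum.distrib schwarz[of _ v])
  qed
  then show ?thesis by (simp add: lie_derivative_def blinfun_apply_inverse)
qed

end

context bivector_manifold
begin

text \<open>Each of the two Lie derivative terms contributes one copy of \<open>d {u, w}\<close>,
  the second by antisymmetry; the last term of the Koszul bracket removes one of them.\<close>

lemma koszul_exact:
  assumes u: "smooth_fun M u" and w: "smooth_fun M w"
  shows "koszul M P (differential M u) (differential M w) p = differential M (poisson_bracket M P u w) p"
proof -
  have 1: "lie_derivative M (anchor P (differential M u)) (differential M w) p = differential M (poisson_bracket M P u w) p"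
    if "smooth_fun M u" "smooth_fun M w" for u w
    using lie_derivative_exact[OF that(2) smooth_coord_comp_anchor[OF differential_one_form[OF that(1)]]]
    unfolding apply_anchor poisson_bracket_def[abs_def] .
  have "poisson_bracket M P w u = (\<lambda>q. - poisson_bracket M P u w q)"
    by (auto simp: poisson_bracket_def P_antisym[of _ "differential M u _"])
  then have 2: "differential M (poisson_bracket M P w u) p = - differential M (poisson_bracket M P u w) p"
    using differential_uminus[OF smooth_poisson_bracket[OF u w], of p] by simp
  show ?thesis
    unfolding koszul_def 1[OF u w] 1[OF w u] 2 by (simp add: poisson_bracket_def[abs_def])
qed

end

section \<open>Metrics and orthonormal coframes\<close>

text \<open>The pointwise content of \<open>pseudo_riemannian\<close>. Nondegeneracy takes the place
  of positivity, so isotropic vectors may exist.\<close>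

definition scalar_product :: "('e::euclidean_space \<Rightarrow> 'e \<Rightarrow> real) \<Rightarrow> bool" where
  "scalar_product B \<longleftrightarrow> bilinear B \<and> (\<forall>v w. B v w = B w v) \<and> (\<forall>v. (\<forall>w. B v w = 0) \<longrightarrow> v = 0)"

lemma scalar_productD:
  assumes "scalar_product B"
  shows "linear (B v)" "linear (\<lambda>v. B v w)" "B v w = B w v" "(\<And>w. B v w = 0) \<Longrightarrow> v = 0"
  using assms unfolding scalar_product_def bilinear_def by auto

lemma scalar_product_simps:
  assumes "scalar_product B"
  shows "B (x + y) w = B x w + B y w" "B w (x + y) = B w x + B w y"
    "B (c *\<^sub>R x) w = c * B x w" "B w (c *\<^sub>R x) = c * B w x"
    "B (x - y) w = B x w - B y w" "B w (x - y) = B w x - B w y"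
    "B 0 w = 0" "B w 0 = 0"
    "B (sum h I) w = (\<Sum>i\<in>I. B (h i) w)" "B w (sum h I) = (\<Sum>i\<in>I. B w (h i))"
  using scalar_productD(1,2)[OF assms]
  by (simp_all add: linear_add[of "B w"] linear_add[of "\<lambda>v. B v w"] linear_cmul[of "B w"] linear_cmul[of "\<lambda>v. B v w"]
      linear_diff[of "B w"] linear_diff[of "\<lambda>v. B v w"] linear_0[of "B w"] linear_0[of "\<lambda>v. B v w"]
      linear_sum[of "B w"] linear_sum[of "\<lambda>v. B v w"])

text \<open>Relative to the Euclidean inner product, \<open>B\<close> becomes an endomorphism
  \<open>L\<close>, injective by nondegeneracy and hence surjective by dimension. This justifies the
  definite description in \<open>metric_raise\<close>.\<close>

lemma scalar_product_represents:
  fixes B :: "'e::euclidean_space \<Rightarrow> 'e \<Rightarrow> real" and \<omega> :: "'e \<Rightarrow>\<^sub>L real"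
  assumes B: "scalar_product B"
  shows "\<exists>!v. \<forall>w. B v w = \<omega> w"
proof -
  note simps = scalar_product_simps[OF B]
  define L where "L v = (\<Sum>k\<in>Basis. B v k *\<^sub>R k)" for v
  have L: "w \<bullet> L v = B v w" for v w
  proof -
    have "B v (\<Sum>k\<in>Basis. (w \<bullet> k) *\<^sub>R k) = (\<Sum>k\<in>Basis. (w \<bullet> k) * B v k)" by (simp add: simps)
    then show ?thesis by (simp add: L_def inner_sum_right euclidean_representation mult.commute)
  qed
  have lin: "linear L"
    by (rule linearI) (simp_all add: L_def simps scaleR_add_left sum.distrib scaleR_sum_right)
  have "inj L"
  proof (rule linear_injective_0[OF lin, THEN iffD2], safe)
    fix v assume "L v = 0"
    then have "B v w = 0" for w using L[of w v] by simp
    then show "v = 0" by (rule scalar_productD(4)[OF B])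
  qed
  then have "surj L" using linear_injective_imp_surjective[OF lin] by blast
  then obtain v where v: "L v = (\<Sum>k\<in>Basis. \<omega> k *\<^sub>R k)" by (metis surjD)
  have "B v w = \<omega> w" for w
  proof -
    have "B v w = w \<bullet> (\<Sum>k\<in>Basis. \<omega> k *\<^sub>R k)" by (simp only: L[symmetric] v)
    also have "\<dots> = (\<Sum>k\<in>Basis. (w \<bullet> k) * \<omega> k)" by (simp add: inner_sum_right mult.commute)
    also have "\<dots> = \<omega> (\<Sum>k\<in>Basis. (w \<bullet> k) *\<^sub>R k)" by (simp only: blinfun.sum_right blinfun.scaleR_right) simp
    finally show ?thesis by (simp add: euclidean_representation)
  qed
  moreover have "v' = v" if "\<forall>w. B v' w = \<omega> w" for v'
  proof -
    have "B (v' - v) w = 0" for w using that calculation by (simp add: simps)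
    then show ?thesis using scalar_productD(4)[OF B] by (metis eq_iff_diff_eq_0)
  qed
  ultimately show ?thesis by blast
qed

lemma orthonormal_independent:
  fixes B :: "'e::euclidean_space \<Rightarrow> 'e \<Rightarrow> real" and n :: nat
  assumes B: "scalar_product B"
    and Y: "\<And>i. i < n \<Longrightarrow> B (Y i) (Y i) \<in> {1, -1}" "\<And>i j. i < n \<Longrightarrow> j < n \<Longrightarrow> i \<noteq> j \<Longrightarrow> B (Y i) (Y j) = 0"
  shows "independent (Y ` {..<n})" "inj_on Y {..<n}"
proof -
  note simps = scalar_product_simps[OF B]
  show inj: "inj_on Y {..<n}"
  proof (rule inj_onI)
    fix i j assume ij: "i \<in> {..<n}" "j \<in> {..<n}" "Y i = Y j"
    show "i = j"
    proof (rule ccontr)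
      assume "i \<noteq> j"
      then have "B (Y i) (Y i) = 0" using Y(2)[of i j] ij by simp
      then show False using Y(1)[of i] ij by simp
    qed
  qed
  show "independent (Y ` {..<n})"
  proof (rule independent_if_scalars_zero)
    fix c y assume s: "(\<Sum>x\<in>Y ` {..<n}. c x *\<^sub>R x) = 0" and y: "y \<in> Y ` {..<n}"
    then obtain j where j: "j < n" "y = Y j" by auto
    have "0 = B (\<Sum>i<n. c (Y i) *\<^sub>R Y i) (Y j)" using s inj by (simp add: sum.reindex simps)
    also have "\<dots> = (\<Sum>i<n. if i = j then c (Y j) * B (Y j) (Y j) else 0)"
      unfolding simps by (rule sum.cong) (use Y(2) j in auto)
    also have "\<dots> = c (Y j) * B (Y j) (Y j)" using j by simp
    finally show "c y = 0" using j Y(1)[of j] by auto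
  qed auto
qed

text \<open>The difference of both sides is orthogonal to all \<open>Y i\<close>, which span the
  space by a dimension count, so nondegeneracy kills it. The sign \<open>B (Y i) (Y i)\<close>
  serves as its own inverse.\<close>

lemma orthonormal_expansion:
  fixes B :: "'e::euclidean_space \<Rightarrow> 'e \<Rightarrow> real"
  assumes B: "scalar_product B"
    and Y: "\<And>i. i < DIM('e) \<Longrightarrow> B (Y i) (Y i) \<in> {1, -1}"
      "\<And>i j. i < DIM('e) \<Longrightarrow> j < DIM('e) \<Longrightarrow> i \<noteq> j \<Longrightarrow> B (Y i) (Y j) = 0"
  shows "w = (\<Sum>i<DIM('e). (B (Y i) (Y i) * B w (Y i)) *\<^sub>R Y i)"
proof -
  note simps = scalar_product_simps[OF B]
  let ?w = "w - (\<Sum>i<DIM('e). (B (Y i) (Y i) * B w (Y i)) *\<^sub>R Y i)"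
  note ind = orthonormal_independent[OF B, of "DIM('e)" Y, OF Y]
  have "card (Y ` {..<DIM('e)}) = dim (UNIV :: 'e set)"
    using card_image[OF ind(2)] by simp
  then have span: "span (Y ` {..<DIM('e)}) = UNIV"
    using card_eq_dim[of "Y ` {..<DIM('e)}" UNIV] ind(1) by auto
  have orth: "B ?w (Y j) = 0" if j: "j < DIM('e)" for j
  proof -
    have "(\<Sum>i<DIM('e). (B (Y i) (Y i) * B w (Y i)) * B (Y i) (Y j)) =
        (\<Sum>i<DIM('e). if i = j then B w (Y j) else 0)"
      by (rule sum.cong) (use Y[of j] Y(2)[of _ j] j in auto)
    then show ?thesis using j by (simp add: simps)
  qed
  have "B ?w x = 0" if "x \<in> span (Y ` {..<DIM('e)})" for x
    using that
  proof (induction rule: span_induct_alt)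
    case base
    show ?case by (rule simps(8))
  next
    case (step c y z)
    then show ?case using orth by (auto simp only: simps(2,4))
  qed
  then have "?w = 0" using span scalar_productD(4)[OF B] by blast
  then show ?thesis by simp
qed

text \<open>If all vectors orthogonal to the family were isotropic, then by polarization they would be orthogonal
  to everything.\<close>

lemma orthonormal_extend:
  fixes B :: "'e::euclidean_space \<Rightarrow> 'e \<Rightarrow> real"
  assumes B: "scalar_product B" and n: "n < DIM('e)"
    and Y: "\<And>i. i < n \<Longrightarrow> B (Y i) (Y i) \<in> {1, -1}" "\<And>i j. i < n \<Longrightarrow> j < n \<Longrightarrow> i \<noteq> j \<Longrightarrow> B (Y i) (Y j) = 0"
  shows "\<exists>w. (\<forall>i<n. B w (Y i) = 0) \<and> B w w \<noteq> 0"
proof (rule ccontr)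
  assume "\<not> ?thesis"
  then have iso: "B w w = 0" if "\<And>i. i < n \<Longrightarrow> B w (Y i) = 0" for w using that by blast
  note simps = scalar_product_simps[OF B] and sym = scalar_productD(3)[OF B]
  \<comment> \<open>The projection to the orthogonal complement of the family; it is nonzero on a
    vector outside the span.\<close>
  define pr where "pr v = v - (\<Sum>i<n. (B (Y i) (Y i) * B v (Y i)) *\<^sub>R Y i)" for v
  have pr: "B (pr v) (Y j) = 0" if j: "j < n" for v j
  proof -
    have "(\<Sum>i<n. (B (Y i) (Y i) * B v (Y i)) * B (Y i) (Y j)) = (\<Sum>i<n. if i = j then B v (Y j) else 0)"
      by (rule sum.cong) (use Y(1)[of j] Y(2)[of _ j] j in auto)
    then show ?thesis using j by (simp add: simps pr_def)
  qed
  have "dim (span (Y ` {..<n})) \<le> card (Y ` {..<n})" by (simp add: dim_le_card')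
  also have "\<dots> < DIM('e)" using n card_image_le[of "{..<n}" Y] by auto
  finally have "span (Y ` {..<n}) \<noteq> UNIV" by (metis dim_UNIV less_irrefl)
  then obtain v where v: "v \<notin> span (Y ` {..<n})" by blast
  have "pr v \<noteq> 0"
  proof
    assume "pr v = 0"
    then have "v = (\<Sum>i<n. (B (Y i) (Y i) * B v (Y i)) *\<^sub>R Y i)" by (simp add: pr_def)
    then show False using v by (metis (no_types, lifting) imageI span_base span_scale span_sum)
  qed
  moreover have "B (pr v) x = 0" for x
  proof -
    have "B (pr v + pr x) (pr v + pr x) = 0" "B (pr v) (pr v) = 0" "B (pr x) (pr x) = 0"
      by (rule iso, simp add: simps pr)+
    then have "B (pr v) (pr x) = 0" by (simp add: simps sym[of "pr x" "pr v"])
    then show ?thesis by (simp add: pr_def[of x] simps pr)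
  qed
  ultimately show False using scalar_productD(4)[OF B] by blast
qed

text \<open>A non-isotropic direction is needed at \<open>x0\<close> only: by continuity its square
  keeps its sign on a smaller neighbourhood, where the vector can be normalised smoothly. The signs
  \<epsilon> are therefore constant on \<open>V\<close>.\<close>

lemma smooth_gram_schmidt:
  fixes B :: "'e::euclidean_space \<Rightarrow> 'e \<Rightarrow> 'e \<Rightarrow> real"
  assumes S: "open S" "x0 \<in> S" and B: "\<And>x. x \<in> S \<Longrightarrow> scalar_product (B x)"
    and smooth: "\<And>v w. smooth_on S (\<lambda>x. B x v w)"
  shows "n \<le> DIM('e) \<Longrightarrow> \<exists>V Y (\<epsilon> :: nat \<Rightarrow> real). open V \<and> x0 \<in> V \<and> V \<subseteq> S \<and>
    (\<forall>i<n. smooth_on V (Y i) \<and> \<epsilon> i \<in> {1, -1} \<and> (\<forall>x\<in>V. B x (Y i x) (Y i x) = \<epsilon> i \<and>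
       (\<forall>j<n. i \<noteq> j \<longrightarrow> B x (Y i x) (Y j x) = 0)))"
proof (induction n)
  case 0
  then show ?case using S by auto
next
  case (Suc n)
  then obtain V Y and \<epsilon> :: "nat \<Rightarrow> real" where V: "open V" "x0 \<in> V" "V \<subseteq> S"
    and Y: "\<And>i. i < n \<Longrightarrow> smooth_on V (Y i)"
    and \<epsilon>: "\<And>i. i < n \<Longrightarrow> \<epsilon> i \<in> {1, -1}" "\<And>i x. i < n \<Longrightarrow> x \<in> V \<Longrightarrow> B x (Y i x) (Y i x) = \<epsilon> i"
    and orth: "\<And>i j x. i < n \<Longrightarrow> j < n \<Longrightarrow> x \<in> V \<Longrightarrow> i \<noteq> j \<Longrightarrow> B x (Y i x) (Y j x) = 0"
    by auto blast
  have BV: "scalar_product (B x)" if "x \<in> V" for x using that V B by blast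
  have smooth_B: "smooth_on V (\<lambda>x. B x (X x) (Z x))" if X: "smooth_on V X" and Z: "smooth_on V Z" for X Z
  proof (rule smooth_on_cong[OF V(1)])
    show "smooth_on V (\<lambda>x. \<Sum>k\<in>Basis. \<Sum>l\<in>Basis. ((X x \<bullet> k) * (Z x \<bullet> l)) * B x k l)"
      using X Z V(3) by (intro smooth_on_sum smooth_on_mult V(1) smooth_on_bounded_linear[OF V(1) bounded_linear_inner_left]
          smooth_on_subset[OF smooth])
    fix x assume "x \<in> V"
    note simps = scalar_product_simps[OF BV[OF this]]
    have "B x (\<Sum>k\<in>Basis. (X x \<bullet> k) *\<^sub>R k) (\<Sum>l\<in>Basis. (Z x \<bullet> l) *\<^sub>R l) =
        (\<Sum>k\<in>Basis. \<Sum>l\<in>Basis. ((X x \<bullet> k) * (Z x \<bullet> l)) * B x k l)"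
      by (simp add: simps sum_distrib_left mult_ac, rule sum.swap)
    then show "(\<Sum>k\<in>Basis. \<Sum>l\<in>Basis. ((X x \<bullet> k) * (Z x \<bullet> l)) * B x k l) = B x (X x) (Z x)"
      by (simp add: euclidean_representation)
  qed
  have "\<exists>w. (\<forall>i<n. B x0 w (Y i x0) = 0) \<and> B x0 w w \<noteq> 0"
    by (rule orthonormal_extend[OF BV[OF V(2)], of n "\<lambda>i. Y i x0"]) (use Suc.prems \<epsilon> orth V(2) in auto)
  then obtain w where w: "\<And>i. i < n \<Longrightarrow> B x0 w (Y i x0) = 0" "B x0 w w \<noteq> 0" by blast
  \<comment> \<open>The constant vector \<open>w\<close> is orthogonal to the family at
    \<open>x0\<close> only, so its components along the family are removed at every point; at
    \<open>x0\<close> this changes nothing.\<close>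
  define W where "W x = w + (-1) *\<^sub>R (\<Sum>i<n. (\<epsilon> i * B x w (Y i x)) *\<^sub>R Y i x)" for x
  have W: "smooth_on V W"
    unfolding W_def
    by (intro smooth_on_add smooth_on_scaleR smooth_on_sum smooth_on_mult smooth_B V(1) smooth_on_const Y) auto
  have W_orth: "B x (W x) (Y j x) = 0" if j: "j < n" and x: "x \<in> V" for j x
  proof -
    note simps = scalar_product_simps[OF BV[OF x]]
    have "(\<Sum>i<n. (\<epsilon> i * B x w (Y i x)) * B x (Y i x) (Y j x)) = (\<Sum>i<n. if i = j then B x w (Y j x) else 0)"
      by (rule sum.cong) (use \<epsilon>[of j] orth[of _ j] j x in auto)
    then show ?thesis using j by (simp add: W_def simps)
  qed
  define N where "N x = B x (W x) (W x)" for x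
  have N: "smooth_on V N" unfolding N_def by (rule smooth_B[OF W W])
  have "W x0 = w" using w by (simp add: W_def)
  then have N0: "N x0 \<noteq> 0" using w by (simp add: N_def)
  \<comment> \<open>The sign at \<open>x0\<close> makes \<open>s * N\<close> positive nearby, so the
    root below is smooth, and it becomes the constant square of the new vector.\<close>
  define s where "s = sgn (N x0)"
  have s: "s \<in> {1, -1}" using N0 by (auto simp: s_def sgn_if)
  define V' where "V' = {x \<in> V. 0 < s * N x}"
  have V': "open V'" "x0 \<in> V'" "V' \<subseteq> V"
  proof -
    have "continuous_on V (\<lambda>x. s * N x)" by (intro continuous_intros smooth_on_continuous_on[OF N])
    then have "open ((\<lambda>x. s * N x) -` {0<..} \<inter> V)"
      by (rule continuous_on_open_vimage[OF V(1), THEN iffD1, rule_format]) (rule open_greaterThan)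
    moreover have "V' = (\<lambda>x. s * N x) -` {0<..} \<inter> V" by (auto simp: V'_def)
    ultimately show "open V'" by simp
    show "x0 \<in> V'" using N0 V(2) by (simp add: V'_def s_def linordered_idom_class.sgn_if)
  qed (auto simp: V'_def)
  define Z where "Z x = inverse (sqrt (s * N x)) *\<^sub>R W x" for x
  have "smooth_on V' (\<lambda>x. s * N x)"
    by (intro smooth_on_mult V' smooth_on_const smooth_on_subset[OF N])
  then have "smooth_on V' (\<lambda>x. sqrt (s * N x))"
    by (rule smooth_on_compose[OF V'(1) open_greaterThan smooth_on_sqrt]) (auto simp: V'_def)
  then have "smooth_on V' (\<lambda>x. inverse (sqrt (s * N x)))"
    by (rule smooth_on_compose[OF V'(1) open_Compl[OF closed_singleton] smooth_on_inverse]) (auto simp: V'_def)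
  then have Z: "smooth_on V' Z"
    unfolding Z_def by (intro smooth_on_scaleR V' smooth_on_subset[OF W])
  have ZZ: "B x (Z x) (Z x) = s" "\<And>j. j < n \<Longrightarrow> B x (Z x) (Y j x) = 0" "\<And>j. j < n \<Longrightarrow> B x (Y j x) (Z x) = 0" if x: "x \<in> V'" for x
  proof -
    have xV: "x \<in> V" and pos: "s * N x > 0" using x by (auto simp: V'_def)
    note simps = scalar_product_simps[OF BV[OF xV]] and sym = scalar_productD(3)[OF BV[OF xV]]
    have "B x (Z x) (Z x) = N x * (inverse (sqrt (s * N x)) * inverse (sqrt (s * N x)))"
      by (simp add: Z_def simps N_def)
    also have "inverse (sqrt (s * N x)) * inverse (sqrt (s * N x)) = inverse (s * N x)"
      using pos by (simp flip: inverse_mult_distrib)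
    also have "N x * inverse (s * N x) = s" using pos s by (auto simp: field_simps)
    finally show "B x (Z x) (Z x) = s" .
    show *: "B x (Z x) (Y j x) = 0" if "j < n" for j
      using W_orth[OF that xV] by (simp add: Z_def simps)
    then show "B x (Y j x) (Z x) = 0" if "j < n" for j using sym that by metis
  qed
  show ?case
  proof (intro exI conjI allI impI ballI)
    show "open V'" "x0 \<in> V'" "V' \<subseteq> S" using V' V by auto
    fix i assume i: "i < Suc n"
    let ?Y = "\<lambda>i. if i = n then Z else Y i" and ?\<epsilon> = "\<lambda>i. if i = n then s else \<epsilon> i"
    show "smooth_on V' (?Y i)" using i Z smooth_on_subset[OF Y V'(3), of i] by (auto simp: less_Suc_eq)
    show "?\<epsilon> i \<in> {1, -1}" using i s \<epsilon> by auto
    fix x assume x: "x \<in> V'"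
    show "B x (?Y i x) (?Y i x) = ?\<epsilon> i" using i x ZZ \<epsilon> V' by auto
    fix j assume "j < Suc n" "i \<noteq> j"
    then show "B x (?Y i x) (?Y j x) = 0" using i x ZZ orth V' by auto
  qed
qed

section \<open>The cometric and orthonormal coframes\<close>

locale metric_manifold = manifold M
  for M :: "('a::{t2_space, second_countable_topology}, 'e::euclidean_space) mfd" +
  fixes G :: "('a, 'e) metric"
  assumes pseudo_riemannian: "pseudo_riemannian M G"
begin

lemma scalar_product_G: "scalar_product (G p)"
  using pseudo_riemannian by (simp add: pseudo_riemannian_def scalar_product_def)

lemma smooth_G_coord: "smooth_fun_on M (cdom M a) (\<lambda>p. G p (coord_field M a v p) (coord_field M a w p))"
  using pseudo_riemannian by (simp add: pseudo_riemannian_def)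

lemmas G_simps = scalar_product_simps[OF scalar_product_G]
lemmas G_sym = scalar_productD(3)[OF scalar_product_G]

abbreviation g where "g \<equiv> cometric G"

definition lower :: "'a \<Rightarrow> 'e \<Rightarrow> ('e \<Rightarrow>\<^sub>L real)" where
  "lower p v = Blinfun (G p v)"

lemma lower_apply [simp]: "lower p v w = G p v w"
proof -
  have "bounded_linear (G p v)"
    using scalar_productD(1)[OF scalar_product_G] linear_conv_bounded_linear by blast
  then show ?thesis by (simp add: lower_def bounded_linear_Blinfun_apply)
qed

lemma G_raise: "G p (metric_raise G p \<omega>) w = \<omega> w"
  using theI'[OF scalar_product_represents[OF scalar_product_G, of p \<omega>]] unfolding metric_raise_def by blast

lemma raise_eqI: "(\<And>w. G p v w = blinfun_apply \<omega> w) \<Longrightarrow> metric_raise G p \<omega> = v"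
  using scalar_product_represents[OF scalar_product_G, of p \<omega>] G_raise by blast

lemma raise_lower: "metric_raise G p (lower p v) = v"
  by (rule raise_eqI) simp

lemma cometric_apply: "g p \<omega> \<tau> = \<omega> (metric_raise G p \<tau>)"
  by (simp add: cometric_def G_raise)

lemma cometric_sym: "g p \<omega> \<tau> = g p \<tau> \<omega>"
  by (simp add: cometric_def G_sym)

lemma cometric_simps_left:
  "g p (x + y) w = g p x w + g p y w" "g p (c *\<^sub>R x) w = c * g p x w" "g p (x - y) w = g p x w - g p y w"
  "g p 0 w = 0" "g p (- x) w = - g p x w" "g p (sum h I) w = (\<Sum>i\<in>I. g p (h i) w)"
  by (simp_all add: cometric_apply blinfun.add_left blinfun.scaleR_left blinfun.diff_left
      blinfun.minus_left blinfun.sum_left)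

lemma cometric_simps_right:
  "g p w (x + y) = g p w x + g p w y" "g p w (c *\<^sub>R x) = c * g p w x" "g p w (x - y) = g p w x - g p w y"
  "g p w 0 = 0" "g p w (- x) = - g p w x" "g p w (sum h I) = (\<Sum>i\<in>I. g p w (h i))"
  unfolding cometric_sym[of p w] by (rule cometric_simps_left)+

lemmas cometric_simps = cometric_simps_left cometric_simps_right

lemma cometric_lower: "g p (lower p v) \<tau> = \<tau> v" "g p \<tau> (lower p v) = \<tau> v"
proof -
  show "g p \<tau> (lower p v) = \<tau> v" by (simp only: cometric_apply raise_lower)
  then show "g p (lower p v) \<tau> = \<tau> v" by (simp only: cometric_sym[of p "lower p v"])
qed

lemma cometric_nondegenerate:
  assumes "\<And>\<tau>. g p \<omega> \<tau> = g p \<omega>' \<tau>"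
  shows "\<omega> = \<omega>'"
  by (rule blinfun_eqI) (metis assms cometric_lower(2))

lemma coframe_expansion:
  assumes "\<And>i. i < DIM('e) \<Longrightarrow> g p (\<eta> i) (\<eta> i) \<in> {1, -1}"
    "\<And>i j. i < DIM('e) \<Longrightarrow> j < DIM('e) \<Longrightarrow> i \<noteq> j \<Longrightarrow> g p (\<eta> i) (\<eta> j) = 0"
  shows "\<tau> = (\<Sum>i<DIM('e). (g p (\<eta> i) (\<eta> i) * g p \<tau> (\<eta> i)) *\<^sub>R \<eta> i)"
proof (rule cometric_nondegenerate)
  fix \<sigma> :: "'e \<Rightarrow>\<^sub>L real"
  have "metric_raise G p \<tau> = (\<Sum>i<DIM('e). (g p (\<eta> i) (\<eta> i) * g p \<tau> (\<eta> i)) *\<^sub>R metric_raise G p (\<eta> i))"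
    using orthonormal_expansion[OF scalar_product_G, of p "\<lambda>i. metric_raise G p (\<eta> i)" "metric_raise G p \<tau>"] assms
    by (simp add: cometric_def)
  then have "\<sigma> (metric_raise G p \<tau>) = (\<Sum>i<DIM('e). (g p (\<eta> i) (\<eta> i) * g p \<tau> (\<eta> i)) * \<sigma> (metric_raise G p (\<eta> i)))"
    by (simp add: blinfun.sum_right blinfun.scaleR_right)
  then show "g p \<tau> \<sigma> = g p (\<Sum>i<DIM('e). (g p (\<eta> i) (\<eta> i) * g p \<tau> (\<eta> i)) *\<^sub>R \<eta> i) \<sigma>"
    by (simp add: cometric_simps cometric_apply[symmetric] cometric_sym[of p \<sigma>])
qed

text \<open>A chart turns the metric into a smooth family of scalar products on the model space, to
  which Gram-Schmidt applies. Smoothness of the frame is recorded through its pairings with forms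
  and coordinate fields, the only way in which it is used.\<close>

lemma local_frame:
  obtains U X and \<epsilon> :: "nat \<Rightarrow> real" where "open U" "p \<in> U" "U \<subseteq> cdom M p"
    "\<And>i. i < DIM('e) \<Longrightarrow> \<epsilon> i \<in> {1, -1}"
    "\<And>i q. i < DIM('e) \<Longrightarrow> q \<in> U \<Longrightarrow> G q (X i q) (X i q) = \<epsilon> i"
    "\<And>i j q. i < DIM('e) \<Longrightarrow> j < DIM('e) \<Longrightarrow> q \<in> U \<Longrightarrow> i \<noteq> j \<Longrightarrow> G q (X i q) (X j q) = 0"
    "\<And>i \<alpha>. i < DIM('e) \<Longrightarrow> smooth_form_on (cdom M p) \<alpha> \<Longrightarrow> smooth_fun_on M U (\<lambda>q. \<alpha> q (X i q))"
    "\<And>i v. i < DIM('e) \<Longrightarrow> smooth_fun_on M U (\<lambda>q. G q (X i q) (coord_field M p v q))"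
proof -
  let ?\<Omega> = "cmap M p ` cdom M p"
  define B where "B x v w = G (cinv M p x) (coord_field M p v (cinv M p x)) (coord_field M p w (cinv M p x))" for x v w
  have sp: "scalar_product (B x)" if x: "x \<in> ?\<Omega>" for x
    unfolding scalar_product_def bilinear_def
  proof (intro conjI allI impI)
    fix v
    show "linear (B x v)" "linear (\<lambda>w. B x w v)"
      by (rule linearI; simp add: B_def coord_field_def blinfun.add_right blinfun.scaleR_right G_simps)+
    fix w show "B x v w = B x w v" by (simp add: B_def G_sym)
  next
    fix v assume v: "\<forall>w. B x v w = 0"
    let ?q = "cinv M p x"
    have q: "?q \<in> cdom M p" using x by auto
    have "G ?q (coord_field M p v ?q) w = 0" for w
      using v[unfolded B_def, rule_format, of "coord_change M ?q p ?q w"] by (simp add: vector_coord_field[OF q])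
    then have "coord_field M p v ?q = 0" by (rule scalar_productD(4)[OF scalar_product_G])
    then have "coord_change M ?q p ?q (coord_field M p v ?q) = 0" by simp
    then show "v = 0" using q by (simp add: coord_field_def coord_change_comp mem_cdom)
  qed
  have B_smooth: "smooth_on ?\<Omega> (\<lambda>x. B x v w)" for v w
    using smooth_fun_onD[OF open_cdom smooth_G_coord order_refl, of p v w] by (simp add: B_def comp_def)
  have x0: "cmap M p p \<in> ?\<Omega>" using mem_cdom by auto
  obtain V Y and \<epsilon> :: "nat \<Rightarrow> real" where V: "open V" "cmap M p p \<in> V" "V \<subseteq> ?\<Omega>"
    and Y: "\<And>i. i < DIM('e) \<Longrightarrow> smooth_on V (Y i)" "\<And>i. i < DIM('e) \<Longrightarrow> \<epsilon> i \<in> {1, -1}"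
      "\<And>i x. i < DIM('e) \<Longrightarrow> x \<in> V \<Longrightarrow> B x (Y i x) (Y i x) = \<epsilon> i"
      "\<And>i j x. i < DIM('e) \<Longrightarrow> j < DIM('e) \<Longrightarrow> x \<in> V \<Longrightarrow> i \<noteq> j \<Longrightarrow> B x (Y i x) (Y j x) = 0"
    using smooth_gram_schmidt[OF open_range x0 sp B_smooth, of "DIM('e)"] by auto blast
  define U where "U = cdom M p \<inter> cmap M p -` V"
  have U: "open U" unfolding U_def by (rule smooth_fun_on_of_chart(2)[OF V(1,3) smooth_on_const[of _ "0::real"]])
  define X where "X i q = coord_field M p (Y i (cmap M p q)) q" for i q
  have Yk: "smooth_fun_on M U (\<lambda>q. Y i (cmap M p q) \<bullet> k)" if "i < DIM('e)" for i k
    by (rule smooth_fun_on_bounded_linear[OF U bounded_linear_inner_left])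
      (use smooth_fun_on_of_chart(1)[OF V(1,3) Y(1)[OF that]] in \<open>simp add: U_def\<close>)
  have X_sum: "X i q = (\<Sum>k\<in>Basis. (Y i (cmap M p q) \<bullet> k) *\<^sub>R coord_field M p k q)" for i q
    unfolding X_def by (rule coord_field_sum)
  show thesis
  proof (rule that[of U \<epsilon> X])
    show "open U" "p \<in> U" "U \<subseteq> cdom M p" using U V mem_cdom by (auto simp: U_def)
    show "\<epsilon> i \<in> {1, -1}" if "i < DIM('e)" for i using Y that by blast
    show "G q (X i q) (X i q) = \<epsilon> i" if "i < DIM('e)" "q \<in> U" for i q
      using Y(3)[OF that(1), of "cmap M p q"] that by (simp add: U_def B_def X_def)
    show "G q (X i q) (X j q) = 0" if "i < DIM('e)" "j < DIM('e)" "q \<in> U" "i \<noteq> j" for i j q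
      using Y(4)[OF that(1,2), of "cmap M p q"] that by (simp add: U_def B_def X_def)
    show "smooth_fun_on M U (\<lambda>q. \<alpha> q (X i q))" if i: "i < DIM('e)" and \<alpha>: "smooth_form_on (cdom M p) \<alpha>" for i \<alpha>
    proof -
      have "smooth_fun_on M U (\<lambda>q. \<alpha> q (coord_field M p k q))" for k
        using \<alpha>[unfolded smooth_form_on_def, rule_format, of p k] by (rule smooth_fun_on_subset) (auto simp: U_def)
      then show ?thesis
        unfolding X_sum blinfun.sum_right blinfun.scaleR_right
        by (intro smooth_fun_on_sum U smooth_fun_on_scaleR Yk[OF i])
    qed
    show "smooth_fun_on M U (\<lambda>q. G q (X i q) (coord_field M p v q))" if i: "i < DIM('e)" for i v
      unfolding X_sum G_simps
      by (intro smooth_fun_on_sum U smooth_fun_on_mult Yk[OF i] smooth_fun_on_subset[OF smooth_G_coord])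
        (auto simp: U_def)
  qed
qed

text \<open>An orthonormal frame inverts the metric explicitly: raising \<beta> gives the sum of the
  \<open>X i\<close> with coefficients \<open>\<epsilon> i * \<beta> (X i)\<close>.\<close>

lemma smooth_cometric:
  assumes "\<alpha> \<in> one_forms M" "\<beta> \<in> one_forms M"
  shows "smooth_fun M (\<lambda>p. g p (\<alpha> p) (\<beta> p))"
proof (rule smooth_fun_on_local)
  fix p
  obtain U X and \<epsilon> :: "nat \<Rightarrow> real" where U: "open U" "p \<in> U" "U \<subseteq> cdom M p"
    and \<epsilon>: "\<And>i. i < DIM('e) \<Longrightarrow> \<epsilon> i \<in> {1, -1}" "\<And>i q. i < DIM('e) \<Longrightarrow> q \<in> U \<Longrightarrow> G q (X i q) (X i q) = \<epsilon> i"
    and orth: "\<And>i j q. i < DIM('e) \<Longrightarrow> j < DIM('e) \<Longrightarrow> q \<in> U \<Longrightarrow> i \<noteq> j \<Longrightarrow> G q (X i q) (X j q) = 0"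
    and X: "\<And>i \<alpha>. i < DIM('e) \<Longrightarrow> smooth_form_on (cdom M p) \<alpha> \<Longrightarrow> smooth_fun_on M U (\<lambda>q. \<alpha> q (X i q))"
    by (rule local_frame[of p]) blast
  have "smooth_fun_on M U (\<lambda>q. \<Sum>i<DIM('e). (\<epsilon> i * \<beta> q (X i q)) * \<alpha> q (X i q))"
    by (intro smooth_fun_on_sum smooth_fun_on_mult U smooth_fun_on_const X one_forms_smooth_form_on assms) auto
  then have "smooth_fun_on M U (\<lambda>p. g p (\<alpha> p) (\<beta> p))"
  proof (rule smooth_fun_on_cong[OF U(1), rotated])
    fix q assume q: "q \<in> U"
    have "metric_raise G q (\<beta> q) = (\<Sum>i<DIM('e). (\<epsilon> i * \<beta> q (X i q)) *\<^sub>R X i q)"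
      using orthonormal_expansion[OF scalar_product_G, of q "\<lambda>i. X i q" "metric_raise G q (\<beta> q)"] \<epsilon> orth q
      by (simp add: G_raise)
    then show "(\<Sum>i<DIM('e). (\<epsilon> i * \<beta> q (X i q)) * \<alpha> q (X i q)) = g q (\<alpha> q) (\<beta> q)"
      by (simp add: cometric_apply blinfun.sum_right blinfun.scaleR_right)
  qed
  then show "\<exists>V. open V \<and> p \<in> V \<and> smooth_fun_on M V (\<lambda>p. g p (\<alpha> p) (\<beta> p))" using U by blast
qed

text \<open>A local frame is lowered by the metric and cut off by a bump function that is 1 near
  \<open>p\<close>, so it becomes global without losing orthonormality there. This gives meaning to
  the choice in \<open>local_coframe\<close>.\<close>

lemma local_coframe_exists: "\<exists>\<eta> U. open U \<and> p \<in> U \<and> orthonormal_coframe M g U \<eta>"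
proof -
  obtain U X and \<epsilon> :: "nat \<Rightarrow> real" where U: "open U" "p \<in> U" "U \<subseteq> cdom M p"
    and \<epsilon>: "\<And>i. i < DIM('e) \<Longrightarrow> \<epsilon> i \<in> {1, -1}" "\<And>i q. i < DIM('e) \<Longrightarrow> q \<in> U \<Longrightarrow> G q (X i q) (X i q) = \<epsilon> i"
    and orth: "\<And>i j q. i < DIM('e) \<Longrightarrow> j < DIM('e) \<Longrightarrow> q \<in> U \<Longrightarrow> i \<noteq> j \<Longrightarrow> G q (X i q) (X j q) = 0"
    and X: "\<And>i v. i < DIM('e) \<Longrightarrow> smooth_fun_on M U (\<lambda>q. G q (X i q) (coord_field M p v q))"
    by (rule local_frame[of p]) blast
  obtain \<rho> :: "'a \<Rightarrow> real" and K V where \<rho>: "smooth_fun M \<rho>" "closed K" "K \<subseteq> U" "\<And>q. q \<notin> K \<Longrightarrow> \<rho> q = 0"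
    and V: "open V" "p \<in> V" "V \<subseteq> U" "\<And>q. q \<in> V \<Longrightarrow> \<rho> q = 1"
    using bump[OF U(1,2)] by metis
  have "(\<lambda>q. \<rho> q *\<^sub>R lower q (X i q)) \<in> one_forms M" if "i < DIM('e)" for i
    by (rule one_forms_extend[OF U(1,3) _ \<rho>]) (simp add: X that)
  then have "orthonormal_coframe M g V (\<lambda>i q. \<rho> q *\<^sub>R lower q (X i q))"
    using V \<epsilon> orth by (auto simp: orthonormal_coframe_def cometric_lower subset_iff)
  then show ?thesis using V by blast
qed

lemma local_coframe:
  obtains U where "open U" "p \<in> U" "orthonormal_coframe M g U (local_coframe M g p)"
proof -
  have "\<exists>U. open U \<and> p \<in> U \<and> orthonormal_coframe M g U (local_coframe M g p)"
    unfolding local_coframe_def by (rule someI_ex[OF local_coframe_exists])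
  then show thesis using that by blast
qed

end

section \<open>The endomorphism field \<open>J\<close>\<close>

locale poisson_metric_manifold = bivector_manifold M P + metric_manifold M G
  for M :: "('a::{t2_space, second_countable_topology}, 'e::euclidean_space) mfd" and P G
begin

lemma J_field_eq: "J_field P g \<alpha> p = lower p (anchor P \<alpha> p)"
  unfolding J_field_def
proof (rule the_equality)
  show "\<forall>\<beta>. P p (\<alpha> p) \<beta> = g p (lower p (anchor P \<alpha> p)) \<beta>" by (simp add: cometric_lower apply_anchor)
  fix \<tau> assume "\<forall>\<beta>. P p (\<alpha> p) \<beta> = g p \<tau> \<beta>"
  then show "\<tau> = lower p (anchor P \<alpha> p)"
    by (intro cometric_nondegenerate[of p]) (simp add: cometric_lower apply_anchor)
qed

lemma cometric_J_field: "g p (J_field P g \<alpha> p) \<beta> = P p (\<alpha> p) \<beta>"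
  by (simp add: J_field_eq cometric_lower apply_anchor)

lemma J_field_one_form:
  assumes "\<alpha> \<in> one_forms M"
  shows "J_field P g \<alpha> \<in> one_forms M"
  unfolding one_forms_def
proof safe
  fix a v
  have "smooth_fun_on M (cdom M a) (\<lambda>q. \<Sum>k\<in>Basis. (coord_comp M a (anchor P \<alpha>) q \<bullet> k) * G q (coord_field M a k q) (coord_field M a v q))"
    by (intro smooth_fun_on_sum open_cdom smooth_fun_on_mult smooth_G_coord
        smooth_fun_on_bounded_linear[OF open_cdom bounded_linear_inner_left smooth_coord_comp_anchor[OF assms]])
  then show "smooth_fun_on M (cdom M a) (\<lambda>q. J_field P g \<alpha> q (coord_field M a v q))"
  proof (rule smooth_fun_on_cong[OF open_cdom, rotated])
    fix q assume "q \<in> cdom M a"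
    then have "anchor P \<alpha> q = (\<Sum>k\<in>Basis. (coord_comp M a (anchor P \<alpha>) q \<bullet> k) *\<^sub>R coord_field M a k q)"
      by (metis coord_field_sum field_coord_comp)
    then show "(\<Sum>k\<in>Basis. (coord_comp M a (anchor P \<alpha>) q \<bullet> k) * G q (coord_field M a k q) (coord_field M a v q)) =
        J_field P g \<alpha> q (coord_field M a v q)"
      by (simp add: J_field_eq G_simps)
  qed
qed

end

section \<open>The contravariant Levi-Civita connection\<close>

text \<open>Expanding the first argument of each \<open>b (e i) (e i)\<close> in the family
  \<open>f\<close> gives a double sum; carrying out the sum over i first reassembles
  \<open>f j\<close> from the family \<open>e\<close>.\<close>

lemma trace_independent_of_basis:
  fixes e f :: "nat \<Rightarrow> 'v::real_vector" and g b :: "'v \<Rightarrow> 'v \<Rightarrow> real"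
  assumes b: "\<And>x. linear (b x)" "\<And>y. linear (\<lambda>x. b x y)" and g: "\<And>x y. g x y = g y x"
    and e: "\<And>x. x = (\<Sum>i<n. (\<epsilon> i * g x (e i)) *\<^sub>R e i)"
    and f: "\<And>x. x = (\<Sum>j<m. (\<delta> j * g x (f j)) *\<^sub>R f j)"
  shows "(\<Sum>i<n. \<epsilon> i * b (e i) (e i)) = (\<Sum>j<m. \<delta> j * b (f j) (f j))"
proof -
  have "b (\<Sum>j<m. (\<delta> j * g x (f j)) *\<^sub>R f j) y = (\<Sum>j<m. (\<delta> j * g x (f j)) * b (f j) y)" for x y
    by (simp add: linear_sum[OF b(2)] linear_cmul[OF b(2)])
  then have "b x y = (\<Sum>j<m. (\<delta> j * g x (f j)) * b (f j) y)" for x y unfolding f[symmetric] .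
  from this[of "e _" "e _"] have "(\<Sum>i<n. \<epsilon> i * b (e i) (e i)) = (\<Sum>i<n. \<Sum>j<m. \<delta> j * ((\<epsilon> i * g (f j) (e i)) * b (f j) (e i)))"
    by (simp add: sum_distrib_left g[of "e _" "f _"] mult_ac)
  also have "\<dots> = (\<Sum>j<m. \<delta> j * (\<Sum>i<n. (\<epsilon> i * g (f j) (e i)) * b (f j) (e i)))"
    by (subst sum.swap) (simp add: sum_distrib_left)
  also have "(\<lambda>j. \<Sum>i<n. (\<epsilon> i * g (f j) (e i)) * b (f j) (e i)) = (\<lambda>j. b (f j) (f j))"
  proof
    fix j
    have "b (f j) (\<Sum>i<n. (\<epsilon> i * g (f j) (e i)) *\<^sub>R e i) = (\<Sum>i<n. (\<epsilon> i * g (f j) (e i)) * b (f j) (e i))"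
      by (simp add: linear_sum[OF b(1)] linear_cmul[OF b(1)])
    then show "(\<Sum>i<n. (\<epsilon> i * g (f j) (e i)) * b (f j) (e i)) = b (f j) (f j)"
      unfolding e[symmetric] by simp
  qed
  finally show ?thesis .
qed

section \<open>Derivatives along the anchor\<close>

context bivector_manifold
begin

text \<open>The derivative of \<open>u\<close> along the anchor image of \<alpha>, written with the
  bivector so that its linearity in \<alpha> and in the differential is immediate.\<close>

definition along :: "('a, 'e) form \<Rightarrow> ('a \<Rightarrow> real) \<Rightarrow> 'a \<Rightarrow> real" where
  "along \<alpha> u p = P p (\<alpha> p) (differential M u p)"

definition jacobiator :: "('a \<Rightarrow> real) \<Rightarrow> ('a \<Rightarrow> real) \<Rightarrow> ('a \<Rightarrow> real) \<Rightarrow> 'a \<Rightarrow> real" where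
  "jacobiator u v w p = poisson_bracket M P u (poisson_bracket M P v w) p +
     poisson_bracket M P v (poisson_bracket M P w u) p + poisson_bracket M P w (poisson_bracket M P u v) p"

lemma poisson_iff:
  "poisson M P \<longleftrightarrow> (\<forall>u v w. smooth_fun M u \<longrightarrow> smooth_fun M v \<longrightarrow> smooth_fun M w \<longrightarrow> (\<forall>p. jacobiator u v w p = 0))"
  by (simp add: poisson_def bivector_field jacobiator_def)

lemma poisson_bracket_along: "poisson_bracket M P u w = along (differential M u) w"
  by (simp add: fun_eq_iff poisson_bracket_def along_def)

lemma poisson_bracket_antisym: "poisson_bracket M P u w p = - poisson_bracket M P w u p"
  unfolding poisson_bracket_def by (rule P_antisym)

lemma smooth_along: "\<alpha> \<in> one_forms M \<Longrightarrow> smooth_fun M u \<Longrightarrow> smooth_fun M (along \<alpha> u)"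
  unfolding along_def by (intro smooth_P_forms differential_one_form)

lemma along_form_simps:
  "along (\<lambda>p. \<alpha> p + \<beta> p) u p = along \<alpha> u p + along \<beta> u p"
  "along (\<lambda>p. \<alpha> p - \<beta> p) u p = along \<alpha> u p - along \<beta> u p"
  "along (\<lambda>p. w p *\<^sub>R \<alpha> p) u p = w p * along \<alpha> u p"
  by (simp_all add: along_def P_simps)

lemma along_const: "along \<alpha> (\<lambda>p. c) p = 0"
  by (simp add: along_def differential_const P_simps)

lemma along_add: "smooth_fun M u \<Longrightarrow> smooth_fun M w \<Longrightarrow> along \<alpha> (\<lambda>p. u p + w p) p = along \<alpha> u p + along \<alpha> w p"
  by (simp add: along_def differential_add[of UNIV] P_simps)

lemma along_mult:
  "smooth_fun M u \<Longrightarrow> smooth_fun M w \<Longrightarrow> along \<alpha> (\<lambda>p. u p * w p) p = u p * along \<alpha> w p + w p * along \<alpha> u p"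
  by (simp add: along_def differential_mult[of UNIV] P_simps)

lemma along_uminus: "smooth_fun M u \<Longrightarrow> along \<alpha> (\<lambda>p. - u p) p = - along \<alpha> u p"
  using along_mult[OF smooth_fun_on_const[of UNIV "-1"]] by (simp add: along_const)

end

section \<open>Rules for connection and bracket; the anchor and the Jacobi identity\<close>

locale contravariant_geometry = poisson_metric_manifold M P G
  for M :: "('a::{t2_space, second_countable_topology}, 'e::euclidean_space) mfd" and P G +
  fixes D :: "('a, 'e) connection"
  assumes levi_civita: "contravariant_levi_civita M P (cometric G) D"
begin

abbreviation "\<Omega> \<equiv> one_forms M"
abbreviation "br \<equiv> koszul M P"

lemma D_form: "\<alpha> \<in> \<Omega> \<Longrightarrow> \<beta> \<in> \<Omega> \<Longrightarrow> D \<alpha> \<beta> \<in> \<Omega>"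
  using levi_civita unfolding contravariant_levi_civita_def by blast

lemma D_lincomb:
  assumes "\<alpha> \<in> \<Omega>" "\<alpha>' \<in> \<Omega>" "\<beta> \<in> \<Omega>"
  shows "D (\<lambda>p. r *\<^sub>R \<alpha> p + s *\<^sub>R \<alpha>' p) \<beta> = (\<lambda>p. r *\<^sub>R D \<alpha> \<beta> p + s *\<^sub>R D \<alpha>' \<beta> p)"
    "D \<beta> (\<lambda>p. r *\<^sub>R \<alpha> p + s *\<^sub>R \<alpha>' p) = (\<lambda>p. r *\<^sub>R D \<beta> \<alpha> p + s *\<^sub>R D \<beta> \<alpha>' p)"
  using assms levi_civita unfolding contravariant_levi_civita_def by blast+

lemma D_add:
  assumes "\<alpha> \<in> \<Omega>" "\<alpha>' \<in> \<Omega>" "\<beta> \<in> \<Omega>"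
  shows "D (\<lambda>p. \<alpha> p + \<alpha>' p) \<beta> = (\<lambda>p. D \<alpha> \<beta> p + D \<alpha>' \<beta> p)" "D \<beta> (\<lambda>p. \<alpha> p + \<alpha>' p) = (\<lambda>p. D \<beta> \<alpha> p + D \<beta> \<alpha>' p)"
    "D (\<lambda>p. \<alpha> p - \<alpha>' p) \<beta> = (\<lambda>p. D \<alpha> \<beta> p - D \<alpha>' \<beta> p)" "D \<beta> (\<lambda>p. \<alpha> p - \<alpha>' p) = (\<lambda>p. D \<beta> \<alpha> p - D \<beta> \<alpha>' p)"
  using D_lincomb[OF assms, of 1 1] D_lincomb[OF assms, of 1 "-1"] by simp_all

lemma D_mult:
  assumes "\<alpha> \<in> \<Omega>" "\<beta> \<in> \<Omega>" "smooth_fun M u"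
  shows "D (\<lambda>p. u p *\<^sub>R \<alpha> p) \<beta> = (\<lambda>p. u p *\<^sub>R D \<alpha> \<beta> p)"
    "D \<alpha> (\<lambda>p. u p *\<^sub>R \<beta> p) = (\<lambda>p. u p *\<^sub>R D \<alpha> \<beta> p + along \<alpha> u p *\<^sub>R \<beta> p)"
  using levi_civita assms unfolding contravariant_levi_civita_def deriv_along_anchor along_def by blast+

lemma D_torsion: "\<alpha> \<in> \<Omega> \<Longrightarrow> \<beta> \<in> \<Omega> \<Longrightarrow> br \<alpha> \<beta> = (\<lambda>p. D \<alpha> \<beta> p - D \<beta> \<alpha> p)"
  using levi_civita unfolding contravariant_levi_civita_def by (metis (no_types, lifting) ext)

lemma D_metric:
  "\<alpha> \<in> \<Omega> \<Longrightarrow> \<beta> \<in> \<Omega> \<Longrightarrow> \<gamma> \<in> \<Omega> \<Longrightarrow>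
    along \<alpha> (\<lambda>q. g q (\<beta> q) (\<gamma> q)) p = g p (D \<alpha> \<beta> p) (\<gamma> p) + g p (\<beta> p) (D \<alpha> \<gamma> p)"
  using levi_civita unfolding contravariant_levi_civita_def deriv_along_anchor along_def by blast

lemma br_form: "\<alpha> \<in> \<Omega> \<Longrightarrow> \<beta> \<in> \<Omega> \<Longrightarrow> br \<alpha> \<beta> \<in> \<Omega>"
  by (simp add: D_torsion one_forms_diff D_form)

lemma br_mult:
  assumes "\<alpha> \<in> \<Omega>" "\<beta> \<in> \<Omega>" "smooth_fun M u"
  shows "br (\<lambda>p. u p *\<^sub>R \<alpha> p) \<beta> = (\<lambda>p. u p *\<^sub>R br \<alpha> \<beta> p - along \<beta> u p *\<^sub>R \<alpha> p)"
    "br \<alpha> (\<lambda>p. u p *\<^sub>R \<beta> p) = (\<lambda>p. u p *\<^sub>R br \<alpha> \<beta> p + along \<alpha> u p *\<^sub>R \<beta> p)"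
  using assms by (simp_all add: D_torsion one_forms_mult D_mult algebra_simps)

lemma br_add:
  assumes "\<alpha> \<in> \<Omega>" "\<alpha>' \<in> \<Omega>" "\<beta> \<in> \<Omega>"
  shows "br (\<lambda>p. \<alpha> p + \<alpha>' p) \<beta> = (\<lambda>p. br \<alpha> \<beta> p + br \<alpha>' \<beta> p)" "br \<beta> (\<lambda>p. \<alpha> p + \<alpha>' p) = (\<lambda>p. br \<beta> \<alpha> p + br \<beta> \<alpha>' p)"
  using assms by (simp_all add: D_torsion one_forms_add D_add algebra_simps)

text \<open>Metric compatibility is used for the three cyclic arrangements, with signs +, +, -, and
  the torsion condition removes all but one covariant derivative. As the metric is nondegenerate,
  this lets the connection of the product be read off from derivatives and brackets.\<close>

lemma koszul_formula:
  assumes "\<alpha> \<in> \<Omega>" "\<beta> \<in> \<Omega>" "\<gamma> \<in> \<Omega>"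
  shows "2 * g p (D \<alpha> \<beta> p) (\<gamma> p) = along \<alpha> (\<lambda>q. g q (\<beta> q) (\<gamma> q)) p + along \<beta> (\<lambda>q. g q (\<alpha> q) (\<gamma> q)) p
     - along \<gamma> (\<lambda>q. g q (\<alpha> q) (\<beta> q)) p + g p (br \<alpha> \<beta> p) (\<gamma> p) - g p (br \<beta> \<gamma> p) (\<alpha> p) + g p (br \<gamma> \<alpha> p) (\<beta> p)"
  unfolding D_metric[OF assms(1,2,3)] D_metric[OF assms(2,1,3)] D_metric[OF assms(3,1,2)]
    D_torsion[OF assms(1,2)] D_torsion[OF assms(2,3)] D_torsion[OF assms(3,1)]
  by (simp add: cometric_simps cometric_sym)

text \<open>The failure of the anchor to preserve brackets. It is tensorial in both forms and equals minus the
  jacobiator on differentials; as the jacobiator is cyclic, it thus depends only on the three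
  differentials at the point.\<close>

definition anchor_defect :: "('a, 'e) form \<Rightarrow> ('a, 'e) form \<Rightarrow> ('a \<Rightarrow> real) \<Rightarrow> 'a \<Rightarrow> real" where
  "anchor_defect \<alpha> \<beta> w p = along (br \<alpha> \<beta>) w p - along \<alpha> (along \<beta> w) p + along \<beta> (along \<alpha> w) p"

lemma br_antisym: "\<alpha> \<in> \<Omega> \<Longrightarrow> \<beta> \<in> \<Omega> \<Longrightarrow> br \<alpha> \<beta> = (\<lambda>p. - br \<beta> \<alpha> p)"
  by (simp add: D_torsion)

lemma anchor_defect_antisym:
  assumes "\<alpha> \<in> \<Omega>" "\<beta> \<in> \<Omega>"
  shows "anchor_defect \<alpha> \<beta> w p = - anchor_defect \<beta> \<alpha> w p"
proof -
  have "along (br \<alpha> \<beta>) w p = - along (br \<beta> \<alpha>) w p"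
    using along_form_simps(3)[of "\<lambda>_. -1" "br \<beta> \<alpha>" w p] by (simp add: br_antisym[OF assms])
  then show ?thesis by (simp add: anchor_defect_def)
qed

text \<open>For a multiple of \<alpha> by \<open>u\<close>, the Leibniz term of the bracket cancels
  the product term from differentiating \<open>u * along \<alpha> w\<close> along \<beta>.\<close>

lemma anchor_defect_cong1:
  assumes "\<alpha> \<in> \<Omega>" "\<alpha>' \<in> \<Omega>" "\<beta> \<in> \<Omega>" "smooth_fun M w" "\<alpha> p = \<alpha>' p"
  shows "anchor_defect \<alpha> \<beta> w p = anchor_defect \<alpha>' \<beta> w p"
proof (rule tensorial[where T = "\<lambda>\<alpha>. anchor_defect \<alpha> \<beta> w p", OF _ _ assms(1,2,5)])
  fix \<alpha> \<gamma> assume a: "\<alpha> \<in> \<Omega>" "\<gamma> \<in> \<Omega>"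
  have "along (\<lambda>p. \<alpha> p + \<gamma> p) w = (\<lambda>p. along \<alpha> w p + along \<gamma> w p)" by (simp add: fun_eq_iff along_form_simps)
  then show "anchor_defect (\<lambda>q. \<alpha> q + \<gamma> q) \<beta> w p = anchor_defect \<alpha> \<beta> w p + anchor_defect \<gamma> \<beta> w p"
    using a assms by (simp add: anchor_defect_def br_add along_form_simps along_add smooth_along)
next
  fix \<alpha> u assume a: "\<alpha> \<in> \<Omega>" "smooth_fun M u"
  have "along (\<lambda>p. u p *\<^sub>R \<alpha> p) w = (\<lambda>p. u p * along \<alpha> w p)" by (simp add: fun_eq_iff along_form_simps)
  then show "anchor_defect (\<lambda>q. u q *\<^sub>R \<alpha> q) \<beta> w p = u p * anchor_defect \<alpha> \<beta> w p"
    using a assms by (simp add: anchor_defect_def br_mult along_form_simps along_mult smooth_along algebra_simps)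
qed

lemma anchor_defect_cong:
  assumes "\<alpha> \<in> \<Omega>" "\<alpha>' \<in> \<Omega>" "\<beta> \<in> \<Omega>" "\<beta>' \<in> \<Omega>" "smooth_fun M w" "\<alpha> p = \<alpha>' p" "\<beta> p = \<beta>' p"
  shows "anchor_defect \<alpha> \<beta> w p = anchor_defect \<alpha>' \<beta>' w p"
proof -
  have "anchor_defect \<alpha> \<beta> w p = anchor_defect \<alpha>' \<beta> w p" using assms by (intro anchor_defect_cong1)
  also have "\<dots> = - anchor_defect \<beta> \<alpha>' w p" using assms by (intro anchor_defect_antisym)
  also have "anchor_defect \<beta> \<alpha>' w p = anchor_defect \<beta>' \<alpha>' w p" using assms by (intro anchor_defect_cong1)
  also have "- anchor_defect \<beta>' \<alpha>' w p = anchor_defect \<alpha>' \<beta>' w p" using anchor_defect_antisym[OF assms(2,4), of w p] by simp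
  finally show ?thesis .
qed

lemma anchor_defect_exact:
  assumes "smooth_fun M u" "smooth_fun M v" "smooth_fun M w"
  shows "anchor_defect (differential M u) (differential M v) w p = - jacobiator u v w p"
proof -
  have 1: "along (br (differential M u) (differential M v)) w p = - poisson_bracket M P w (poisson_bracket M P u v) p"
    unfolding poisson_bracket_antisym[of w] poisson_bracket_along[of "poisson_bracket M P u v"]
    by (simp add: along_def koszul_exact[OF assms(1,2)])
  have "along (differential M u) w = (\<lambda>q. - poisson_bracket M P w u q)"
    by (simp add: poisson_bracket_along[symmetric] poisson_bracket_antisym[of u w] fun_eq_iff)
  then have 2: "along (differential M v) (along (differential M u) w) p = - poisson_bracket M P v (poisson_bracket M P w u) p"
    by (simp add: along_uminus smooth_poisson_bracket assms poisson_bracket_along[of v])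
  show ?thesis
    unfolding anchor_defect_def 1 2 jacobiator_def by (simp add: poisson_bracket_along[symmetric])
qed

text \<open>The defect controls the two arguments that enter as forms; the cyclic symmetry then
  moves the third argument into such a position.\<close>

lemma jacobiator_cong:
  assumes "smooth_fun M u" "smooth_fun M v" "smooth_fun M w" "smooth_fun M u'" "smooth_fun M v'" "smooth_fun M w'"
    and "differential M u p = differential M u' p" "differential M v p = differential M v' p" "differential M w p = differential M w' p"
  shows "jacobiator u v w p = jacobiator u' v' w' p"
proof -
  have *: "jacobiator u v w p = jacobiator u' v' w p"
    if "smooth_fun M u" "smooth_fun M v" "smooth_fun M w" "smooth_fun M u'" "smooth_fun M v'"
      "differential M u p = differential M u' p" "differential M v p = differential M v' p" for u v w u' v'
    using anchor_defect_cong[of "differential M u" "differential M u'" "differential M v" "differential M v'" w p]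
    by (simp add: that differential_one_form anchor_defect_exact)
  have cyc: "jacobiator u v w p = jacobiator v w u p" for u v w by (simp add: jacobiator_def)
  show ?thesis using *[of u v w u' v'] *[of v' w u' v' w'] cyc[of u' v'] assms by simp
qed

text \<open>Together with \<open>jacobiator_cong\<close> this reduces the Jacobi identity of a
  product to lifted functions.\<close>

lemma jacobiator_add1:
  assumes "smooth_fun M u" "smooth_fun M u'" "smooth_fun M v" "smooth_fun M w"
  shows "jacobiator (\<lambda>q. u q + u' q) v w p = jacobiator u v w p + jacobiator u' v w p"
proof -
  have d: "differential M (\<lambda>q. u q + u' q) = (\<lambda>q. differential M u q + differential M u' q)"
    using differential_add[OF assms(1,2)] by (simp add: fun_eq_iff)
  have 1: "poisson_bracket M P w (\<lambda>q. u q + u' q) = (\<lambda>q. poisson_bracket M P w u q + poisson_bracket M P w u' q)"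
    "poisson_bracket M P (\<lambda>q. u q + u' q) v = (\<lambda>q. poisson_bracket M P u v q + poisson_bracket M P u' v q)"
    by (simp_all add: poisson_bracket_def fun_eq_iff d P_simps)
  show ?thesis
    unfolding jacobiator_def 1
    using assms by (simp add: poisson_bracket_along along_add smooth_along differential_one_form d along_form_simps)
qed

lemma anchor_defect_zero:
  assumes "poisson M P" "\<alpha> \<in> \<Omega>" "\<beta> \<in> \<Omega>" "smooth_fun M w"
  shows "anchor_defect \<alpha> \<beta> w p = 0"
proof -
  obtain u where u: "smooth_fun M u" "differential M u p = \<alpha> p" by (rule covector_is_differential)
  obtain v where v: "smooth_fun M v" "differential M v p = \<beta> p" by (rule covector_is_differential)
  have "anchor_defect \<alpha> \<beta> w p = anchor_defect (differential M u) (differential M v) w p"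
    using assms u v by (intro anchor_defect_cong) (auto simp: differential_one_form)
  then show ?thesis using assms u v by (simp add: anchor_defect_exact poisson_iff)
qed

section \<open>Tensoriality of the curvature and the Ricci trace\<close>

abbreviation "curv \<equiv> curvature M P D"

lemma curv_add1:
  assumes "\<alpha> \<in> \<Omega>" "\<alpha>' \<in> \<Omega>" "\<beta> \<in> \<Omega>" "\<gamma> \<in> \<Omega>"
  shows "curv (\<lambda>p. \<alpha> p + \<alpha>' p) \<beta> \<gamma> p = curv \<alpha> \<beta> \<gamma> p + curv \<alpha>' \<beta> \<gamma> p"
  using assms by (simp add: curvature_def D_add br_add D_form br_form)

lemma curv_mult1:
  assumes "\<alpha> \<in> \<Omega>" "\<beta> \<in> \<Omega>" "\<gamma> \<in> \<Omega>" "smooth_fun M u"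
  shows "curv (\<lambda>p. u p *\<^sub>R \<alpha> p) \<beta> \<gamma> p = u p *\<^sub>R curv \<alpha> \<beta> \<gamma> p"
  using assms by (simp add: curvature_def D_mult D_add br_mult D_form br_form one_forms_mult smooth_along algebra_simps)

lemma curv_antisym:
  assumes "\<alpha> \<in> \<Omega>" "\<beta> \<in> \<Omega>" "\<gamma> \<in> \<Omega>"
  shows "curv \<alpha> \<beta> \<gamma> p = - curv \<beta> \<alpha> \<gamma> p"
proof -
  have "D (br \<alpha> \<beta>) \<gamma> p = - D (br \<beta> \<alpha>) \<gamma> p"
    using D_mult(1)[OF br_form[OF assms(2,1)] assms(3) smooth_fun_on_const, of "-1"]
    by (simp add: br_antisym[OF assms(1,2)])
  then show ?thesis by (simp add: curvature_def)
qed

lemma curv_add3: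
  assumes "\<alpha> \<in> \<Omega>" "\<beta> \<in> \<Omega>" "\<gamma> \<in> \<Omega>" "\<gamma>' \<in> \<Omega>"
  shows "curv \<alpha> \<beta> (\<lambda>p. \<gamma> p + \<gamma>' p) p = curv \<alpha> \<beta> \<gamma> p + curv \<alpha> \<beta> \<gamma>' p"
  using assms by (simp add: curvature_def D_add D_form br_form)

text \<open>In the Leibniz expansion the terms with one derivative of \<open>u\<close> and one of
  \<gamma> cancel; what multiplies \<gamma> undifferentiated is the anchor defect.\<close>

lemma curv_mult3:
  assumes "poisson M P" "\<alpha> \<in> \<Omega>" "\<beta> \<in> \<Omega>" "\<gamma> \<in> \<Omega>" "smooth_fun M u"
  shows "curv \<alpha> \<beta> (\<lambda>p. u p *\<^sub>R \<gamma> p) p = u p *\<^sub>R curv \<alpha> \<beta> \<gamma> p"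
proof -
  have "curv \<alpha> \<beta> (\<lambda>p. u p *\<^sub>R \<gamma> p) p = u p *\<^sub>R curv \<alpha> \<beta> \<gamma> p - anchor_defect \<alpha> \<beta> u p *\<^sub>R \<gamma> p"
    using assms by (simp add: curvature_def D_mult D_add D_form br_form one_forms_mult smooth_along anchor_defect_def algebra_simps)
  then show ?thesis by (simp add: anchor_defect_zero[OF assms(1-3,5)])
qed

text \<open>Linearity over functions handles the first and third arguments; antisymmetry carries the
  result over to the second.\<close>

lemma curv_cong:
  assumes P: "poisson M P" and "\<alpha> \<in> \<Omega>" "\<alpha>' \<in> \<Omega>" "\<beta> \<in> \<Omega>" "\<beta>' \<in> \<Omega>" "\<gamma> \<in> \<Omega>" "\<gamma>' \<in> \<Omega>"
    "\<alpha> p = \<alpha>' p" "\<beta> p = \<beta>' p" "\<gamma> p = \<gamma>' p"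
  shows "curv \<alpha> \<beta> \<gamma> p = curv \<alpha>' \<beta>' \<gamma>' p"
proof -
  have 1: "curv \<alpha> \<beta> \<gamma> p = curv \<alpha>' \<beta> \<gamma> p" if "\<alpha> \<in> \<Omega>" "\<alpha>' \<in> \<Omega>" "\<beta> \<in> \<Omega>" "\<gamma> \<in> \<Omega>" "\<alpha> p = \<alpha>' p" for \<alpha> \<alpha>' \<beta> \<gamma>
  proof (rule blinfun_eqI)
    fix v show "curv \<alpha> \<beta> \<gamma> p v = curv \<alpha>' \<beta> \<gamma> p v"
      by (rule tensorial[where T = "\<lambda>\<alpha>. curv \<alpha> \<beta> \<gamma> p v", OF _ _ that(1,2,5)])
        (use that in \<open>auto simp: curv_add1 curv_mult1 blinfun.add_left blinfun.scaleR_left\<close>)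
  qed
  have 3: "curv \<alpha> \<beta> \<gamma> p = curv \<alpha> \<beta> \<gamma>' p" if "\<alpha> \<in> \<Omega>" "\<beta> \<in> \<Omega>" "\<gamma> \<in> \<Omega>" "\<gamma>' \<in> \<Omega>" "\<gamma> p = \<gamma>' p" for \<alpha> \<beta> \<gamma> \<gamma>'
  proof (rule blinfun_eqI)
    fix v show "curv \<alpha> \<beta> \<gamma> p v = curv \<alpha> \<beta> \<gamma>' p v"
      by (rule tensorial[where T = "\<lambda>\<gamma>. curv \<alpha> \<beta> \<gamma> p v", OF _ _ that(3,4,5)])
        (use that in \<open>auto simp: curv_add3 curv_mult3[OF P] blinfun.add_left blinfun.scaleR_left\<close>)
  qed
  have "curv \<alpha> \<beta> \<gamma> p = curv \<alpha>' \<beta> \<gamma> p" using assms by (intro 1)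
  also have "\<dots> = - curv \<beta> \<alpha>' \<gamma> p" using assms by (intro curv_antisym)
  also have "curv \<beta> \<alpha>' \<gamma> p = curv \<beta>' \<alpha>' \<gamma> p" using assms by (intro 1)
  also have "- curv \<beta>' \<alpha>' \<gamma> p = curv \<alpha>' \<beta>' \<gamma> p" using curv_antisym[of \<alpha>' \<beta>' \<gamma> p] assms by simp
  also have "\<dots> = curv \<alpha>' \<beta>' \<gamma>' p" using assms by (intro 3)
  finally show ?thesis .
qed

lemma orthonormal_coframe_expansion:
  assumes "orthonormal_coframe M g U \<eta>" "p \<in> U"
  shows "\<tau> = (\<Sum>i<DIM('e). (g p (\<eta> i p) (\<eta> i p) * g p \<tau> (\<eta> i p)) *\<^sub>R \<eta> i p)"
  by (rule coframe_expansion) (use assms in \<open>auto simp: orthonormal_coframe_def\<close>)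

text \<open>This frees \<open>ricci\<close> from the chosen coframe: at \<open>p\<close> the
  summands are values of one bilinear form on covectors, and its trace is the same for all
  orthonormal bases.\<close>

lemma ricci_coframe:
  assumes P: "poisson M P" and \<alpha>: "\<alpha> \<in> \<Omega>" and \<eta>: "orthonormal_coframe M g U \<eta>" "p \<in> U"
  shows "ricci M P g D \<alpha> \<beta> p = (\<Sum>i<DIM('e). g p (\<eta> i p) (\<eta> i p) * g p (curv \<alpha> (\<eta> i) (\<eta> i) p) (\<beta> p))"
proof -
  obtain V where V: "p \<in> V" "orthonormal_coframe M g V (local_coframe M g p)"
    by (rule local_coframe)
  let ?\<xi> = "local_coframe M g p"
  \<comment> \<open>An arbitrary extension of a covector to a global form. Only tensoriality of the
    curvature makes \<open>b\<close> independent of it, and thereby bilinear.\<close>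
  define ext where "ext \<tau> = (SOME \<gamma>. \<gamma> \<in> \<Omega> \<and> \<gamma> p = \<tau>)" for \<tau>
  have "\<exists>\<gamma>. \<gamma> \<in> \<Omega> \<and> \<gamma> p = \<tau>" for \<tau> using covector_is_form_value[of p \<tau>] by metis
  then have ext: "ext \<tau> \<in> \<Omega>" "ext \<tau> p = \<tau>" for \<tau> unfolding ext_def by (metis (mono_tags, lifting) someI_ex)+
  define b where "b \<sigma> \<tau> = g p (curv \<alpha> (ext \<sigma>) (ext \<tau>) p) (\<beta> p)" for \<sigma> \<tau>
  have b: "b (\<sigma> p) (\<tau> p) = g p (curv \<alpha> \<sigma> \<tau> p) (\<beta> p)" if "\<sigma> \<in> \<Omega>" "\<tau> \<in> \<Omega>" for \<sigma> \<tau>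
    unfolding b_def using that ext \<alpha> by (subst curv_cong[OF P \<alpha> \<alpha> ext(1) that(1) ext(1) that(2)]) auto
  have "linear (b \<sigma>)" for \<sigma>
  proof (rule linearI)
    fix \<tau> \<tau>' :: "'e \<Rightarrow>\<^sub>L real" and c :: real
    show "b \<sigma> (\<tau> + \<tau>') = b \<sigma> \<tau> + b \<sigma> \<tau>'"
      using b[of "ext \<sigma>" "\<lambda>q. ext \<tau> q + ext \<tau>' q"] curv_add3[OF \<alpha> ext(1) ext(1) ext(1)]
      by (simp add: ext one_forms_add cometric_simps b_def)
    show "b \<sigma> (c *\<^sub>R \<tau>) = c *\<^sub>R b \<sigma> \<tau>"
      using b[of "ext \<sigma>" "\<lambda>q. c *\<^sub>R ext \<tau> q"] curv_mult3[OF P \<alpha> ext(1) ext(1) smooth_fun_on_const[of UNIV c]]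
      by (simp add: ext one_forms_scaleR cometric_simps b_def)
  qed
  moreover have "linear (\<lambda>\<sigma>. b \<sigma> \<tau>)" for \<tau>
  proof (rule linearI)
    fix \<sigma> \<sigma>' :: "'e \<Rightarrow>\<^sub>L real" and c :: real
    show "b (\<sigma> + \<sigma>') \<tau> = b \<sigma> \<tau> + b \<sigma>' \<tau>"
      using b[of "\<lambda>q. ext \<sigma> q + ext \<sigma>' q" "ext \<tau>"] curv_add1[OF ext(1) ext(1) \<alpha> ext(1)]
      by (simp add: ext one_forms_add cometric_simps b_def curv_antisym[OF \<alpha>])
    show "b (c *\<^sub>R \<sigma>) \<tau> = c *\<^sub>R b \<sigma> \<tau>"
      using b[of "\<lambda>q. c *\<^sub>R ext \<sigma> q" "ext \<tau>"] curv_mult1[OF ext(1) \<alpha> ext(1) smooth_fun_on_const[of UNIV c]]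
      by (simp add: ext one_forms_scaleR cometric_simps b_def curv_antisym[OF \<alpha>])
  qed
  ultimately have "(\<Sum>i<DIM('e). g p (?\<xi> i p) (?\<xi> i p) * b (?\<xi> i p) (?\<xi> i p)) =
      (\<Sum>i<DIM('e). g p (\<eta> i p) (\<eta> i p) * b (\<eta> i p) (\<eta> i p))"
    by (rule trace_independent_of_basis[OF _ _ cometric_sym
          orthonormal_coframe_expansion[OF V(2,1)] orthonormal_coframe_expansion[OF \<eta>]])
  moreover have "?\<xi> i \<in> \<Omega>" "\<eta> i \<in> \<Omega>" if "i < DIM('e)" for i
    using V \<eta> that by (auto simp: orthonormal_coframe_def)
  ultimately show ?thesis by (simp add: ricci_def Let_def b)
qed

end

section \<open>Products\<close>

lemma smooth_on_Pair:
  assumes "open S" "smooth_on S h" "smooth_on S k"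
  shows "smooth_on S (\<lambda>x. (h x, k x))"
proof -
  have "bounded_linear (\<lambda>x. (x, 0))" "bounded_linear (\<lambda>x. (0, x))"
    by (auto intro!: bounded_linear_Pair bounded_linear_ident bounded_linear_zero)
  then have "smooth_on S (\<lambda>x. (h x, 0))" "smooth_on S (\<lambda>x. (0, k x))"
    using assms smooth_on_bounded_linear by blast+
  from smooth_on_add[OF assms(1) this] show ?thesis by simp
qed

definition inl_blinfun :: "'e::euclidean_space \<Rightarrow>\<^sub>L ('e \<times> 'f::euclidean_space)" where
  "inl_blinfun = Blinfun (\<lambda>v. (v, 0))"

definition inr_blinfun :: "'f::euclidean_space \<Rightarrow>\<^sub>L ('e::euclidean_space \<times> 'f)" where
  "inr_blinfun = Blinfun (\<lambda>w. (0, w))"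

lemma inl_blinfun_apply [simp]: "inl_blinfun v = (v, 0)"
  and inr_blinfun_apply [simp]: "inr_blinfun w = (0, w)"
  unfolding inl_blinfun_def inr_blinfun_def
  by (subst bounded_linear_Blinfun_apply; auto intro!: bounded_linear_Pair bounded_linear_ident bounded_linear_zero)+

definition hlift :: "('a, 'e::euclidean_space) form \<Rightarrow> ('a \<times> 'b, 'e \<times> 'f::euclidean_space) form" where
  "hlift \<alpha> z = \<alpha> (fst z) o\<^sub>L fst_blinfun"

definition vlift :: "('b, 'f::euclidean_space) form \<Rightarrow> ('a \<times> 'b, 'e::euclidean_space \<times> 'f) form" where
  "vlift \<beta> z = \<beta> (snd z) o\<^sub>L snd_blinfun"

lemma lift_apply [simp]: "hlift \<alpha> z x = \<alpha> (fst z) (fst x)" "vlift \<beta> z x = \<beta> (snd z) (snd x)"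
  by (simp_all add: hlift_def vlift_def)

lemma lift_compose [simp]:
  "hlift \<alpha> z o\<^sub>L inl_blinfun = \<alpha> (fst z)" "hlift \<alpha> z o\<^sub>L inr_blinfun = 0"
  "vlift \<beta> z o\<^sub>L inl_blinfun = 0" "vlift \<beta> z o\<^sub>L inr_blinfun = \<beta> (snd z)"
  by (rule blinfun_eqI; simp)+

lemma covector_split: "\<omega> = ((\<omega> o\<^sub>L inl_blinfun) o\<^sub>L fst_blinfun) + ((\<omega> o\<^sub>L inr_blinfun) o\<^sub>L snd_blinfun)"
  by (rule blinfun_eqI) (simp add: blinfun.add_left flip: blinfun.add_right)

lemma compose_simps:
  "(\<omega> + \<tau>) o\<^sub>L h = (\<omega> o\<^sub>L h) + (\<tau> o\<^sub>L h)" "(c *\<^sub>R \<omega>) o\<^sub>L h = c *\<^sub>R (\<omega> o\<^sub>L h)"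
  "(\<omega> - \<tau>) o\<^sub>L h = (\<omega> o\<^sub>L h) - (\<tau> o\<^sub>L h)" "(- \<omega>) o\<^sub>L h = - (\<omega> o\<^sub>L h)" "0 o\<^sub>L h = 0"
  by (rule blinfun_eqI; simp add: blinfun.add_left blinfun.scaleR_left blinfun.diff_left blinfun.minus_left)+

lemma lift_simps:
  "hlift (\<lambda>p. \<alpha> p + \<beta> p) = (\<lambda>z. hlift \<alpha> z + hlift \<beta> z)" "vlift (\<lambda>q. \<gamma> q + \<delta> q) = (\<lambda>z. vlift \<gamma> z + vlift \<delta> z)"
  "hlift (\<lambda>p. \<alpha> p - \<beta> p) = (\<lambda>z. hlift \<alpha> z - hlift \<beta> z)" "vlift (\<lambda>q. \<gamma> q - \<delta> q) = (\<lambda>z. vlift \<gamma> z - vlift \<delta> z)"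
  "hlift (\<lambda>p. u p *\<^sub>R \<alpha> p) = (\<lambda>z. u (fst z) *\<^sub>R hlift \<alpha> z)" "vlift (\<lambda>q. w q *\<^sub>R \<gamma> q) = (\<lambda>z. w (snd z) *\<^sub>R vlift \<gamma> z)"
  by (simp_all add: fun_eq_iff hlift_def vlift_def compose_simps)

lemma cdom_prod: "cdom (prod_mfd B F) (a, b) = cdom B a \<times> cdom F b"
  and cmap_prod: "cmap (prod_mfd B F) (a, b) (p, q) = (cmap B a p, cmap F b q)"
  by (simp_all add: cdom_def cmap_def prod_mfd_def)

section \<open>The product manifold and lifted functions and forms\<close>

locale product_manifold = B: manifold B + F: manifold F
  for B :: "('a::{t2_space, second_countable_topology}, 'e::euclidean_space) mfd"
    and F :: "('b::{t2_space, second_countable_topology}, 'f::euclidean_space) mfd"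
begin

abbreviation "M \<equiv> prod_mfd B F"

lemma cmap_prod_fun: "cmap M (a, b) = map_prod (cmap B a) (cmap F b)"
  by (simp add: fun_eq_iff cmap_prod)

lemma cmap_image_prod: "cmap M (a, b) ` (U \<times> V) = (cmap B a ` U) \<times> (cmap F b ` V)"
  unfolding cmap_prod_fun by (rule map_prod_surj_on) auto

lemma cinv_prod:
  assumes "x \<in> cmap B a ` cdom B a" "y \<in> cmap F b ` cdom F b"
  shows "cinv M (a, b) (x, y) = (cinv B a x, cinv F b y)"
proof -
  have inj: "inj_on (cmap M (a, b)) (cdom M (a, b))"
    by (rule inj_onI) (auto simp: cdom_prod cmap_prod, (metis B.cinv_cmap F.cinv_cmap)+)
  have "cmap M (a, b) (cinv B a x, cinv F b y) = (x, y)" "(cinv B a x, cinv F b y) \<in> cdom M (a, b)"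
    using assms by (auto simp: cmap_prod cdom_prod)
  then show ?thesis unfolding cinv_def[of M] using inj by (metis inv_into_f_f)
qed

lemma smooth_manifold_prod: "smooth_manifold M"
  unfolding smooth_manifold_def
proof (intro conjI allI)
  fix z :: "'a \<times> 'b"
  obtain a b where z: "z = (a, b)" by (cases z)
  show "z \<in> cdom M z" "open (cdom M z)" "open (cmap M z ` cdom M z)"
    by (simp_all add: z cdom_prod cmap_image_prod B.mem_cdom F.mem_cdom open_Times B.open_cdom F.open_cdom B.open_range F.open_range)
  have hB: "continuous_on (cdom B a) (cmap B a)" "continuous_on (cmap B a ` cdom B a) (cinv B a)"
    and hF: "continuous_on (cdom F b) (cmap F b)" "continuous_on (cmap F b ` cdom F b) (cinv F b)"
    using B.homeo[of a] F.homeo[of b] by (auto simp: homeomorphism_def)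
  show "homeomorphism (cdom M z) (cmap M z ` cdom M z) (cmap M z) (cinv M z)"
  proof (rule homeomorphismI)
    show "continuous_on (cdom M z) (cmap M z)"
      unfolding z cdom_prod cmap_prod_fun map_prod_def case_prod_unfold
      by (intro continuous_on_Pair continuous_on_compose2[OF hB(1)] continuous_on_compose2[OF hF(1)] continuous_intros) auto
    have "continuous_on (cmap B a ` cdom B a \<times> cmap F b ` cdom F b) (\<lambda>x. (cinv B a (fst x), cinv F b (snd x)))"
      by (intro continuous_on_Pair continuous_on_compose2[OF hB(2)] continuous_on_compose2[OF hF(2)] continuous_intros) auto
    then show "continuous_on (cmap M z ` cdom M z) (cinv M z)"
      unfolding z cdom_prod cmap_image_prod
      by (rule continuous_on_cong[THEN iffD1, rotated 2]) (auto simp: cinv_prod)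
  qed (auto simp: z cdom_prod cmap_prod cinv_prod)
next
  fix z z' :: "'a \<times> 'b"
  obtain a b c d where z: "z = (a, b)" "z' = (c, d)" by (cases z, cases z')
  let ?S = "cmap B a ` (cdom B a \<inter> cdom B c)" and ?T = "cmap F b ` (cdom F b \<inter> cdom F d)"
  have o: "open ?S" "open ?T" "open (?S \<times> ?T)"
    using B.open_image[OF B.open_cdom, of a c] F.open_image[OF F.open_cdom, of b d]
    by (auto simp: Int_commute intro!: open_Times)
  have "smooth_on (?S \<times> ?T) fst" "smooth_on (?S \<times> ?T) snd"
    using o(3) by (auto intro: smooth_on_linear bounded_linear_fst bounded_linear_snd)
  then have "smooth_on (?S \<times> ?T) (\<lambda>x. ((cmap B c \<circ> cinv B a) (fst x), (cmap F d \<circ> cinv F b) (snd x)))"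
    by (intro smooth_on_Pair o smooth_on_compose[OF o(3) o(1) B.smooth_transition]
        smooth_on_compose[OF o(3) o(2) F.smooth_transition]) auto
  then show "smooth_on (cmap M z ` (cdom M z \<inter> cdom M z')) (cmap M z' \<circ> cinv M z)"
    unfolding z cdom_prod Times_Int_Times cmap_image_prod
    by (rule smooth_on_cong[OF o(3), rotated]) (auto simp: cinv_prod cmap_prod)
qed

sublocale M: manifold M
  by unfold_locales (rule smooth_manifold_prod)

text \<open>Derivatives in a product chart are computed from a formula \<open>k\<close> in the
  coordinates of the factors, which has to match \<open>h\<close> on the open range of the
  chart.\<close>

lemma chart_prod_has_derivative:
  fixes h :: "'a \<times> 'b \<Rightarrow> 'v::real_normed_vector"
  assumes pq: "p \<in> cdom B a" "q \<in> cdom F b"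
    and D: "(k has_derivative k') (at (cmap B a p, cmap F b q))"
    and eq: "\<And>x y. x \<in> cmap B a ` cdom B a \<Longrightarrow> y \<in> cmap F b ` cdom F b \<Longrightarrow> k (x, y) = h (cinv B a x, cinv F b y)"
  shows "(h \<circ> cinv M (a, b) has_derivative k') (at (cmap M (a, b) (p, q)))"
  unfolding cmap_prod
  by (rule has_derivative_transform_within_open[OF D, of "(cmap B a ` cdom B a) \<times> (cmap F b ` cdom F b)"])
    (use pq in \<open>auto intro!: open_Times B.open_range F.open_range simp: cinv_prod eq\<close>)

lemma has_derivative_fst_snd:
  assumes "(u has_derivative u') (at x)" "(w has_derivative w') (at y)"
  shows "((\<lambda>z. u (fst z)) has_derivative (\<lambda>v. u' (fst v))) (at (x, y))"
    "((\<lambda>z. w (snd z)) has_derivative (\<lambda>v. w' (snd v))) (at (x, y))"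
  using has_derivative_compose[OF bounded_linear_imp_has_derivative[OF bounded_linear_fst], of u u' "(x, y)" UNIV]
    has_derivative_compose[OF bounded_linear_imp_has_derivative[OF bounded_linear_snd], of w w' "(x, y)" UNIV] assms
  by auto

lemma coord_change_prod:
  assumes "p \<in> cdom B a" "p \<in> cdom B c" "q \<in> cdom F b" "q \<in> cdom F d"
  shows "coord_change M (a, b) (c, d) (p, q) v = (coord_change B a c p (fst v), coord_change F b d q (snd v))"
proof -
  have "((\<lambda>z. ((cmap B c \<circ> cinv B a) (fst z), (cmap F d \<circ> cinv F b) (snd z))) has_derivative
      (\<lambda>v. (coord_change B a c p (fst v), coord_change F b d q (snd v)))) (at (cmap B a p, cmap F b q))"
    by (rule has_derivative_Pair[OF
          has_derivative_fst_snd[OF B.coord_change_has_derivative[OF assms(1,2)] F.coord_change_has_derivative[OF assms(3,4)]]])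
  then have 1: "(cmap M (c, d) \<circ> cinv M (a, b) has_derivative
      (\<lambda>v. (coord_change B a c p (fst v), coord_change F b d q (snd v)))) (at (cmap M (a, b) (p, q)))"
    by (rule chart_prod_has_derivative[OF assms(1,3)]) (simp add: cmap_prod)
  have 2: "(cmap M (c, d) \<circ> cinv M (a, b) has_derivative
      blinfun_apply (coord_change M (a, b) (c, d) (p, q))) (at (cmap M (a, b) (p, q)))"
    by (rule M.coord_change_has_derivative) (use assms in \<open>auto simp: cdom_prod\<close>)
  show ?thesis unfolding has_derivative_unique[OF 2 1] ..
qed

lemma coord_field_prod:
  assumes "p \<in> cdom B a" "q \<in> cdom F b"
  shows "coord_field M (a, b) v (p, q) = (coord_field B a (fst v) p, coord_field F b (snd v) q)"
  by (simp add: coord_field_def coord_change_prod assms B.mem_cdom F.mem_cdom)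

lemma smooth_fun_on_fst:
  assumes U: "open U" and u: "smooth_fun_on B U u"
  shows "smooth_fun_on M (U \<times> UNIV) (\<lambda>z. u (fst z))"
  unfolding smooth_fun_on_def
proof
  fix z :: "'a \<times> 'b"
  obtain a b where z: "z = (a, b)" by (cases z)
  let ?S = "cmap B a ` (U \<inter> cdom B a)" and ?T = "cmap F b ` cdom F b"
  have o: "open ?S" "open (?S \<times> ?T)" using B.open_image[OF U] F.open_range by (auto intro: open_Times)
  have "smooth_on (?S \<times> ?T) (\<lambda>x. (u \<circ> cinv B a) (fst x))"
    by (rule smooth_on_compose[OF o(2,1) u[unfolded smooth_fun_on_def, rule_format]])
      (use o(2) in \<open>auto intro: smooth_on_linear bounded_linear_fst\<close>)
  then show "smooth_on (cmap M z ` ((U \<times> UNIV) \<inter> cdom M z)) ((\<lambda>z. u (fst z)) \<circ> cinv M z)"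
    unfolding z cdom_prod Times_Int_Times cmap_image_prod Int_UNIV_left
    by (rule smooth_on_cong[OF o(2), rotated]) (auto simp: cinv_prod)
qed

lemma smooth_fun_on_snd:
  assumes U: "open U" and u: "smooth_fun_on F U u"
  shows "smooth_fun_on M (UNIV \<times> U) (\<lambda>z. u (snd z))"
  unfolding smooth_fun_on_def
proof
  fix z :: "'a \<times> 'b"
  obtain a b where z: "z = (a, b)" by (cases z)
  let ?S = "cmap B a ` cdom B a" and ?T = "cmap F b ` (U \<inter> cdom F b)"
  have o: "open ?T" "open (?S \<times> ?T)" using F.open_image[OF U] B.open_range by (auto intro: open_Times)
  have "smooth_on (?S \<times> ?T) (\<lambda>x. (u \<circ> cinv F b) (snd x))"
    by (rule smooth_on_compose[OF o(2,1) u[unfolded smooth_fun_on_def, rule_format]])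
      (use o(2) in \<open>auto intro: smooth_on_linear bounded_linear_snd\<close>)
  then show "smooth_on (cmap M z ` ((UNIV \<times> U) \<inter> cdom M z)) ((\<lambda>z. u (snd z)) \<circ> cinv M z)"
    unfolding z cdom_prod Times_Int_Times cmap_image_prod Int_UNIV_left
    by (rule smooth_on_cong[OF o(2), rotated]) (auto simp: cinv_prod)
qed

lemma smooth_fun_lift:
  "smooth_fun B u \<Longrightarrow> smooth_fun M (\<lambda>z. u (fst z))" "smooth_fun F w \<Longrightarrow> smooth_fun M (\<lambda>z. w (snd z))"
  using smooth_fun_on_fst[of UNIV u] smooth_fun_on_snd[of UNIV w] by simp_all

lemma differential_lift:
  assumes "smooth_fun B u" "smooth_fun F w"
  shows "differential M (\<lambda>z. u (fst z)) = hlift (differential B u)" "differential M (\<lambda>z. w (snd z)) = vlift (differential F w)"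
proof -
  have "differential M (\<lambda>z. u (fst z)) z = hlift (differential B u) z \<and> differential M (\<lambda>z. w (snd z)) z = vlift (differential F w) z" for z
  proof -
    obtain p q where z: "z = (p, q)" by (cases z)
    note d = has_derivative_fst_snd[OF B.differential_has_derivative[OF assms(1), of p] F.differential_has_derivative[OF assms(2), of q], simplified]
    show ?thesis
      unfolding z
      by (safe; rule blinfun_eqI; rule M.differential_eqI[THEN trans], rule chart_prod_has_derivative[OF B.mem_cdom F.mem_cdom], rule d) auto
  qed
  then show "differential M (\<lambda>z. u (fst z)) = hlift (differential B u)" "differential M (\<lambda>z. w (snd z)) = vlift (differential F w)"
    by auto
qed

lemma hlift_form:
  assumes "\<alpha> \<in> one_forms B"
  shows "hlift \<alpha> \<in> one_forms M"
  unfolding one_forms_def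
proof safe
  fix a b v w
  have "smooth_fun_on M (cdom B a \<times> cdom F b) (\<lambda>z. \<alpha> (fst z) (coord_field B a v (fst z)))"
    by (rule M.smooth_fun_on_subset[OF smooth_fun_on_fst[OF B.open_cdom B.one_formsD[OF assms]]]) auto
  then show "smooth_fun_on M (cdom M (a, b)) (\<lambda>z. hlift \<alpha> z (coord_field M (a, b) (v, w) z))"
    unfolding cdom_prod by (rule M.smooth_fun_on_cong[rotated 2])
      (auto simp: coord_field_prod open_Times B.open_cdom F.open_cdom)
qed

lemma vlift_form:
  assumes "\<beta> \<in> one_forms F"
  shows "vlift \<beta> \<in> one_forms M"
  unfolding one_forms_def
proof safe
  fix a b v w
  have "smooth_fun_on M (cdom B a \<times> cdom F b) (\<lambda>z. \<beta> (snd z) (coord_field F b w (snd z)))"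
    by (rule M.smooth_fun_on_subset[OF smooth_fun_on_snd[OF F.open_cdom F.one_formsD[OF assms]]]) auto
  then show "smooth_fun_on M (cdom M (a, b)) (\<lambda>z. vlift \<beta> z (coord_field M (a, b) (v, w) z))"
    unfolding cdom_prod by (rule M.smooth_fun_on_cong[rotated 2])
      (auto simp: coord_field_prod open_Times B.open_cdom F.open_cdom)
qed

text \<open>A form on the product is in general not a sum of lifted forms, but its value at one
  point is; for tensorial expressions that is enough.\<close>

lemma form_value_split:
  obtains \<alpha> \<beta> where "\<alpha> \<in> one_forms B" "\<beta> \<in> one_forms F" "\<omega> = hlift \<alpha> (p, q) + vlift \<beta> (p, q)"
proof -
  obtain \<alpha> where \<alpha>: "\<alpha> \<in> one_forms B" "\<alpha> p = \<omega> o\<^sub>L inl_blinfun" by (rule B.covector_is_form_value)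
  obtain \<beta> where \<beta>: "\<beta> \<in> one_forms F" "\<beta> q = \<omega> o\<^sub>L inr_blinfun" by (rule F.covector_is_form_value)
  have "\<omega> = hlift \<alpha> (p, q) + vlift \<beta> (p, q)"
    unfolding hlift_def vlift_def fst_conv snd_conv \<alpha>(2) \<beta>(2) by (rule covector_split)
  then show thesis using that \<alpha> \<beta> by blast
qed

text \<open>In the preferred charts the slice inclusions and the projections are affine near the
  point, so their tangent maps are the constant block maps. This makes \<open>sum_bivector\<close>
  and \<open>warped_metric\<close> explicit.\<close>

lemma tangent_maps:
  "tangent_map B M (\<lambda>x. (x, q)) p = inl_blinfun" "tangent_map F M (\<lambda>y. (p, y)) q = inr_blinfun"
  "tangent_map M B fst (p, q) = fst_blinfun" "tangent_map M F snd (p, q) = snd_blinfun"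
proof -
  have 1: "(cmap M (p, q) \<circ> (\<lambda>x. (x, q)) \<circ> cinv B p has_derivative (\<lambda>v. (v, 0))) (at (cmap B p p))"
    by (rule has_derivative_transform_within_open[OF has_derivative_Pair[OF has_derivative_ident has_derivative_const] B.open_range[of p]])
      (auto simp: cmap_prod B.mem_cdom)
  have 2: "(cmap M (p, q) \<circ> (\<lambda>y. (p, y)) \<circ> cinv F q has_derivative (\<lambda>v. (0, v))) (at (cmap F q q))"
    by (rule has_derivative_transform_within_open[OF has_derivative_Pair[OF has_derivative_const has_derivative_ident] F.open_range[of q]])
      (auto simp: cmap_prod F.mem_cdom)
  have 3: "(cmap B p \<circ> fst \<circ> cinv M (p, q) has_derivative fst) (at (cmap M (p, q) (p, q)))"
    by (rule chart_prod_has_derivative[OF B.mem_cdom F.mem_cdom, where k = fst]) (auto intro!: derivative_eq_intros)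
  have 4: "(cmap F q \<circ> snd \<circ> cinv M (p, q) has_derivative snd) (at (cmap M (p, q) (p, q)))"
    by (rule chart_prod_has_derivative[OF B.mem_cdom F.mem_cdom, where k = snd]) (auto intro!: derivative_eq_intros)
  show "tangent_map B M (\<lambda>x. (x, q)) p = inl_blinfun" "tangent_map F M (\<lambda>y. (p, y)) q = inr_blinfun"
    unfolding tangent_map_def frechet_derivative_at[OF 1, symmetric] frechet_derivative_at[OF 2, symmetric]
    by (simp_all add: inl_blinfun_def inr_blinfun_def)
  show "tangent_map M B fst (p, q) = fst_blinfun" "tangent_map M F snd (p, q) = snd_blinfun"
    unfolding tangent_map_def fst_conv snd_conv frechet_derivative_at[OF 3, symmetric] frechet_derivative_at[OF 4, symmetric]
    by (rule blinfun_eqI; simp add: bounded_linear_Blinfun_apply bounded_linear_fst bounded_linear_snd)+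
qed

end

section \<open>The sum of two bivector fields\<close>

locale poisson_product = B: bivector_manifold B PB + F: bivector_manifold F PF
  for B :: "('a::{t2_space, second_countable_topology}, 'e::euclidean_space) mfd" and PB
    and F :: "('b::{t2_space, second_countable_topology}, 'f::euclidean_space) mfd" and PF
begin

sublocale product_manifold B F ..

abbreviation "P \<equiv> sum_bivector B F PB PF"

lemma sum_bivector_apply:
  "P (p, q) \<omega> \<tau> = PB p (\<omega> o\<^sub>L inl_blinfun) (\<tau> o\<^sub>L inl_blinfun) + PF q (\<omega> o\<^sub>L inr_blinfun) (\<tau> o\<^sub>L inr_blinfun)"
  by (simp add: sum_bivector_def tangent_maps)

lemma coord_form_prod:
  assumes "p \<in> cdom B a" "q \<in> cdom F b"
  shows "coord_form M (a, b) \<omega> (p, q) o\<^sub>L inl_blinfun = coord_form B a (\<omega> o\<^sub>L inl_blinfun) p"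
    "coord_form M (a, b) \<omega> (p, q) o\<^sub>L inr_blinfun = coord_form F b (\<omega> o\<^sub>L inr_blinfun) q"
  by (rule blinfun_eqI, simp add: coord_form_def coord_change_prod assms B.mem_cdom F.mem_cdom)+

lemma bivector_field_sum: "bivector_field M P"
  unfolding bivector_field_def
proof (intro conjI allI)
  fix z :: "'a \<times> 'b" and \<omega> \<tau>
  obtain p q where z: "z = (p, q)" by (cases z)
  show "bilinear (P z)"
    unfolding bilinear_def z sum_bivector_apply
    by (intro conjI allI linearI) (simp_all add: compose_simps B.P_simps F.P_simps algebra_simps)
  show "P z \<omega> \<tau> = - P z \<tau> \<omega>"
    unfolding z sum_bivector_apply by (simp add: B.P_antisym[of p "\<omega> o\<^sub>L _"] F.P_antisym[of q "\<omega> o\<^sub>L _"])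
  let ?\<omega>1 = "\<omega> o\<^sub>L inl_blinfun" and ?\<omega>2 = "\<omega> o\<^sub>L inr_blinfun" and ?\<tau>1 = "\<tau> o\<^sub>L inl_blinfun" and ?\<tau>2 = "\<tau> o\<^sub>L inr_blinfun"
  have o: "open (cdom B p \<times> cdom F q)" by (simp add: open_Times B.open_cdom F.open_cdom)
  have "smooth_fun_on M (cdom B p \<times> cdom F q) (\<lambda>x. PB (fst x) (coord_form B p ?\<omega>1 (fst x)) (coord_form B p ?\<tau>1 (fst x)))"
    by (rule M.smooth_fun_on_subset[OF smooth_fun_on_fst[OF B.open_cdom B.smooth_P_coord]]) auto
  moreover have "smooth_fun_on M (cdom B p \<times> cdom F q) (\<lambda>x. PF (snd x) (coord_form F q ?\<omega>2 (snd x)) (coord_form F q ?\<tau>2 (snd x)))"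
    by (rule M.smooth_fun_on_subset[OF smooth_fun_on_snd[OF F.open_cdom F.smooth_P_coord]]) auto
  ultimately have "smooth_fun_on M (cdom B p \<times> cdom F q) (\<lambda>x.
      PB (fst x) (coord_form B p ?\<omega>1 (fst x)) (coord_form B p ?\<tau>1 (fst x)) +
      PF (snd x) (coord_form F q ?\<omega>2 (snd x)) (coord_form F q ?\<tau>2 (snd x)))"
    by (rule M.smooth_fun_on_add[OF o])
  then show "smooth_fun_on M (cdom M z) (\<lambda>x. P x (coord_form M z \<omega> x) (coord_form M z \<tau> x))"
    unfolding z cdom_prod
    by (rule M.smooth_fun_on_cong[OF o, rotated]) (auto simp: sum_bivector_apply coord_form_prod)
qed

sublocale M: bivector_manifold M P
  by unfold_locales (rule bivector_field_sum)

lemma along_lift: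
  assumes "smooth_fun B u" "smooth_fun F w"
  shows "M.along (hlift \<alpha>) (\<lambda>z. u (fst z)) = (\<lambda>z. B.along \<alpha> u (fst z))" "M.along (hlift \<alpha>) (\<lambda>z. w (snd z)) = (\<lambda>z. 0)"
    "M.along (vlift \<beta>) (\<lambda>z. u (fst z)) = (\<lambda>z. 0)" "M.along (vlift \<beta>) (\<lambda>z. w (snd z)) = (\<lambda>z. F.along \<beta> w (snd z))"
  by (simp_all add: fun_eq_iff M.along_def differential_lift[OF assms] sum_bivector_apply B.along_def F.along_def B.P_simps F.P_simps)

lemma poisson_bracket_lift:
  assumes "smooth_fun B u" "smooth_fun B u'" "smooth_fun F w" "smooth_fun F w'"
  shows "poisson_bracket M P (\<lambda>z. u (fst z)) (\<lambda>z. u' (fst z)) = (\<lambda>z. poisson_bracket B PB u u' (fst z))"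
    "poisson_bracket M P (\<lambda>z. u (fst z)) (\<lambda>z. w (snd z)) = (\<lambda>z. 0)"
    "poisson_bracket M P (\<lambda>z. w (snd z)) (\<lambda>z. u (fst z)) = (\<lambda>z. 0)"
    "poisson_bracket M P (\<lambda>z. w (snd z)) (\<lambda>z. w' (snd z)) = (\<lambda>z. poisson_bracket F PF w w' (snd z))"
  unfolding M.poisson_bracket_along B.poisson_bracket_along F.poisson_bracket_along
    differential_lift[OF assms(1,3)] along_lift[OF assms(2,4)] along_lift[OF assms(2,3)] along_lift[OF assms(1,3)]
  by (rule refl)+

end

section \<open>Warped products\<close>

lemma sum_lessThan_add: "(\<Sum>i<m + n. h i) = (\<Sum>i<m. h i) + (\<Sum>j<n. h (m + j) :: 'v::comm_monoid_add)" for m n :: nat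
  by (induction n) (simp_all add: add.assoc)

lemma orthonormal_coframeD:
  fixes M :: "('a, 'e::euclidean_space) mfd"
  assumes "orthonormal_coframe M g U \<eta>"
  shows "i < DIM('e) \<Longrightarrow> \<eta> i \<in> one_forms M"
    "i < DIM('e) \<Longrightarrow> p \<in> U \<Longrightarrow> g p (\<eta> i p) (\<eta> i p) \<in> {1, -1}"
    "i < DIM('e) \<Longrightarrow> j < DIM('e) \<Longrightarrow> i \<noteq> j \<Longrightarrow> p \<in> U \<Longrightarrow> g p (\<eta> i p) (\<eta> j p) = 0"
  using assms unfolding orthonormal_coframe_def by blast+

context contravariant_geometry
begin

lemma local_coframe_mem:
  assumes "i < DIM('e)"
  shows "local_coframe M g p i \<in> \<Omega>" "g p (local_coframe M g p i p) (local_coframe M g p i p) \<in> {1, -1}"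
  using local_coframe[of p] assms unfolding orthonormal_coframe_def by metis+

lemma ricci_cong:
  assumes "poisson M P" "\<alpha> \<in> \<Omega>" "\<alpha>' \<in> \<Omega>" "\<alpha> p = \<alpha>' p" "\<beta> p = \<beta>' p"
  shows "ricci M P g D \<alpha> \<beta> p = ricci M P g D \<alpha>' \<beta>' p"
proof -
  have "curv \<alpha> (local_coframe M g p i) (local_coframe M g p i) p = curv \<alpha>' (local_coframe M g p i) (local_coframe M g p i) p"
    if "i < DIM('e)" for i
    using local_coframe_mem(1)[OF that, of p] by (intro curv_cong assms refl)
  then show ?thesis by (simp add: ricci_def Let_def assms(5))
qed

lemma ricci_add_left:
  assumes "\<alpha> \<in> \<Omega>" "\<alpha>' \<in> \<Omega>"
  shows "ricci M P g D (\<lambda>q. \<alpha> q + \<alpha>' q) \<beta> p = ricci M P g D \<alpha> \<beta> p + ricci M P g D \<alpha>' \<beta> p"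
  using assms local_coframe_mem
  by (simp add: ricci_def Let_def curv_add1 cometric_simps distrib_left sum.distrib)

lemma ricci_add_right:
  "ricci M P g D \<alpha> (\<lambda>q. \<beta> q + \<beta>' q) p = ricci M P g D \<alpha> \<beta> p + ricci M P g D \<alpha> \<beta>' p"
  by (simp add: ricci_def Let_def cometric_simps distrib_left sum.distrib)

lemma curv_mult2:
  assumes "\<alpha> \<in> \<Omega>" "\<beta> \<in> \<Omega>" "\<gamma> \<in> \<Omega>" "smooth_fun M u"
  shows "curv \<alpha> (\<lambda>p. u p *\<^sub>R \<beta> p) \<gamma> p = u p *\<^sub>R curv \<alpha> \<beta> \<gamma> p"
  using curv_antisym[OF assms(1) one_forms_mult[OF assms(4,2)] assms(3), of p] curv_antisym[OF assms(1-3), of p]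
  by (simp add: curv_mult1 assms)

text \<open>The contraction of an orthonormal coframe. It later produces the squared norm of
  \<open>J df\<close> from the base trace and a single copy of the fibre metric from the fibre
  trace.\<close>

lemma sum_coframe:
  assumes "orthonormal_coframe M g U \<eta>" "p \<in> U"
  shows "(\<Sum>i<DIM('e). g p (\<eta> i p) (\<eta> i p) * (g p \<sigma> (\<eta> i p) * g p (\<eta> i p) \<tau>)) = g p \<sigma> \<tau>"
proof -
  have "g p (\<Sum>i<DIM('e). (g p (\<eta> i p) (\<eta> i p) * g p \<sigma> (\<eta> i p)) *\<^sub>R \<eta> i p) \<tau> =
      (\<Sum>i<DIM('e). g p (\<eta> i p) (\<eta> i p) * (g p \<sigma> (\<eta> i p) * g p (\<eta> i p) \<tau>))"
    by (simp add: cometric_simps mult.assoc)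
  then show ?thesis unfolding orthonormal_coframe_expansion[OF assms, symmetric] by simp
qed

end

section \<open>The warped metric and its cometric\<close>

locale warped_metric_product = poisson_product B PB F PF +
  B: poisson_metric_manifold B PB GB + F: poisson_metric_manifold F PF GF
  for B :: "('a::{t2_space, second_countable_topology}, 'e::euclidean_space) mfd" and PB GB
    and F :: "('b::{t2_space, second_countable_topology}, 'f::euclidean_space) mfd" and PF GF +
  fixes f :: "'a \<Rightarrow> real"
  assumes smooth_f: "smooth_fun B f" and f_pos: "f p > 0"
begin

abbreviation "GM \<equiv> warped_metric B F f GB GF"

lemma f_nonzero [simp]: "f p \<noteq> 0"
  using f_pos[of p] by simp

lemma warped_metric_apply:
  "GM (p, q) v w = GB p (fst v) (fst w) + (f p)\<^sup>2 * GF q (snd v) (snd w)"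
  by (simp add: warped_metric_def pullback_metric_def tangent_maps)

lemma pseudo_riemannian_warped: "pseudo_riemannian M GM"
  unfolding pseudo_riemannian_def
proof (intro conjI allI impI)
  fix z :: "'a \<times> 'b" and v w
  obtain p q where z: "z = (p, q)" by (cases z)
  show "bilinear (GM z)"
    unfolding bilinear_def z warped_metric_apply
    by (intro conjI allI linearI) (simp_all add: B.G_simps F.G_simps algebra_simps)
  show "GM z v w = GM z w v"
    unfolding z warped_metric_apply by (simp add: B.G_sym[of p "fst v"] F.G_sym[of q "snd v"])
  have o: "open (cdom B p \<times> cdom F q)" by (simp add: open_Times B.open_cdom F.open_cdom)
  have "smooth_fun_on M (cdom B p \<times> cdom F q) (\<lambda>x. GB (fst x) (coord_field B p (fst v) (fst x)) (coord_field B p (fst w) (fst x)))"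
    by (rule M.smooth_fun_on_subset[OF smooth_fun_on_fst[OF B.open_cdom B.smooth_G_coord]]) auto
  moreover have "smooth_fun_on M (cdom B p \<times> cdom F q) (\<lambda>x. (f (fst x))\<^sup>2 *
      GF (snd x) (coord_field F q (snd v) (snd x)) (coord_field F q (snd w) (snd x)))"
    unfolding power2_eq_square
    by (intro M.smooth_fun_on_mult o M.smooth_fun_on_subset[OF smooth_fun_lift(1)[OF smooth_f]]
        M.smooth_fun_on_subset[OF smooth_fun_on_snd[OF F.open_cdom F.smooth_G_coord]]) auto
  ultimately have "smooth_fun_on M (cdom B p \<times> cdom F q) (\<lambda>x.
      GB (fst x) (coord_field B p (fst v) (fst x)) (coord_field B p (fst w) (fst x)) + (f (fst x))\<^sup>2 *
      GF (snd x) (coord_field F q (snd v) (snd x)) (coord_field F q (snd w) (snd x)))"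
    by (rule M.smooth_fun_on_add[OF o])
  then show "smooth_fun_on M (cdom M z) (\<lambda>x. GM x (coord_field M z v x) (coord_field M z w x))"
    unfolding z cdom_prod
    by (rule M.smooth_fun_on_cong[OF o, rotated]) (auto simp: warped_metric_apply coord_field_prod)
next
  fix z :: "'a \<times> 'b" and v :: "'e \<times> 'f"
  obtain p q where z: "z = (p, q)" by (cases z)
  assume v: "\<forall>w. GM z v w = 0"
  have "GB p (fst v) w = 0" for w
    using v[rule_format, of "(w, 0)"] by (simp add: z warped_metric_apply F.G_simps)
  \<comment> \<open>The warping function has no zeros, so the factor \<open>(f p)\<^sup>2\<close>
    can be cancelled.\<close>
  moreover have "GF q (snd v) w = 0" for w
    using v[rule_format, of "(0, w)"] by (simp add: z warped_metric_apply B.G_simps)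
  ultimately show "v = 0"
    using scalar_productD(4)[OF B.scalar_product_G] scalar_productD(4)[OF F.scalar_product_G] by (metis prod_eqI fst_zero snd_zero)
qed

sublocale M: poisson_metric_manifold M P GM
  by unfold_locales (rule pseudo_riemannian_warped)

text \<open>Raising an index inverts the block-diagonal metric, so the fibre component of the raised
  vector carries the inverse of \<open>(f p)\<^sup>2\<close>; in the cometric this factor appears
  once.\<close>

lemma cometric_warped:
  "M.g (p, q) \<omega> \<tau> = B.g p (\<omega> o\<^sub>L inl_blinfun) (\<tau> o\<^sub>L inl_blinfun) +
     inverse ((f p)\<^sup>2) * F.g q (\<omega> o\<^sub>L inr_blinfun) (\<tau> o\<^sub>L inr_blinfun)"
proof -
  have "metric_raise GM (p, q) \<tau> = (metric_raise GB p (\<tau> o\<^sub>L inl_blinfun), inverse ((f p)\<^sup>2) *\<^sub>R metric_raise GF q (\<tau> o\<^sub>L inr_blinfun))"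
  proof (rule M.raise_eqI)
    fix w
    have "\<tau> w = \<tau> (fst w, 0) + \<tau> (0, snd w)" by (simp flip: blinfun.add_right)
    then show "GM (p, q) (metric_raise GB p (\<tau> o\<^sub>L inl_blinfun), inverse ((f p)\<^sup>2) *\<^sub>R metric_raise GF q (\<tau> o\<^sub>L inr_blinfun)) w = \<tau> w"
      by (simp add: warped_metric_apply B.G_raise F.G_raise F.G_simps)
  qed
  moreover have "\<omega> (v, c *\<^sub>R w) = \<omega> (v, 0) + c * \<omega> (0, w)" for v w c
    using blinfun.add_right[of \<omega> "(v, 0)" "c *\<^sub>R (0, w)"] by (simp add: blinfun.scaleR_right del: scaleR_Pair) simp
  ultimately show ?thesis
    by (simp add: M.cometric_apply B.cometric_apply F.cometric_apply)
qed

lemma cometric_lift: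
  "M.g z (hlift \<alpha> z) (hlift \<beta> z) = B.g (fst z) (\<alpha> (fst z)) (\<beta> (fst z))"
  "M.g z (hlift \<alpha> z) (vlift \<gamma> z) = 0" "M.g z (vlift \<gamma> z) (hlift \<alpha> z) = 0"
  "M.g z (vlift \<gamma> z) (vlift \<delta> z) = inverse ((f (fst z))\<^sup>2) * F.g (snd z) (\<gamma> (snd z)) (\<delta> (snd z))"
  by (cases z; simp add: cometric_warped B.cometric_simps F.cometric_simps)+

text \<open>Lifted forms exhaust all covectors at a point, so the Koszul formula needs to be
  evaluated on lifted test forms only.\<close>

lemma lift_eqI:
  assumes "\<And>\<gamma>. \<gamma> \<in> one_forms B \<Longrightarrow> M.g z \<omega> (hlift \<gamma> z) = M.g z \<omega>' (hlift \<gamma> z)"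
    "\<And>\<delta>. \<delta> \<in> one_forms F \<Longrightarrow> M.g z \<omega> (vlift \<delta> z) = M.g z \<omega>' (vlift \<delta> z)"
  shows "\<omega> = \<omega>'"
proof (rule M.cometric_nondegenerate[of z])
  fix \<tau> :: "('e \<times> 'f) \<Rightarrow>\<^sub>L real"
  obtain \<gamma> \<delta> where "\<gamma> \<in> one_forms B" "\<delta> \<in> one_forms F" "\<tau> = hlift \<gamma> (fst z, snd z) + vlift \<delta> (fst z, snd z)"
    by (rule form_value_split)
  then show "M.g z \<omega> \<tau> = M.g z \<omega>' \<tau>" by (simp add: M.cometric_simps assms)
qed

end

section \<open>Brackets of lifted forms and the Jacobi identity of the product\<close>

locale warped_product = warped_metric_product B PB GB F PF GF f +
  B: contravariant_geometry B PB GB DB + F: contravariant_geometry F PF GF DF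
  for B :: "('a::{t2_space, second_countable_topology}, 'e::euclidean_space) mfd" and PB GB DB
    and F :: "('b::{t2_space, second_countable_topology}, 'f::euclidean_space) mfd" and PF GF DF
    and f +
  fixes D
  assumes levi_civita_prod: "contravariant_levi_civita (prod_mfd B F) (sum_bivector B F PB PF)
      (cometric (warped_metric B F f GB GF)) D"
    and poisson_B: "poisson B PB" and poisson_F: "poisson F PF"
begin

sublocale M: contravariant_geometry M P GM D
  by unfold_locales (rule levi_civita_prod)

text \<open>The lifting lemmas treat both factors at once; these specialisations put the zero
  function in place of the factor that does not occur.\<close>

lemmas along_h = along_lift(1,3)[OF _ F.smooth_fun_on_const[of UNIV 0]]
lemmas along_v = along_lift(2,4)[OF B.smooth_fun_on_const[of UNIV 0]]
lemmas differential_h = differential_lift(1)[OF _ F.smooth_fun_on_const[of UNIV 0]]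
lemmas differential_v = differential_lift(2)[OF B.smooth_fun_on_const[of UNIV 0]]
lemmas bracket_h = poisson_bracket_lift(1)[OF _ _ F.smooth_fun_on_const[of UNIV 0] F.smooth_fun_on_const[of UNIV 0]]
lemmas bracket_v = poisson_bracket_lift(4)[OF B.smooth_fun_on_const[of UNIV 0] B.smooth_fun_on_const[of UNIV 0]]
lemmas bracket_hv = poisson_bracket_lift(2,3)[OF _ B.smooth_fun_on_const[of UNIV 0] _ F.smooth_fun_on_const[of UNIV 0]]

text \<open>Neither bracket is tensorial, but the difference \<open>E\<close> is:
  \<open>along\<close> commutes with lifting, so the derivative terms in the two Leibniz rules
  cancel. On differentials both brackets are the differential of the same lifted Poisson
  bracket.\<close>

lemma br_hh:
  assumes "\<alpha> \<in> B.\<Omega>" "\<beta> \<in> B.\<Omega>"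
  shows "M.br (hlift \<alpha>) (hlift \<beta>) = hlift (B.br \<alpha> \<beta>)"
proof (rule ext, rule blinfun_eqI)
  fix z x
  define E where "E \<alpha> \<beta> = (M.br (hlift \<alpha>) (hlift \<beta>) z - hlift (B.br \<alpha> \<beta>) z) x" for \<alpha> \<beta>
  have E1: "E \<alpha> \<beta> = E \<alpha>' \<beta>" if "\<alpha> \<in> B.\<Omega>" "\<alpha>' \<in> B.\<Omega>" "\<beta> \<in> B.\<Omega>" "\<alpha> (fst z) = \<alpha>' (fst z)" for \<alpha> \<alpha>' \<beta>
    by (rule B.tensorial[where T = "\<lambda>\<alpha>. E \<alpha> \<beta>", OF _ _ that(1,2,4)])
      (simp_all add: E_def that hlift_form lift_simps M.br_add B.br_add M.br_mult B.br_mult smooth_fun_lift along_h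
        blinfun.add_left blinfun.diff_left blinfun.scaleR_left algebra_simps del: lift_apply)
  have E2: "E \<alpha> \<beta> = E \<alpha> \<beta>'" if "\<alpha> \<in> B.\<Omega>" "\<beta> \<in> B.\<Omega>" "\<beta>' \<in> B.\<Omega>" "\<beta> (fst z) = \<beta>' (fst z)" for \<alpha> \<beta> \<beta>'
    by (rule B.tensorial[where T = "\<lambda>\<beta>. E \<alpha> \<beta>", OF _ _ that(2,3,4)])
      (simp_all add: E_def that hlift_form lift_simps M.br_add B.br_add M.br_mult B.br_mult smooth_fun_lift along_h
        blinfun.add_left blinfun.diff_left blinfun.scaleR_left algebra_simps del: lift_apply)
  obtain u where u: "smooth_fun B u" "differential B u (fst z) = \<alpha> (fst z)" by (rule B.covector_is_differential)
  obtain w where w: "smooth_fun B w" "differential B w (fst z) = \<beta> (fst z)" by (rule B.covector_is_differential)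
  have "E \<alpha> \<beta> = E (differential B u) \<beta>" using u assms by (intro E1 B.differential_one_form) auto
  also have "\<dots> = E (differential B u) (differential B w)" using u w assms by (intro E2 B.differential_one_form) auto
  also have "\<dots> = 0"
    using M.koszul_exact[of "\<lambda>z. u (fst z)" "\<lambda>z. w (fst z)" z] B.koszul_exact[OF u(1) w(1), of "fst z"] u w
    by (simp add: E_def differential_h bracket_h smooth_fun_lift B.smooth_poisson_bracket blinfun.diff_left)
  finally show "M.br (hlift \<alpha>) (hlift \<beta>) z x = hlift (B.br \<alpha> \<beta>) z x"
    by (simp add: E_def blinfun.diff_left)
qed

lemma br_vv:
  assumes "\<alpha> \<in> F.\<Omega>" "\<beta> \<in> F.\<Omega>"
  shows "M.br (vlift \<alpha>) (vlift \<beta>) = vlift (F.br \<alpha> \<beta>)"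
proof (rule ext, rule blinfun_eqI)
  fix z x
  define E where "E \<alpha> \<beta> = (M.br (vlift \<alpha>) (vlift \<beta>) z - vlift (F.br \<alpha> \<beta>) z) x" for \<alpha> \<beta>
  have E1: "E \<alpha> \<beta> = E \<alpha>' \<beta>" if "\<alpha> \<in> F.\<Omega>" "\<alpha>' \<in> F.\<Omega>" "\<beta> \<in> F.\<Omega>" "\<alpha> (snd z) = \<alpha>' (snd z)" for \<alpha> \<alpha>' \<beta>
    by (rule F.tensorial[where T = "\<lambda>\<alpha>. E \<alpha> \<beta>", OF _ _ that(1,2,4)])
      (simp_all add: E_def that vlift_form lift_simps M.br_add F.br_add M.br_mult F.br_mult smooth_fun_lift along_v
        blinfun.add_left blinfun.diff_left blinfun.scaleR_left algebra_simps del: lift_apply)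
  have E2: "E \<alpha> \<beta> = E \<alpha> \<beta>'" if "\<alpha> \<in> F.\<Omega>" "\<beta> \<in> F.\<Omega>" "\<beta>' \<in> F.\<Omega>" "\<beta> (snd z) = \<beta>' (snd z)" for \<alpha> \<beta> \<beta>'
    by (rule F.tensorial[where T = "\<lambda>\<beta>. E \<alpha> \<beta>", OF _ _ that(2,3,4)])
      (simp_all add: E_def that vlift_form lift_simps M.br_add F.br_add M.br_mult F.br_mult smooth_fun_lift along_v
        blinfun.add_left blinfun.diff_left blinfun.scaleR_left algebra_simps del: lift_apply)
  obtain u where u: "smooth_fun F u" "differential F u (snd z) = \<alpha> (snd z)" by (rule F.covector_is_differential)
  obtain w where w: "smooth_fun F w" "differential F w (snd z) = \<beta> (snd z)" by (rule F.covector_is_differential)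
  have "E \<alpha> \<beta> = E (differential F u) \<beta>" using u assms by (intro E1 F.differential_one_form) auto
  also have "\<dots> = E (differential F u) (differential F w)" using u w assms by (intro E2 F.differential_one_form) auto
  also have "\<dots> = 0"
    using M.koszul_exact[of "\<lambda>z. u (snd z)" "\<lambda>z. w (snd z)" z] F.koszul_exact[OF u(1) w(1), of "snd z"] u w
    by (simp add: E_def differential_v bracket_v smooth_fun_lift F.smooth_poisson_bracket blinfun.diff_left)
  finally show "M.br (vlift \<alpha>) (vlift \<beta>) z x = vlift (F.br \<alpha> \<beta>) z x"
    by (simp add: E_def blinfun.diff_left)
qed

text \<open>Functions of one factor have zero derivative along forms of the other one, so here the
  bracket itself is linear over functions in each slot. On differentials it vanishes because
  functions lifted from different factors Poisson-commute.\<close>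

lemma br_hv:
  assumes "\<alpha> \<in> B.\<Omega>" "\<beta> \<in> F.\<Omega>"
  shows "M.br (hlift \<alpha>) (vlift \<beta>) = (\<lambda>z. 0)" "M.br (vlift \<beta>) (hlift \<alpha>) = (\<lambda>z. 0)"
proof -
  show *: "M.br (hlift \<alpha>) (vlift \<beta>) = (\<lambda>z. 0)"
  proof (rule ext, rule blinfun_eqI)
    fix z x
    define E where "E \<alpha> \<beta> = M.br (hlift \<alpha>) (vlift \<beta>) z x" for \<alpha> \<beta>
    have E1: "E \<alpha> \<beta> = E \<alpha>' \<beta>" if "\<alpha> \<in> B.\<Omega>" "\<alpha>' \<in> B.\<Omega>" "\<beta> \<in> F.\<Omega>" "\<alpha> (fst z) = \<alpha>' (fst z)" for \<alpha> \<alpha>' \<beta>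
      by (rule B.tensorial[where T = "\<lambda>\<alpha>. E \<alpha> \<beta>", OF _ _ that(1,2,4)])
        (simp_all add: E_def that hlift_form vlift_form lift_simps M.br_add M.br_mult smooth_fun_lift along_h
          blinfun.add_left blinfun.diff_left blinfun.scaleR_left algebra_simps del: lift_apply)
    have E2: "E \<alpha> \<beta> = E \<alpha> \<beta>'" if "\<alpha> \<in> B.\<Omega>" "\<beta> \<in> F.\<Omega>" "\<beta>' \<in> F.\<Omega>" "\<beta> (snd z) = \<beta>' (snd z)" for \<alpha> \<beta> \<beta>'
      by (rule F.tensorial[where T = "\<lambda>\<beta>. E \<alpha> \<beta>", OF _ _ that(2,3,4)])
        (simp_all add: E_def that hlift_form vlift_form lift_simps M.br_add M.br_mult smooth_fun_lift along_v
          blinfun.add_left blinfun.diff_left blinfun.scaleR_left algebra_simps del: lift_apply)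
    obtain u where u: "smooth_fun B u" "differential B u (fst z) = \<alpha> (fst z)" by (rule B.covector_is_differential)
    obtain w where w: "smooth_fun F w" "differential F w (snd z) = \<beta> (snd z)" by (rule F.covector_is_differential)
    have "E \<alpha> \<beta> = E (differential B u) \<beta>" using u assms by (intro E1 B.differential_one_form) auto
    also have "\<dots> = E (differential B u) (differential F w)"
      using u w assms by (intro E2 B.differential_one_form F.differential_one_form) auto
    also have "\<dots> = 0"
      using M.koszul_exact[of "\<lambda>z. u (fst z)" "\<lambda>z. w (snd z)" z] u w
      by (simp add: E_def differential_h differential_v bracket_hv smooth_fun_lift M.differential_const)
    finally show "M.br (hlift \<alpha>) (vlift \<beta>) z x = blinfun_apply 0 x" by (simp add: E_def)
  qed
  show "M.br (vlift \<beta>) (hlift \<alpha>) = (\<lambda>z. 0)"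
    by (subst M.br_antisym) (simp_all add: assms hlift_form vlift_form *)
qed

text \<open>For three lifted functions the jacobiator is 0 by the identity of a factor or because
  mixed brackets vanish. At the given point any function may be replaced by a sum of two lifted
  ones.\<close>

lemma poisson_prod: "poisson M P"
  unfolding M.poisson_iff
proof (intro allI impI)
  fix u v w z assume uvw: "smooth_fun M u" "smooth_fun M v" "smooth_fun M w"
  define L where "L = {\<lambda>z. u (fst z) |u. smooth_fun B u} \<union> {\<lambda>z. w (snd z) |w. smooth_fun F w}"
  have L_smooth: "smooth_fun M x" if "x \<in> L" for x using that by (auto simp: L_def smooth_fun_lift)
  have zero: "poisson_bracket M P x (\<lambda>z. 0) = (\<lambda>z. 0)" for x
    by (simp add: fun_eq_iff poisson_bracket_def M.differential_const M.P_simps)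
  have L0: "M.jacobiator x y t z = 0" if "x \<in> L" "y \<in> L" "t \<in> L" for x y t
    using that poisson_B[unfolded B.poisson_iff] poisson_F[unfolded F.poisson_iff]
    unfolding L_def Un_iff mem_Collect_eq
    by (elim disjE exE conjE)
      (simp_all add: M.jacobiator_def bracket_h bracket_v bracket_hv zero B.smooth_poisson_bracket F.smooth_poisson_bracket
        B.jacobiator_def F.jacobiator_def)
  have split: "\<exists>x y. x \<in> L \<and> y \<in> L \<and> differential M u z = differential M (\<lambda>z. x z + y z) z" if "smooth_fun M u" for u
  proof -
    obtain x where x: "smooth_fun B x" "differential B x (fst z) = differential M u z o\<^sub>L inl_blinfun"
      by (rule B.covector_is_differential)
    obtain y where y: "smooth_fun F y" "differential F y (snd z) = differential M u z o\<^sub>L inr_blinfun"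
      by (rule F.covector_is_differential)
    have "differential M (\<lambda>z. x (fst z) + y (snd z)) z = hlift (differential B x) z + vlift (differential F y) z"
      using M.differential_add[OF smooth_fun_lift(1)[OF x(1)] smooth_fun_lift(2)[OF y(1)], of z]
      by (simp add: differential_h differential_v x y)
    also have "\<dots> = differential M u z"
      unfolding hlift_def vlift_def x(2) y(2) by (rule covector_split[symmetric])
    finally show ?thesis using x(1) y(1) unfolding L_def by (intro exI[of _ "\<lambda>z. x (fst z)"] exI[of _ "\<lambda>z. y (snd z)"]) auto
  qed
  have cyc: "M.jacobiator x y t z = M.jacobiator y t x z" for x y t by (simp add: M.jacobiator_def)
  obtain u1 u2 where u: "u1 \<in> L" "u2 \<in> L" "differential M u z = differential M (\<lambda>z. u1 z + u2 z) z"
    using split[OF uvw(1)] by blast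
  obtain v1 v2 where v: "v1 \<in> L" "v2 \<in> L" "differential M v z = differential M (\<lambda>z. v1 z + v2 z) z"
    using split[OF uvw(2)] by blast
  obtain w1 w2 where w: "w1 \<in> L" "w2 \<in> L" "differential M w z = differential M (\<lambda>z. w1 z + w2 z) z"
    using split[OF uvw(3)] by blast
  note s = L_smooth[OF u(1)] L_smooth[OF u(2)] L_smooth[OF v(1)] L_smooth[OF v(2)] L_smooth[OF w(1)] L_smooth[OF w(2)]
  have sum: "smooth_fun M (\<lambda>z. x z + y z)" if "x \<in> L" "y \<in> L" for x y
    using that L_smooth by (intro M.smooth_fun_on_add) auto
  \<comment> \<open>Additivity is available in the first slot, so the three sums are split one at a
    time, with a cyclic rotation in between.\<close>
  have w0: "M.jacobiator (\<lambda>z. w1 z + w2 z) x y z = 0" if "x \<in> L" "y \<in> L" for x y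
    using that w by (simp add: M.jacobiator_add1 L_smooth L0)
  have v0: "M.jacobiator (\<lambda>z. v1 z + v2 z) (\<lambda>z. w1 z + w2 z) x z = 0" if "x \<in> L" for x
    using w0[OF that v(1)] w0[OF that v(2)] cyc[of v1 "\<lambda>z. w1 z + w2 z" x] cyc[of v2 "\<lambda>z. w1 z + w2 z" x]
    by (simp add: M.jacobiator_add1[OF s(3,4) sum[OF w(1,2)] L_smooth[OF that]])
  have "M.jacobiator u v w z = M.jacobiator (\<lambda>z. u1 z + u2 z) (\<lambda>z. v1 z + v2 z) (\<lambda>z. w1 z + w2 z) z"
    using u v w uvw sum by (intro M.jacobiator_cong) auto
  also have "\<dots> = 0"
    using v0[OF u(1)] v0[OF u(2)] cyc[of u1 "\<lambda>z. v1 z + v2 z" "\<lambda>z. w1 z + w2 z"] cyc[of u2 "\<lambda>z. v1 z + v2 z" "\<lambda>z. w1 z + w2 z"]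
    by (simp add: M.jacobiator_add1[OF s(1,2) sum[OF v(1,2)] sum[OF w(1,2)]])
  finally show "M.jacobiator u v w z = 0" .
qed

end

section \<open>The connection on lifted forms\<close>

context warped_product
begin

abbreviation "\<omega> \<equiv> J_field PB B.g (differential B f)"

text \<open>By \<open>along_f\<close> this is minus the derivative of log f along the anchor of
  \<alpha>. It is the factor by which \<alpha> scales fibre forms under the connection.\<close>

definition slope :: "('a, 'e) form \<Rightarrow> 'a \<Rightarrow> real" where
  "slope \<alpha> p = B.g p (\<omega> p) (\<alpha> p) * inverse (f p)"

text \<open>The coefficient 1/f^3 in the horizontal part of \<open>D U V\<close>: 1/f^2 comes from
  the cometric, 1/f from \<open>slope\<close>. The product form suits the Leibniz rule.\<close>

definition inv_cube :: "'a \<Rightarrow> real" where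
  "inv_cube p = inverse (f p) * (inverse (f p) * inverse (f p))"

lemma omega_form: "\<omega> \<in> B.\<Omega>"
  by (intro B.J_field_one_form B.differential_one_form smooth_f)

text \<open>The sign comes from antisymmetry: \<open>df\<close> stands in the second slot of the
  bivector here, but in the first one in \<open>J df\<close>.\<close>

lemma along_f: "B.along \<alpha> f p = - B.g p (\<omega> p) (\<alpha> p)"
  by (simp add: B.cometric_J_field B.along_def B.P_antisym[of p "\<alpha> p"])

lemma smooth_inverse_f: "smooth_fun B (\<lambda>p. inverse (f p))"
  by (rule B.smooth_fun_on_inverse[OF open_UNIV smooth_f]) simp

lemma smooth_inv_cube: "smooth_fun B inv_cube"
  unfolding inv_cube_def by (intro B.smooth_fun_on_mult open_UNIV smooth_inverse_f)

lemma smooth_slope: "\<alpha> \<in> B.\<Omega> \<Longrightarrow> smooth_fun B (slope \<alpha>)"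
  unfolding slope_def by (intro B.smooth_fun_on_mult open_UNIV smooth_inverse_f B.smooth_cometric omega_form)

text \<open>Obtained by differentiating the constant \<open>f * inverse f\<close>.\<close>

lemma along_inverse_f: "B.along \<alpha> (\<lambda>p. inverse (f p)) p = slope \<alpha> p * inverse (f p)"
proof -
  have "0 = B.along \<alpha> (\<lambda>p. f p * inverse (f p)) p" by (simp add: B.along_const)
  also have "\<dots> = f p * B.along \<alpha> (\<lambda>p. inverse (f p)) p - inverse (f p) * B.g p (\<omega> p) (\<alpha> p)"
    by (subst B.along_mult) (simp_all add: smooth_f smooth_inverse_f along_f)
  finally show ?thesis by (simp add: slope_def field_simps)
qed

lemma along_inverse_f2: "B.along \<alpha> (\<lambda>p. inverse ((f p)\<^sup>2)) p = 2 * slope \<alpha> p * inverse ((f p)\<^sup>2)"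
proof -
  have "(\<lambda>p. inverse ((f p)\<^sup>2)) = (\<lambda>p. inverse (f p) * inverse (f p))" by (simp add: power2_eq_square)
  then show ?thesis by (simp add: B.along_mult smooth_inverse_f along_inverse_f power2_eq_square)
qed

lemma along_inv_cube: "B.along \<alpha> inv_cube p = 3 * slope \<alpha> p * inv_cube p"
  unfolding inv_cube_def
  by (simp add: B.along_mult B.smooth_fun_on_mult smooth_inverse_f along_inverse_f algebra_simps)

lemma smooth_inverse_f2: "smooth_fun B (\<lambda>p. inverse ((f p)\<^sup>2))"
  unfolding power2_eq_square inverse_mult_distrib by (intro B.smooth_fun_on_mult open_UNIV smooth_inverse_f)

text \<open>The derivative of 1/f^2 in base directions is the only coupling between the factors;
  every further warping term goes back to the factor \<open>2 * slope \<alpha>\<close>.\<close>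

lemma along_cometric_vv:
  assumes "\<gamma> \<in> F.\<Omega>" "\<delta> \<in> F.\<Omega>"
  shows "M.along (hlift \<alpha>) (\<lambda>z. M.g z (vlift \<gamma> z) (vlift \<delta> z)) z =
      2 * slope \<alpha> (fst z) * M.g z (vlift \<gamma> z) (vlift \<delta> z)"
    "M.along (vlift \<beta>) (\<lambda>z. M.g z (vlift \<gamma> z) (vlift \<delta> z)) z =
      inverse ((f (fst z))\<^sup>2) * F.along \<beta> (\<lambda>q. F.g q (\<gamma> q) (\<delta> q)) (snd z)"
  unfolding cometric_lift
  using smooth_fun_lift(1)[OF smooth_inverse_f2] smooth_fun_lift(2)[OF F.smooth_cometric[OF assms]]
  by (simp_all add: M.along_mult along_h[OF smooth_inverse_f2] along_v[OF F.smooth_cometric[OF assms]] along_inverse_f2)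

lemma along_cometric_hh:
  assumes "\<gamma> \<in> B.\<Omega>" "\<delta> \<in> B.\<Omega>"
  shows "M.along (hlift \<alpha>) (\<lambda>z. M.g z (hlift \<gamma> z) (hlift \<delta> z)) z = B.along \<alpha> (\<lambda>p. B.g p (\<gamma> p) (\<delta> p)) (fst z)"
    "M.along (vlift \<beta>) (\<lambda>z. M.g z (hlift \<gamma> z) (hlift \<delta> z)) z = 0"
  unfolding cometric_lift by (simp_all add: along_h[OF B.smooth_cometric[OF assms]])

lemma along_cometric_hv:
  "M.along \<alpha> (\<lambda>z. M.g z (hlift \<gamma> z) (vlift \<delta> z)) z = 0" "M.along \<alpha> (\<lambda>z. M.g z (vlift \<delta> z) (hlift \<gamma> z)) z = 0"
  by (simp_all add: cometric_lift M.along_const)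

lemmas along_cometric = along_cometric_vv along_cometric_hh along_cometric_hv
lemmas br_lift = br_hh br_vv br_hv
lemmas forms = hlift_form vlift_form omega_form B.D_form F.D_form M.D_form

lemma D_hh:
  assumes "\<alpha> \<in> B.\<Omega>" "\<beta> \<in> B.\<Omega>"
  shows "D (hlift \<alpha>) (hlift \<beta>) = hlift (DB \<alpha> \<beta>)"
proof (rule ext, rule lift_eqI)
  fix z \<gamma> assume \<gamma>: "\<gamma> \<in> B.\<Omega>"
  have "2 * M.g z (D (hlift \<alpha>) (hlift \<beta>) z) (hlift \<gamma> z) = 2 * B.g (fst z) (DB \<alpha> \<beta> (fst z)) (\<gamma> (fst z))"
    using assms \<gamma> by (simp add: M.koszul_formula B.koszul_formula forms along_cometric br_lift) (simp add: cometric_lift)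
  then show "M.g z (D (hlift \<alpha>) (hlift \<beta>) z) (hlift \<gamma> z) = M.g z (hlift (DB \<alpha> \<beta>) z) (hlift \<gamma> z)"
    by (simp add: cometric_lift)
next
  fix z \<delta> assume \<delta>: "\<delta> \<in> F.\<Omega>"
  have "2 * M.g z (D (hlift \<alpha>) (hlift \<beta>) z) (vlift \<delta> z) = 0"
    using assms \<delta> by (simp add: M.koszul_formula forms along_cometric br_lift M.cometric_simps) (simp add: cometric_lift)
  then show "M.g z (D (hlift \<alpha>) (hlift \<beta>) z) (vlift \<delta> z) = M.g z (hlift (DB \<alpha> \<beta>) z) (vlift \<delta> z)"
    by (simp add: cometric_lift)
qed

text \<open>Tested on a fibre form, the Koszul formula retains only the base derivative of the fibre
  cometric, since mixed brackets vanish; tested on a base form everything drops out.\<close>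

lemma D_hv:
  assumes "\<alpha> \<in> B.\<Omega>" "\<beta> \<in> F.\<Omega>"
  shows "D (hlift \<alpha>) (vlift \<beta>) = (\<lambda>z. slope \<alpha> (fst z) *\<^sub>R vlift \<beta> z)"
proof (rule ext, rule lift_eqI)
  fix z \<gamma> assume \<gamma>: "\<gamma> \<in> B.\<Omega>"
  have "2 * M.g z (D (hlift \<alpha>) (vlift \<beta>) z) (hlift \<gamma> z) = 0"
    using assms \<gamma> by (simp add: M.koszul_formula forms along_cometric br_lift M.cometric_simps) (simp add: cometric_lift)
  then show "M.g z (D (hlift \<alpha>) (vlift \<beta>) z) (hlift \<gamma> z) = M.g z (slope \<alpha> (fst z) *\<^sub>R vlift \<beta> z) (hlift \<gamma> z)"
    by (simp add: cometric_lift M.cometric_simps)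
next
  fix z \<delta> assume \<delta>: "\<delta> \<in> F.\<Omega>"
  have "2 * M.g z (D (hlift \<alpha>) (vlift \<beta>) z) (vlift \<delta> z) = 2 * slope \<alpha> (fst z) * M.g z (vlift \<beta> z) (vlift \<delta> z)"
    using assms \<delta> by (simp add: M.koszul_formula forms along_cometric br_lift M.cometric_simps) (simp add: cometric_lift)
  then show "M.g z (D (hlift \<alpha>) (vlift \<beta>) z) (vlift \<delta> z) = M.g z (slope \<alpha> (fst z) *\<^sub>R vlift \<beta> z) (vlift \<delta> z)"
    by (simp add: M.cometric_simps)
qed

text \<open>The mixed bracket vanishes, so the absence of torsion makes both orders equal.\<close>

lemma D_vh:
  assumes "\<alpha> \<in> B.\<Omega>" "\<beta> \<in> F.\<Omega>"
  shows "D (vlift \<beta>) (hlift \<alpha>) = (\<lambda>z. slope \<alpha> (fst z) *\<^sub>R vlift \<beta> z)"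
  using M.D_torsion[OF hlift_form[OF assms(1)] vlift_form[OF assms(2)]] br_hv(1)[OF assms]
  by (simp add: D_hv assms fun_eq_iff)

text \<open>Against a base form \<alpha> only the term with the derivative along \<alpha> survives,
  with a minus sign; rewriting \<open>slope \<alpha>\<close> as a product with \<omega> yields the
  horizontal part. The vertical part is the Koszul formula of the fibre scaled by 1/f^2.\<close>

lemma D_vv:
  assumes "\<beta> \<in> F.\<Omega>" "\<gamma> \<in> F.\<Omega>"
  shows "D (vlift \<beta>) (vlift \<gamma>) = (\<lambda>z. vlift (DF \<beta> \<gamma>) z - (F.g (snd z) (\<beta> (snd z)) (\<gamma> (snd z)) * inv_cube (fst z)) *\<^sub>R hlift \<omega> z)"
proof (rule ext, rule lift_eqI)
  fix z \<alpha> assume \<alpha>: "\<alpha> \<in> B.\<Omega>"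
  have "2 * M.g z (D (vlift \<beta>) (vlift \<gamma>) z) (hlift \<alpha> z) = - 2 * slope \<alpha> (fst z) * M.g z (vlift \<beta> z) (vlift \<gamma> z)"
    using assms \<alpha> by (simp add: M.koszul_formula forms along_cometric br_lift M.cometric_simps) (simp add: cometric_lift)
  then show "M.g z (D (vlift \<beta>) (vlift \<gamma>) z) (hlift \<alpha> z) =
      M.g z (vlift (DF \<beta> \<gamma>) z - (F.g (snd z) (\<beta> (snd z)) (\<gamma> (snd z)) * inv_cube (fst z)) *\<^sub>R hlift \<omega> z) (hlift \<alpha> z)"
    by (simp add: cometric_lift M.cometric_simps slope_def inv_cube_def power2_eq_square)
next
  fix z \<delta> assume \<delta>: "\<delta> \<in> F.\<Omega>"
  have "2 * M.g z (D (vlift \<beta>) (vlift \<gamma>) z) (vlift \<delta> z) =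
      inverse ((f (fst z))\<^sup>2) * (2 * F.g (snd z) (DF \<beta> \<gamma> (snd z)) (\<delta> (snd z)))"
    unfolding F.koszul_formula[OF assms \<delta>] using assms \<delta>
    by (simp add: M.koszul_formula forms along_cometric br_lift M.cometric_simps) (simp add: cometric_lift algebra_simps)
  then show "M.g z (D (vlift \<beta>) (vlift \<gamma>) z) (vlift \<delta> z) =
      M.g z (vlift (DF \<beta> \<gamma>) z - (F.g (snd z) (\<beta> (snd z)) (\<gamma> (snd z)) * inv_cube (fst z)) *\<^sub>R hlift \<omega> z) (vlift \<delta> z)"
    by (simp add: cometric_lift M.cometric_simps)
qed

section \<open>Curvature on lifted forms\<close>

lemma curv_hhh:
  assumes "\<alpha> \<in> B.\<Omega>" "\<beta> \<in> B.\<Omega>" "\<gamma> \<in> B.\<Omega>"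
  shows "M.curv (hlift \<alpha>) (hlift \<beta>) (hlift \<gamma>) z = hlift (B.curv \<alpha> \<beta> \<gamma>) z"
  using assms by (simp add: curvature_def D_hh br_hh B.D_form B.br_form lift_simps)

lemma D_zero: "\<gamma> \<in> M.\<Omega> \<Longrightarrow> D (\<lambda>z. 0) \<gamma> = (\<lambda>z. 0)"
  using M.D_mult(1)[OF M.one_forms_zero _ M.smooth_fun_on_const[of UNIV 0], of \<gamma>] by simp

lemma smooth_slope_lift: "\<alpha> \<in> B.\<Omega> \<Longrightarrow> smooth_fun M (\<lambda>z. slope \<alpha> (fst z))"
  by (rule smooth_fun_lift(1)[OF smooth_slope])

lemma smooth_inv_cube_lift: "smooth_fun M (\<lambda>z. inv_cube (fst z))"
  by (rule smooth_fun_lift(1)[OF smooth_inv_cube])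

lemma smooth_gF_lift: "\<beta> \<in> F.\<Omega> \<Longrightarrow> \<gamma> \<in> F.\<Omega> \<Longrightarrow> smooth_fun M (\<lambda>z. F.g (snd z) (\<beta> (snd z)) (\<gamma> (snd z)))"
  using smooth_fun_lift(2)[OF F.smooth_cometric] by blast

text \<open>The vertical terms cancel and the bracket is 0. Differentiating 1/f^3 gives three times
  \<open>slope \<alpha>\<close> along \<omega>, and the opposite order of derivatives takes one of
  them back.\<close>

lemma curv_hvv:
  assumes "\<alpha> \<in> B.\<Omega>" "U \<in> F.\<Omega>" "W \<in> F.\<Omega>"
  shows "M.curv (hlift \<alpha>) (vlift U) (vlift W) z = - (F.g (snd z) (U (snd z)) (W (snd z)) * inv_cube (fst z)) *\<^sub>R
      (hlift (DB \<alpha> \<omega>) z + (2 * slope \<alpha> (fst z)) *\<^sub>R hlift \<omega> z)"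
proof -
  let ?w = "\<lambda>z. F.g (snd z) (U (snd z)) (W (snd z))"
  have wc: "smooth_fun M (\<lambda>z. ?w z * inv_cube (fst z))"
    by (intro M.smooth_fun_on_mult open_UNIV smooth_gF_lift smooth_inv_cube_lift assms)
  have 1: "D (hlift \<alpha>) (D (vlift U) (vlift W)) z = slope \<alpha> (fst z) *\<^sub>R vlift (DF U W) z -
      ((?w z * inv_cube (fst z)) *\<^sub>R hlift (DB \<alpha> \<omega>) z + (?w z * (3 * slope \<alpha> (fst z) * inv_cube (fst z))) *\<^sub>R hlift \<omega> z)"
    using assms wc
    by (simp add: D_vv M.D_add M.D_mult forms M.one_forms_mult D_hv D_hh M.along_mult smooth_gF_lift smooth_inv_cube_lift
        along_h[OF smooth_inv_cube] along_v[OF F.smooth_cometric] along_inv_cube)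
  have 2: "D (vlift U) (D (hlift \<alpha>) (vlift W)) z = slope \<alpha> (fst z) *\<^sub>R (vlift (DF U W) z - (?w z * inv_cube (fst z)) *\<^sub>R hlift \<omega> z)"
    using assms by (simp add: D_hv M.D_mult forms smooth_slope_lift D_vv along_h[OF smooth_slope])
  have 3: "D (M.br (hlift \<alpha>) (vlift U)) (vlift W) z = 0"
    using assms by (simp add: br_hv D_zero forms)
  show ?thesis
    unfolding curvature_def 1 2 3
    by (rule blinfun_eqI)
      (simp add: blinfun.add_left blinfun.diff_left blinfun.scaleR_left blinfun.minus_left algebra_simps)
qed

text \<open>Differentiating \<open>slope \<beta>\<close> by metric compatibility produces
  \<open>slope (DB \<alpha> \<beta>)\<close>, which cancels the other order of derivatives. One
  product of slopes comes from differentiating 1/f, the second from scaling twice.\<close>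

lemma curv_vhh:
  assumes "\<alpha> \<in> B.\<Omega>" "\<beta> \<in> B.\<Omega>" "U \<in> F.\<Omega>"
  shows "M.curv (vlift U) (hlift \<alpha>) (hlift \<beta>) z =
      - (B.g (fst z) (DB \<alpha> \<omega> (fst z)) (\<beta> (fst z)) * inverse (f (fst z)) + 2 * slope \<alpha> (fst z) * slope \<beta> (fst z)) *\<^sub>R vlift U z"
proof -
  have 1: "D (vlift U) (D (hlift \<alpha>) (hlift \<beta>)) z = slope (DB \<alpha> \<beta>) (fst z) *\<^sub>R vlift U z"
    using assms by (simp add: D_hh D_vh forms)
  have 2: "D (hlift \<alpha>) (D (vlift U) (hlift \<beta>)) z =
      slope \<beta> (fst z) *\<^sub>R slope \<alpha> (fst z) *\<^sub>R vlift U z + B.along \<alpha> (slope \<beta>) (fst z) *\<^sub>R vlift U z"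
    using assms by (simp add: D_vh M.D_mult forms smooth_slope_lift D_hv along_h[OF smooth_slope])
  have 3: "D (M.br (vlift U) (hlift \<alpha>)) (hlift \<beta>) z = 0"
    using assms by (simp add: br_hv D_zero forms)
  have *: "slope \<beta> = (\<lambda>p. B.g p (\<omega> p) (\<beta> p) * inverse (f p))" by (simp add: fun_eq_iff slope_def)
  have "B.along \<alpha> (slope \<beta>) (fst z) = B.g (fst z) (\<omega> (fst z)) (\<beta> (fst z)) * (slope \<alpha> (fst z) * inverse (f (fst z))) +
      inverse (f (fst z)) * (B.g (fst z) (DB \<alpha> \<omega> (fst z)) (\<beta> (fst z)) + B.g (fst z) (\<omega> (fst z)) (DB \<alpha> \<beta> (fst z)))"
    unfolding * using assms by (simp add: B.along_mult smooth_inverse_f B.smooth_cometric omega_form along_inverse_f B.D_metric)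
  then show ?thesis
    unfolding curvature_def 1 2 3 by (simp add: slope_def algebra_simps flip: scaleR_add_left)
qed

text \<open>The horizontal terms cancel: their part antisymmetric in \<open>U\<close> and
  \<open>W\<close> is the fibre product of the bracket of \<open>U\<close> and \<open>W\<close> with
  \<open>Z\<close>, which the bracket term removes. What remains beyond the fibre curvature comes
  from \<open>D U \<omega>\<close>, a multiple of \<open>U\<close>.\<close>

lemma curv_vvv:
  assumes "U \<in> F.\<Omega>" "W \<in> F.\<Omega>" "Z \<in> F.\<Omega>"
  shows "M.curv (vlift U) (vlift W) (vlift Z) z = vlift (F.curv U W Z) z - (inv_cube (fst z) * slope \<omega> (fst z)) *\<^sub>R
      (F.g (snd z) (W (snd z)) (Z (snd z)) *\<^sub>R vlift U z - F.g (snd z) (U (snd z)) (Z (snd z)) *\<^sub>R vlift W z)"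
proof -
  let ?q = "snd z"
  have DD: "D (vlift U) (D (vlift W) (vlift Z)) z = vlift (DF U (DF W Z)) z
      - (F.g ?q (U ?q) (DF W Z ?q) * inv_cube (fst z)) *\<^sub>R hlift \<omega> z
      - ((F.g ?q (W ?q) (Z ?q) * inv_cube (fst z)) *\<^sub>R (slope \<omega> (fst z) *\<^sub>R vlift U z) +
         (inv_cube (fst z) * (F.g ?q (DF U W ?q) (Z ?q) + F.g ?q (W ?q) (DF U Z ?q))) *\<^sub>R hlift \<omega> z)"
    if "U \<in> F.\<Omega>" "W \<in> F.\<Omega>" "Z \<in> F.\<Omega>" for U W Z
  proof -
    have wc: "smooth_fun M (\<lambda>z. F.g (snd z) (W (snd z)) (Z (snd z)) * inv_cube (fst z))"
      by (intro M.smooth_fun_on_mult open_UNIV smooth_gF_lift smooth_inv_cube_lift that)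
    show ?thesis
      using that wc
      by (simp add: D_vv M.D_add M.D_mult forms M.one_forms_mult D_vh M.along_mult smooth_gF_lift smooth_inv_cube_lift
          along_h[OF smooth_inv_cube] along_v[OF F.smooth_cometric] F.D_metric)
  qed
  have br: "D (M.br (vlift U) (vlift W)) (vlift Z) z = vlift (DF (F.br U W) Z) z
      - ((F.g ?q (DF U W ?q) (Z ?q) - F.g ?q (DF W U ?q) (Z ?q)) * inv_cube (fst z)) *\<^sub>R hlift \<omega> z"
    using assms by (simp add: br_vv D_vv F.br_form) (simp add: F.D_torsion F.cometric_simps)
  have F: "vlift (F.curv U W Z) z = vlift (DF U (DF W Z)) z - vlift (DF W (DF U Z)) z - vlift (DF (F.br U W) Z) z"
    by (simp add: curvature_def lift_simps)
  show ?thesis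
    unfolding curvature_def[of M] DD[OF assms] DD[OF assms(2,1,3)] br F
    by (rule blinfun_eqI) (simp add: blinfun.diff_left blinfun.add_left blinfun.scaleR_left algebra_simps)
qed

end

section \<open>Ricci curvature and the Einstein condition\<close>

context warped_product
begin

lemma f_cancel:
  "f p * (f p * (inverse ((f p)\<^sup>2) * x)) = x" "(f p)\<^sup>2 * (inverse ((f p)\<^sup>2) * x) = x" "(f p)\<^sup>2 * inverse ((f p)\<^sup>2) = 1"
proof -
  show *: "(f p)\<^sup>2 * inverse ((f p)\<^sup>2) = 1" by simp
  have "(f p)\<^sup>2 * (inverse ((f p)\<^sup>2) * x) = (f p)\<^sup>2 * inverse ((f p)\<^sup>2) * x"
    "f p * (f p * (inverse ((f p)\<^sup>2) * x)) = (f p)\<^sup>2 * inverse ((f p)\<^sup>2) * x"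
    by (simp_all only: power2_eq_square mult.assoc)
  then show "f p * (f p * (inverse ((f p)\<^sup>2) * x)) = x" "(f p)\<^sup>2 * (inverse ((f p)\<^sup>2) * x) = x"
    by (simp_all only: * mult_1_left)
qed

abbreviation "ric \<equiv> ricci M P M.g D"
abbreviation "ricB \<equiv> ricci B PB B.g DB"
abbreviation "ricF \<equiv> ricci F PF F.g DF"
abbreviation "hess \<equiv> contravariant_hessian B PB B.g DB f"
abbreviation "lap \<equiv> contravariant_laplacian B PB B.g DB f"
abbreviation "\<eta> \<equiv> local_coframe B B.g"
abbreviation "\<zeta> \<equiv> local_coframe F F.g"
abbreviation "signB p i \<equiv> B.g p (\<eta> p i p) (\<eta> p i p)"
abbreviation "signF q j \<equiv> F.g q (\<zeta> q j q) (\<zeta> q j q)"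

text \<open>The factor \<open>f\<close> makes lifted fibre forms unit for a cometric that carries
  1/f^2. Indices from \<open>DIM('e)\<close> on belong to the fibre.\<close>

definition coframe :: "'a \<Rightarrow> 'b \<Rightarrow> nat \<Rightarrow> ('a \<times> 'b, 'e \<times> 'f) form" where
  "coframe p q i = (if i < DIM('e) then hlift (\<eta> p i)
     else (\<lambda>z. f (fst z) *\<^sub>R vlift (\<zeta> q (i - DIM('e))) z))"

lemma coframe_orthonormal:
  obtains U where "(p, q) \<in> U" "orthonormal_coframe M M.g U (coframe p q)"
proof -
  let ?\<zeta> = "\<lambda>i. \<zeta> q (i - DIM('e))"
  obtain UB where UB: "p \<in> UB" "orthonormal_coframe B B.g UB (\<eta> p)" by (rule B.local_coframe)
  obtain UF where UF: "q \<in> UF" "orthonormal_coframe F F.g UF (\<zeta> q)" by (rule F.local_coframe)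
  have less: "i - DIM('e) < DIM('f)" if "i < DIM('e \<times> 'f)" "\<not> i < DIM('e)" for i
    using that by simp
  have "orthonormal_coframe M M.g (UB \<times> UF) (coframe p q)"
    unfolding orthonormal_coframe_def
  proof (intro conjI ballI allI impI)
    fix i assume i: "i < DIM('e \<times> 'f)"
    show "coframe p q i \<in> M.\<Omega>"
    proof (cases "i < DIM('e)")
      case True
      then show ?thesis by (simp add: coframe_def hlift_form B.local_coframe_mem)
    next
      case False
      from less[OF i False] show ?thesis
        using False by (simp add: coframe_def M.one_forms_mult smooth_fun_lift(1)[OF smooth_f] vlift_form F.local_coframe_mem)
    qed
    fix z :: "'a \<times> 'b" assume "z \<in> UB \<times> UF"
    then have z: "fst z \<in> UB" "snd z \<in> UF" by auto
    show "M.g z (coframe p q i z) (coframe p q i z) \<in> {1, -1}"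
    proof (cases "i < DIM('e)")
      case True
      then have "M.g z (coframe p q i z) (coframe p q i z) = B.g (fst z) (\<eta> p i (fst z)) (\<eta> p i (fst z))"
        by (simp add: coframe_def cometric_lift)
      then show ?thesis using orthonormal_coframeD(2)[OF UB(2) True z(1)] by simp
    next
      case False
      then have *: "M.g z (coframe p q i z) (coframe p q i z) = F.g (snd z) (?\<zeta> i (snd z)) (?\<zeta> i (snd z))"
        by (simp only: coframe_def if_False M.cometric_simps cometric_lift f_cancel)
      show ?thesis unfolding * by (rule orthonormal_coframeD(2)[OF UF(2) less[OF i False] z(2)])
    qed
    fix j assume j: "j < DIM('e \<times> 'f)" "i \<noteq> j"
    show "M.g z (coframe p q i z) (coframe p q j z) = 0"
    proof (cases "i < DIM('e)"; cases "j < DIM('e)")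
      assume ij: "i < DIM('e)" "j < DIM('e)"
      then show ?thesis using orthonormal_coframeD(3)[OF UB(2) ij j(2) z(1)] by (simp add: coframe_def cometric_lift)
    next
      assume ij: "\<not> i < DIM('e)" "\<not> j < DIM('e)"
      then have "i - DIM('e) \<noteq> j - DIM('e)" using j(2) by simp
      then show ?thesis
        using orthonormal_coframeD(3)[OF UF(2) less[OF i ij(1)] less[OF j(1) ij(2)] _ z(2)] ij
        by (simp add: coframe_def M.cometric_simps cometric_lift)
    qed (simp_all add: coframe_def M.cometric_simps cometric_lift)
  qed
  from that[OF _ this] UB(1) UF(1) show thesis by simp
qed

text \<open>Tensoriality in the second and third arguments pulls both factors \<open>f\<close> of
  the fibre coframe out of the curvature, which gives \<open>(f p)\<^sup>2\<close>; the signs are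
  those of the factors.\<close>

lemma ricci_prod:
  assumes "\<alpha> \<in> M.\<Omega>"
  shows "ric \<alpha> \<beta> (p, q) =
     (\<Sum>i<DIM('e). signB p i * M.g (p, q) (M.curv \<alpha> (hlift (\<eta> p i)) (hlift (\<eta> p i)) (p, q)) (\<beta> (p, q))) +
     (\<Sum>j<DIM('f). signF q j * (f p)\<^sup>2 * M.g (p, q) (M.curv \<alpha> (vlift (\<zeta> q j)) (vlift (\<zeta> q j)) (p, q)) (\<beta> (p, q)))"
proof -
  obtain U where U: "(p, q) \<in> U" "orthonormal_coframe M M.g U (coframe p q)" by (rule coframe_orthonormal)
  let ?h = "\<lambda>i. M.g (p, q) (coframe p q i (p, q)) (coframe p q i (p, q)) *
      M.g (p, q) (M.curv \<alpha> (coframe p q i) (coframe p q i) (p, q)) (\<beta> (p, q))"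
  have "ric \<alpha> \<beta> (p, q) = (\<Sum>i<DIM('e) + DIM('f). ?h i)"
    using M.ricci_coframe[OF poisson_prod assms U(2,1)] by simp
  also have "\<dots> = (\<Sum>i<DIM('e). ?h i) + (\<Sum>j<DIM('f). ?h (DIM('e) + j))"
    by (rule sum_lessThan_add)
  also have "(\<Sum>i<DIM('e). ?h i) = (\<Sum>i<DIM('e). signB p i * M.g (p, q) (M.curv \<alpha> (hlift (\<eta> p i)) (hlift (\<eta> p i)) (p, q)) (\<beta> (p, q)))"
    by (simp add: coframe_def cometric_lift)
  also have "(\<Sum>j<DIM('f). ?h (DIM('e) + j)) = (\<Sum>j<DIM('f). signF q j * (f p)\<^sup>2 * M.g (p, q) (M.curv \<alpha> (vlift (\<zeta> q j)) (vlift (\<zeta> q j)) (p, q)) (\<beta> (p, q)))"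
  proof (rule sum.cong[OF refl])
    fix j assume "j \<in> {..<DIM('f)}"
    then have \<zeta>: "\<zeta> q j \<in> F.\<Omega>" using F.local_coframe_mem by auto
    note f = smooth_fun_lift(1)[OF smooth_f]
    have "M.curv \<alpha> (\<lambda>z. f (fst z) *\<^sub>R vlift (\<zeta> q j) z) (\<lambda>z. f (fst z) *\<^sub>R vlift (\<zeta> q j) z) (p, q) =
        (f p)\<^sup>2 *\<^sub>R M.curv \<alpha> (vlift (\<zeta> q j)) (vlift (\<zeta> q j)) (p, q)"
      using assms vlift_form[OF \<zeta>]
      by (simp add: M.curv_mult2 M.curv_mult3[OF poisson_prod] f M.one_forms_mult power2_eq_square)
    then show "?h (DIM('e) + j) = (signF q j * (f p)\<^sup>2 * M.g (p, q) (M.curv \<alpha> (vlift (\<zeta> q j)) (vlift (\<zeta> q j)) (p, q)) (\<beta> (p, q)))"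
      by (simp add: coframe_def cometric_lift M.cometric_simps f_cancel)
  qed
  finally show ?thesis .
qed

text \<open>Both curvature expressions that occur are horizontal, hence orthogonal to fibre
  forms.\<close>

lemma ricci_hv:
  assumes "\<alpha> \<in> B.\<Omega>"
  shows "ric (hlift \<alpha>) (vlift \<delta>) (p, q) = 0"
  using assms B.local_coframe_mem(1) F.local_coframe_mem(1)
  by (simp add: ricci_prod hlift_form curv_hhh curv_hvv M.cometric_simps cometric_lift)

text \<open>Both curvature expressions that occur are vertical, hence orthogonal to base
  forms.\<close>

lemma ricci_vh:
  assumes "\<gamma> \<in> F.\<Omega>"
  shows "ric (vlift \<gamma>) (hlift \<beta>) (p, q) = 0"
  using assms B.local_coframe_mem(1) F.local_coframe_mem(1)
  by (simp add: ricci_prod vlift_form curv_vhh curv_vvv M.cometric_simps cometric_lift)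

text \<open>The base part of the trace is the Ricci curvature of the base; in the fibre part every
  coframe element contributes the same amount, whence the factor \<open>DIM('f)\<close>.\<close>

lemma ricci_hh:
  assumes "\<alpha> \<in> B.\<Omega>" "\<beta> \<in> B.\<Omega>"
  shows "ric (hlift \<alpha>) (hlift \<beta>) (p, q) = ricB \<alpha> \<beta> p - real DIM('f) / (f p)\<^sup>2 *
     (2 * (B.g p (\<omega> p) (\<alpha> p) * B.g p (\<omega> p) (\<beta> p)) - f p * hess \<alpha> \<beta> p)"
proof -
  let ?A = "2 * (B.g p (\<omega> p) (\<alpha> p) * B.g p (\<omega> p) (\<beta> p)) - f p * hess \<alpha> \<beta> p"
  have "(\<Sum>j<DIM('f). signF q j * (f p)\<^sup>2 * M.g (p, q) (M.curv (hlift \<alpha>) (vlift (\<zeta> q j)) (vlift (\<zeta> q j)) (p, q)) (hlift \<beta> (p, q))) =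
      (\<Sum>j<DIM('f). - (?A / (f p)\<^sup>2))"
  proof (rule sum.cong[OF refl])
    fix j assume "j \<in> {..<DIM('f)}"
    then have \<zeta>: "\<zeta> q j \<in> F.\<Omega>"
      "signF q j \<in> {1, -1}" using F.local_coframe_mem by auto
    \<comment> \<open>One sign comes from the trace, the other from the square of the coframe
      element inside the curvature.\<close>
    then have s: "signF q j * signF q j = 1"
      by auto
    have "(signF q j * (f p)\<^sup>2) *
        (- (signF q j * inv_cube p) * x) =
        - (signF q j * signF q j)
          * ((f p)\<^sup>2 * inv_cube p * x)" for x
      by (simp add: algebra_simps)
    moreover have "(f p)\<^sup>2 * inv_cube p * (B.g p (DB \<alpha> \<omega> p) (\<beta> p) + 2 * slope \<alpha> p * B.g p (\<omega> p) (\<beta> p)) = ?A / (f p)\<^sup>2"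
      by (simp add: inv_cube_def slope_def contravariant_hessian_def power2_eq_square field_simps)
    ultimately show "(signF q j * (f p)\<^sup>2 * M.g (p, q) (M.curv (hlift \<alpha>) (vlift (\<zeta> q j)) (vlift (\<zeta> q j)) (p, q)) (hlift \<beta> (p, q))) = - (?A / (f p)\<^sup>2)"
      using \<zeta>(1) assms
      by (simp only: curv_hvv M.cometric_simps cometric_lift fst_conv snd_conv s mult_minus_left mult_1_left)
  qed
  moreover have "(\<Sum>i<DIM('e). signB p i * M.g (p, q) (M.curv (hlift \<alpha>) (hlift (\<eta> p i)) (hlift (\<eta> p i)) (p, q)) (hlift \<beta> (p, q))) = ricB \<alpha> \<beta> p"
    using assms B.local_coframe_mem by (simp add: curv_hhh cometric_lift ricci_def Let_def)
  ultimately show ?thesis by (simp add: ricci_prod hlift_form assms)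
qed

text \<open>The base trace contributes the Laplacian and twice the squared norm of \<omega>, the
  fibre trace \<open>DIM('f)\<close> - 1 further copies of it.\<close>

lemma ricci_vv:
  assumes "U \<in> F.\<Omega>" "V \<in> F.\<Omega>"
  shows "ric (vlift U) (vlift V) (p, q) = ricF U V q -
     ((real DIM('f) + 1) * B.g p (\<omega> p) (\<omega> p) + f p * lap p) / (f p) ^ 4 * F.g q (U q) (V q)"
proof -
  let ?g = "F.g q (U q) (V q)" and ?w = "B.g p (\<omega> p) (\<omega> p)"
  obtain UB where UB: "p \<in> UB" "orthonormal_coframe B B.g UB (\<eta> p)" by (rule B.local_coframe)
  obtain UF where UF: "q \<in> UF" "orthonormal_coframe F F.g UF (\<zeta> q)" by (rule F.local_coframe)
  have 1: "(\<Sum>i<DIM('e). signB p i * M.g (p, q) (M.curv (vlift U) (hlift (\<eta> p i)) (hlift (\<eta> p i)) (p, q)) (vlift V (p, q))) =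
      - (lap p * inverse (f p) + 2 * ?w * inverse ((f p)\<^sup>2)) * (inverse ((f p)\<^sup>2) * ?g)"
  proof -
    have "signB p i * M.g (p, q) (M.curv (vlift U) (hlift (\<eta> p i)) (hlift (\<eta> p i)) (p, q)) (vlift V (p, q)) =
       - ((signB p i * B.g p (DB (\<eta> p i) \<omega> p) (\<eta> p i p)) * inverse (f p) +
          2 * (signB p i * (B.g p (\<omega> p) (\<eta> p i p) * B.g p (\<eta> p i p) (\<omega> p))) * inverse ((f p)\<^sup>2)) * (inverse ((f p)\<^sup>2) * ?g)"
      if "i < DIM('e)" for i
      using B.local_coframe_mem(1)[OF that, of p] assms
      by (simp add: curv_vhh M.cometric_simps cometric_lift slope_def power2_eq_square B.cometric_sym[of p "\<eta> p i p" "\<omega> p"] algebra_simps)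
    then have "(\<Sum>i<DIM('e). signB p i * M.g (p, q) (M.curv (vlift U) (hlift (\<eta> p i)) (hlift (\<eta> p i)) (p, q)) (vlift V (p, q))) =
       (\<Sum>i<DIM('e). - ((signB p i * B.g p (DB (\<eta> p i) \<omega> p) (\<eta> p i p)) * inverse (f p) +
          2 * (signB p i * (B.g p (\<omega> p) (\<eta> p i p) * B.g p (\<eta> p i p) (\<omega> p))) * inverse ((f p)\<^sup>2)) * (inverse ((f p)\<^sup>2) * ?g))"
      by simp
    also have "\<dots> = - ((\<Sum>i<DIM('e). signB p i * B.g p (DB (\<eta> p i) \<omega> p) (\<eta> p i p)) * inverse (f p) +
          2 * (\<Sum>i<DIM('e). signB p i * (B.g p (\<omega> p) (\<eta> p i p) * B.g p (\<eta> p i p) (\<omega> p))) * inverse ((f p)\<^sup>2)) * (inverse ((f p)\<^sup>2) * ?g)"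
      by (simp only: sum_distrib_left sum_distrib_right sum.distrib[symmetric] sum_negf[symmetric])
    finally show ?thesis
      by (simp only: B.sum_coframe[OF UB(2,1)])
        (simp add: contravariant_laplacian_def contravariant_hessian_def Let_def sum_negf)
  qed
  \<comment> \<open>The curvature of the fibre part has the shape of constant curvature up to
    \<open>F.curv\<close>; tracing gives dimension minus one, where the subtracted copy is the
    contraction of the coframe.\<close>
  have 2: "(\<Sum>j<DIM('f). signF q j * (f p)\<^sup>2 * M.g (p, q) (M.curv (vlift U) (vlift (\<zeta> q j)) (vlift (\<zeta> q j)) (p, q)) (vlift V (p, q))) =
      ricF U V q - (inv_cube p * slope \<omega> p) * (real DIM('f) * ?g - ?g)"
  proof -
    have "signF q j * (f p)\<^sup>2 * M.g (p, q) (M.curv (vlift U) (vlift (\<zeta> q j)) (vlift (\<zeta> q j)) (p, q)) (vlift V (p, q)) =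
        signF q j * F.g q (F.curv U (\<zeta> q j) (\<zeta> q j) q) (V q) -
        (inv_cube p * slope \<omega> p) * (?g - signF q j * (F.g q (U q) (\<zeta> q j q) * F.g q (\<zeta> q j q) (V q)))"
      if "j < DIM('f)" for j
    proof -
      have s: "signF q j * signF q j = 1" using F.local_coframe_mem(2)[OF that, of q] by auto
      then have s': "signF q j * (signF q j * x) = x" for x by (simp flip: mult.assoc)
      have "signF q j * (f p)\<^sup>2 * M.g (p, q) (M.curv (vlift U) (vlift (\<zeta> q j)) (vlift (\<zeta> q j)) (p, q)) (vlift V (p, q)) =
          signF q j * ((f p)\<^sup>2 * inverse ((f p)\<^sup>2)) * (F.g q (F.curv U (\<zeta> q j) (\<zeta> q j) q) (V q) -
          (inv_cube p * slope \<omega> p) * (signF q j * ?g - F.g q (U q) (\<zeta> q j q) * F.g q (\<zeta> q j q) (V q)))"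
        using F.local_coframe_mem(1)[OF that, of q] assms
        by (simp only: curv_vvv M.cometric_simps cometric_lift fst_conv snd_conv) (simp add: algebra_simps f_cancel)
      then show ?thesis by (simp add: right_diff_distrib s' mult.left_commute)
    qed
    then have "(\<Sum>j<DIM('f). signF q j * (f p)\<^sup>2 * M.g (p, q) (M.curv (vlift U) (vlift (\<zeta> q j)) (vlift (\<zeta> q j)) (p, q)) (vlift V (p, q))) =
        (\<Sum>j<DIM('f). signF q j * F.g q (F.curv U (\<zeta> q j) (\<zeta> q j) q) (V q) -
        (inv_cube p * slope \<omega> p) * (?g - signF q j * (F.g q (U q) (\<zeta> q j q) * F.g q (\<zeta> q j q) (V q))))"
      by simp
    also have "\<dots> = ricF U V q - (inv_cube p * slope \<omega> p) * (real DIM('f) * ?g -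
        (\<Sum>j<DIM('f). signF q j * (F.g q (U q) (\<zeta> q j q) * F.g q (\<zeta> q j q) (V q))))"
      by (simp add: sum_subtractf ricci_def Let_def flip: sum_distrib_left)
    finally show ?thesis by (simp only: F.sum_coframe[OF UF(2,1)])
  qed
  have "ric (vlift U) (vlift V) (p, q) =
      - (lap p * inverse (f p) + 2 * ?w * inverse ((f p)\<^sup>2)) * (inverse ((f p)\<^sup>2) * ?g) +
      (ricF U V q - (inv_cube p * slope \<omega> p) * (real DIM('f) * ?g - ?g))"
    unfolding ricci_prod[OF vlift_form[OF assms(1)]] 1 2 ..
  also have "\<dots> = ricF U V q -
     ((real DIM('f) + 1) * ?w + f p * lap p) / (f p) ^ 4 * ?g"
    by (simp add: inv_cube_def slope_def field_simps power2_eq_square power4_eq_xxxx)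
  finally show ?thesis .
qed

text \<open>The mixed equations read 0 = 0, because Ricci curvature and cometric both vanish there.
  Splitting a form at a point is legitimate since the Ricci curvature depends on point
  values.\<close>

lemma einstein_prod_iff:
  "einstein M P M.g D \<kappa> \<longleftrightarrow>
    (\<forall>\<alpha>\<in>B.\<Omega>. \<forall>\<beta>\<in>B.\<Omega>. \<forall>p q. ric (hlift \<alpha>) (hlift \<beta>) (p, q) = \<kappa> * B.g p (\<alpha> p) (\<beta> p)) \<and>
    (\<forall>U\<in>F.\<Omega>. \<forall>V\<in>F.\<Omega>. \<forall>p q. ric (vlift U) (vlift V) (p, q) = \<kappa> * (inverse ((f p)\<^sup>2) * F.g q (U q) (V q)))"
  (is "_ \<longleftrightarrow> ?H \<and> ?V")
proof
  assume "einstein M P M.g D \<kappa>"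
  then show "?H \<and> ?V" by (simp add: einstein_def hlift_form vlift_form cometric_lift)
next
  assume HV: "?H \<and> ?V"
  show "einstein M P M.g D \<kappa>"
    unfolding einstein_def
  proof (intro ballI allI)
    fix \<alpha> \<beta> and z :: "'a \<times> 'b" assume forms: "\<alpha> \<in> M.\<Omega>" "\<beta> \<in> M.\<Omega>"
    obtain p q where z: "z = (p, q)" by (cases z)
    obtain \<alpha>1 \<alpha>2 where \<alpha>: "\<alpha>1 \<in> B.\<Omega>" "\<alpha>2 \<in> F.\<Omega>" "\<alpha> z = hlift \<alpha>1 (p, q) + vlift \<alpha>2 (p, q)"
      by (rule form_value_split)
    obtain \<beta>1 \<beta>2 where \<beta>: "\<beta>1 \<in> B.\<Omega>" "\<beta>2 \<in> F.\<Omega>" "\<beta> z = hlift \<beta>1 (p, q) + vlift \<beta>2 (p, q)"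
      by (rule form_value_split)
    have "ric \<alpha> \<beta> z = ric (\<lambda>z. hlift \<alpha>1 z + vlift \<alpha>2 z) (\<lambda>z. hlift \<beta>1 z + vlift \<beta>2 z) z"
      using forms \<alpha> \<beta> z by (intro M.ricci_cong poisson_prod M.one_forms_add hlift_form vlift_form) auto
    also have "\<dots> = \<kappa> * M.g z (\<alpha> z) (\<beta> z)"
      using \<alpha> \<beta> HV by (simp add: z M.ricci_add_left M.ricci_add_right hlift_form vlift_form M.one_forms_add ricci_hv ricci_vh
          M.cometric_simps cometric_lift algebra_simps)
    finally show "ric \<alpha> \<beta> z = \<kappa> * M.g z (\<alpha> z) (\<beta> z)" .
  qed
qed

theorem einstein_warped_iff:
  "einstein M P M.g D \<kappa> \<longleftrightarrow>
    (\<exists>\<mu>. (\<forall>\<alpha>\<in>B.\<Omega>. \<forall>\<beta>\<in>B.\<Omega>. \<forall>p. ricB \<alpha> \<beta> p = \<kappa> * B.g p (\<alpha> p) (\<beta> p) + real DIM('f) / (f p)\<^sup>2 *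
        (2 * (B.g p (\<omega> p) (\<alpha> p) * B.g p (\<omega> p) (\<beta> p)) - f p * hess \<alpha> \<beta> p)) \<and>
      einstein F PF F.g DF \<mu> \<and>
      (\<forall>p. \<mu> = 1 / (f p) ^ 4 * (\<kappa> * (f p)\<^sup>2 + (real DIM('f) + 1) * B.g p (\<omega> p) (\<omega> p) +
        f p * lap p)))"
proof -
  \<comment> \<open>The right-hand side of condition (c), still as a function on the base. The
    vertical block of the Einstein equation says that the fibre Ricci curvature is
    \<open>m p\<close> times the fibre cometric, for every \<open>p\<close>.\<close>
  define m where "m p = 1 / (f p) ^ 4 * (\<kappa> * (f p)\<^sup>2 + (real DIM('f) + 1) * B.g p (\<omega> p) (\<omega> p) +
        f p * lap p)" for p
  have m: "ric (vlift U) (vlift V) (p, q) = \<kappa> * (inverse ((f p)\<^sup>2) * F.g q (U q) (V q)) \<longleftrightarrow>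
      ricF U V q = m p * F.g q (U q) (V q)" if "U \<in> F.\<Omega>" "V \<in> F.\<Omega>" for U V p q
  proof -
    have "m p * F.g q (U q) (V q) = \<kappa> * (inverse ((f p)\<^sup>2) * F.g q (U q) (V q)) +
      ((real DIM('f) + 1) * B.g p (\<omega> p) (\<omega> p) + f p * lap p) / (f p) ^ 4 * F.g q (U q) (V q)"
      by (simp add: m_def field_simps power2_eq_square power4_eq_xxxx)
    then show ?thesis unfolding ricci_vv[OF that] by linarith
  qed
  have "(\<forall>U\<in>F.\<Omega>. \<forall>V\<in>F.\<Omega>. \<forall>p q. ricF U V q = m p * F.g q (U q) (V q)) \<longleftrightarrow>
      (\<exists>\<mu>. einstein F PF F.g DF \<mu> \<and> (\<forall>p. \<mu> = m p))"
  proof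
    assume R: "\<forall>U\<in>F.\<Omega>. \<forall>V\<in>F.\<Omega>. \<forall>p q. ricF U V q = m p * F.g q (U q) (V q)"
    fix p0 :: 'a and q :: 'b
    have "m p0 = m p" for p
    proof -
      \<comment> \<open>The fibre has positive dimension, so a coframe element with index 0 exists;
        its square is nonzero and can be cancelled to compare \<open>m\<close> at two base points
        over the same \<open>q\<close>.\<close>
      have \<zeta>: "\<zeta> q 0 \<in> F.\<Omega>" "signF q 0 \<noteq> 0" using F.local_coframe_mem[of 0 q] by auto
      then have "m p0 * signF q 0 = m p * signF q 0" using R by metis
      then show ?thesis using \<zeta>(2) by simp
    qed
    then show "\<exists>\<mu>. einstein F PF F.g DF \<mu> \<and> (\<forall>p. \<mu> = m p)"
      using R by (intro exI[of _ "m p0"]) (simp add: einstein_def)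
  next
    assume "\<exists>\<mu>. einstein F PF F.g DF \<mu> \<and> (\<forall>p. \<mu> = m p)"
    then show "\<forall>U\<in>F.\<Omega>. \<forall>V\<in>F.\<Omega>. \<forall>p q. ricF U V q = m p * F.g q (U q) (V q)"
      by (auto simp: einstein_def)
  qed
  then show ?thesis
    unfolding einstein_prod_iff m_def[symmetric] by (simp add: ricci_hh m diff_eq_eq)
qed

end

theorem theorem4p1:
  fixes B :: "('a::{t2_space, second_countable_topology}, 'e::euclidean_space) mfd"
    and F :: "('b::{t2_space, second_countable_topology}, 'f::euclidean_space) mfd"
    and GB :: "('a, 'e) metric" and GF :: "('b, 'f) metric"
    and PB :: "('a, 'e) bivector" and PF :: "('b, 'f) bivector"
    and f :: "'a \<Rightarrow> real" and lam :: real
    and DB :: "('a, 'e) connection" and DF :: "('b, 'f) connection"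
    and D :: "('a \<times> 'b, 'e \<times> 'f) connection"
  defines "gB \<equiv> cometric GB"
    and "gF \<equiv> cometric GF"
    and "g \<equiv> cometric (warped_metric B F f GB GF)"
    and "P \<equiv> sum_bivector B F PB PF"
    and "s2 \<equiv> real DIM('f)"
    and "Jdf \<equiv> J_field PB (cometric GB) (differential B f)"
  assumes "smooth_manifold B" and "smooth_manifold F"
    and "pseudo_riemannian B GB" and "pseudo_riemannian F GF"
    and "poisson B PB" and "poisson F PF"
    and "smooth_fun B f" and "\<And>p. f p > 0"
    and "contravariant_levi_civita B PB gB DB"
    and "contravariant_levi_civita F PF gF DF"
    and "contravariant_levi_civita (prod_mfd B F) P g D"
  shows "einstein (prod_mfd B F) P g D lam \<longleftrightarrow>
    (\<exists>lam' :: real.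
      (\<forall>\<alpha>\<in>one_forms B. \<forall>\<beta>\<in>one_forms B. \<forall>p.
         ricci B PB gB DB \<alpha> \<beta> p =
           lam * gB p (\<alpha> p) (\<beta> p) +
           s2 / (f p)\<^sup>2 * (2 * (gB p (Jdf p) (\<alpha> p) * gB p (Jdf p) (\<beta> p))
                         - f p * contravariant_hessian B PB gB DB f \<alpha> \<beta> p)) \<and>
      einstein F PF gF DF lam' \<and>
      (\<forall>p. lam' = 1 / (f p) ^ 4 *
         (lam * (f p)\<^sup>2 + (s2 + 1) * gB p (Jdf p) (Jdf p)
          + f p * contravariant_laplacian B PB gB DB f p)))"
proof -
  \<comment> \<open>The locale asks for the bivector field property separately; it is part of
    \<open>poisson\<close>.\<close>
  have bivector_fields: "bivector_field B PB" "bivector_field F PF"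
    using assms(11,12) by (simp_all add: poisson_def)
  interpret warped_product B PB GB DB F PF GF DF f D
    by unfold_locales (rule bivector_fields assms(7-)[unfolded gB_def gF_def g_def P_def])+
  show ?thesis
    unfolding gB_def gF_def g_def P_def s2_def Jdf_def by (rule einstein_warped_iff)
qed

end
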